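(* Let $A\subset\mathbb{C}^m$ and $X\subset\mathbb{C}^n$ be polydisks centered at $0$, and let $J$ be an ideal of $\mathcal{O}_{A\times X}$. The partition of $A$ given by the local Hilbert polynomial of $\mathcal{O}_X/J_{|a}$ at $x=0$ is constructible; that is, the parts of the partition of $A$ defined by the equivalence relation $a\sim a'\iff HSP_{J_{|a}}=HSP_{J_{|a'}}$ are constructible subsets of $A$.
   Context: $x=(x_1,\dots,x_n)$ are the coordinates on $\mathbb{C}^n$. $\mathcal{O}_{A\times X}$ (resp. $\mathcal{O}_X$) is the ring of analytic functions on $A\times X$ (resp. $X$). For $a_0\in A$, $J_{|a_0}\subset\mathcal{O}_X$ is the ideal obtained from $J$ by specializing $a=a_0$; it is identified with its germ at $x=0$, i.e. with the ideal it generates in $\mathbb{C}\{x\}$. Let $\mathfrak{m}$ be the maximal ideal of $\mathbb{C}\{x\}$. For an ideal $I\subset\mathbb{C}\{x\}$, the local Hilbert-Samuel function is $HSF_I(r)=\dim_{\mathbb{C}}\bigl(\mathbb{C}\{x\}/(I+\mathfrak{m}^{r+1})\bigr)$, $r\in\mathbb{N}$, and the local Hilbert polynomial $HSP_I$ is the polynomial with rational coefficients such that $HSP_I(r)=HSF_I(r)$ for all large enough $r\in\mathbb{N}$. A subset of $A$ is locally closed if it is the difference of two closed analytic subsets of $A$, and constructible if it is a finite union of locally closed subsets. *)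

theory Defs
  imports
    "HOL-Analysis.Analysis"
    "HOL-Algebra.QuotRing"
    "HOL-Algebra.Ideal_Product"
    "HOL-Algebra.Embedded_Algebras"
    "HOL-Computational_Algebra.Polynomial"
begin

section \<open>Analytic functions on open sets of complex affine space\<close>

definition monomial :: "complex ^ 'n \<Rightarrow> ('n::finite \<Rightarrow> nat) \<Rightarrow> complex"
  where "monomial z \<alpha> = (\<Prod>i\<in>UNIV. (z $ i) ^ \<alpha> i)"

definition polydisk :: "('n::finite \<Rightarrow> real) \<Rightarrow> (complex ^ 'n) set"
  where "polydisk \<rho> = {z. \<forall>i. norm (z $ i) < \<rho> i}"

text \<open>\<open>f (p + z) = (\<Sum>\<alpha>. c \<alpha> * z\<^sup>\<alpha>)\<close> for all \<open>z\<close> near \<open>0\<close>; the sum over multi-indices is unconditional,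
  hence absolutely convergent. So \<open>c\<close> is the germ of \<open>f\<close> at \<open>p\<close>.\<close>

definition has_power_series ::
    "(complex ^ 'n \<Rightarrow> complex) \<Rightarrow> complex ^ 'n \<Rightarrow> (('n::finite \<Rightarrow> nat) \<Rightarrow> complex) \<Rightarrow> bool"
  where "has_power_series f p c \<longleftrightarrow>
    (\<exists>r>0. \<forall>z\<in>polydisk (\<lambda>_. r). ((\<lambda>\<alpha>. c \<alpha> * monomial z \<alpha>) has_sum f (p + z)) UNIV)"

text \<open>Functions on \<open>U\<close> are represented by total functions that are \<open>undefined\<close> outside \<open>U\<close>.\<close>

definition analytic_functions :: "(complex ^ 'n::finite) set \<Rightarrow> (complex ^ 'n \<Rightarrow> complex) ring"
  where "analytic_functions U =
    \<lparr>carrier = {f \<in> extensional U. \<forall>p\<in>U. \<exists>c. has_power_series f p c},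
     mult = (\<lambda>f g. \<lambda>z\<in>U. f z * g z),
     one = (\<lambda>z\<in>U. 1),
     zero = (\<lambda>z\<in>U. 0),
     add = (\<lambda>f g. \<lambda>z\<in>U. f z + g z)\<rparr>"

section \<open>The ring \<open>\<complex>{x}\<close> of convergent power series\<close>

definition conv_series :: "(('n::finite \<Rightarrow> nat) \<Rightarrow> complex) ring"
  where "conv_series =
    \<lparr>carrier = {c. \<exists>r>0. \<forall>z\<in>polydisk (\<lambda>_. r). (\<lambda>\<alpha>. c \<alpha> * monomial z \<alpha>) summable_on UNIV},
     mult = (\<lambda>c d \<gamma>. \<Sum>\<alpha> | \<alpha> \<le> \<gamma>. c \<alpha> * d (\<lambda>i. \<gamma> i - \<alpha> i)),
     one = (\<lambda>\<alpha>. if \<alpha> = (\<lambda>_. 0) then 1 else 0),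
     zero = (\<lambda>\<alpha>. 0),
     add = (\<lambda>c d \<alpha>. c \<alpha> + d \<alpha>)\<rparr>"

definition const_series :: "complex \<Rightarrow> ('n::finite \<Rightarrow> nat) \<Rightarrow> complex"
  where "const_series k = (\<lambda>\<alpha>. if \<alpha> = (\<lambda>_. 0) then k else 0)"

definition max_ideal :: "(('n::finite \<Rightarrow> nat) \<Rightarrow> complex) set"
  where "max_ideal = {c \<in> carrier conv_series. c (\<lambda>_. 0) = 0}"

section \<open>Local Hilbert-Samuel function and local Hilbert polynomial\<close>

definition HS_ideal ::
    "(('n::finite \<Rightarrow> nat) \<Rightarrow> complex) set \<Rightarrow> nat \<Rightarrow> (('n \<Rightarrow> nat) \<Rightarrow> complex) set"
  where "HS_ideal I r =
    I <+>\<^bsub>conv_series\<^esub> (max_ideal [^]\<^bsub>ideals_set conv_series\<^esub> (r + 1))"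

text \<open>The field of scalars is the image of the constants \<open>\<complex>\<close> in the quotient ring. If the
  quotient is the zero ring, this image is not a field, but the relation \<open>ring.dimension\<close> then
  still holds for exactly one number, namely \<open>0\<close>.\<close>

definition HSF :: "(('n::finite \<Rightarrow> nat) \<Rightarrow> complex) set \<Rightarrow> nat \<Rightarrow> nat"
  where "HSF I r =
    (let Q = conv_series Quot HS_ideal I r;
         K = range (\<lambda>k. HS_ideal I r +>\<^bsub>conv_series\<^esub> const_series k)
     in THE d. ring.dimension Q d K (carrier Q))"

definition HSP :: "(('n::finite \<Rightarrow> nat) \<Rightarrow> complex) set \<Rightarrow> rat poly"
  where "HSP I = (THE P. \<exists>r0. \<forall>r\<ge>r0. poly P (of_nat r) = of_nat (HSF I r))"

section \<open>Specialization of an ideal\<close>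

text \<open>\<open>\<complex>\<^sup>m \<times> \<complex>\<^sup>n\<close> is identified with \<open>\<complex>\<^sup>m\<^sup>+\<^sup>n\<close>, with the coordinates indexed by a disjoint sum.\<close>

definition join_vec :: "complex ^ 'm::finite \<Rightarrow> complex ^ 'n::finite \<Rightarrow> complex ^ ('m + 'n)"
  where "join_vec a x = (\<chi> k. case k of Inl i \<Rightarrow> a $ i | Inr j \<Rightarrow> x $ j)"

definition vec_Times ::
    "(complex ^ 'm::finite) set \<Rightarrow> (complex ^ 'n::finite) set \<Rightarrow> (complex ^ ('m + 'n)) set"
  where "vec_Times A X = {join_vec a x | a x. a \<in> A \<and> x \<in> X}"

definition specialize ::
    "(complex ^ 'n::finite) set \<Rightarrow> (complex ^ ('m::finite + 'n) \<Rightarrow> complex) set \<Rightarrow> complex ^ 'm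
      \<Rightarrow> (complex ^ 'n \<Rightarrow> complex) set"
  where "specialize X J a = (\<lambda>f. \<lambda>x\<in>X. f (join_vec a x)) ` J"

text \<open>The ideal of \<open>\<complex>{x}\<close> generated by the germs at \<open>0\<close> of the elements of \<open>I\<close>.\<close>

definition germ_ideal ::
    "(complex ^ 'n::finite \<Rightarrow> complex) set \<Rightarrow> (('n \<Rightarrow> nat) \<Rightarrow> complex) set"
  where "germ_ideal I = Idl\<^bsub>conv_series\<^esub> {c. \<exists>f\<in>I. has_power_series f 0 c}"

section \<open>Closed analytic and constructible subsets\<close>

text \<open>The local condition is imposed at every point of \<open>A\<close>, not only at the points of \<open>Z\<close>, so \<open>Z\<close> is
  closed in \<open>A\<close>.\<close>

definition closed_analytic_in :: "(complex ^ 'm::finite) set \<Rightarrow> (complex ^ 'm) set \<Rightarrow> bool"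
  where "closed_analytic_in A Z \<longleftrightarrow> Z \<subseteq> A \<and>
    (\<forall>a\<in>A. \<exists>U F. open U \<and> a \<in> U \<and> U \<subseteq> A \<and> finite F \<and> F \<subseteq> carrier (analytic_functions U) \<and>
       Z \<inter> U = {z \<in> U. \<forall>f\<in>F. f z = 0})"

definition locally_closed_in :: "(complex ^ 'm::finite) set \<Rightarrow> (complex ^ 'm) set \<Rightarrow> bool"
  where "locally_closed_in A L \<longleftrightarrow>
    (\<exists>Y Z. closed_analytic_in A Y \<and> closed_analytic_in A Z \<and> L = Y - Z)"

definition constructible_in :: "(complex ^ 'm::finite) set \<Rightarrow> (complex ^ 'm) set \<Rightarrow> bool"
  where "constructible_in A C \<longleftrightarrow>
    (\<exists>\<L>. finite \<L> \<and> (\<forall>L\<in>\<L>. locally_closed_in A L) \<and> C = \<Union>\<L>)"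

section \<open>The rings are commutative rings, and the maximal ideal is maximal\<close>

lemma finite_below: "finite {\<alpha>. \<alpha> \<le> (\<gamma> :: 'n::finite \<Rightarrow> nat)}"
proof -
  have "{\<alpha>. \<alpha> \<le> \<gamma>} \<subseteq> (\<Pi>\<^sub>E i\<in>UNIV. {..\<gamma> i})" by (auto simp: le_fun_def PiE_def)
  thus ?thesis by (rule finite_subset) (intro finite_PiE, auto)
qed

lemma monomial_add: "monomial z (\<lambda>i. \<alpha> i + \<beta> i) = monomial z \<alpha> * monomial z \<beta>"
  by (simp add: monomial_def power_add prod.distrib)

lemma monomial_zero: "monomial z (\<lambda>_. 0) = 1"
  by (simp add: monomial_def)

lemma summable_Times:
  fixes f :: "'a \<Rightarrow> complex" and g :: "'b \<Rightarrow> complex"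
  assumes "f summable_on UNIV" "g summable_on UNIV"
  shows "(\<lambda>(a,b). f a * g b) summable_on UNIV \<times> UNIV"
proof -
  have f: "(\<lambda>a. norm (f a)) summable_on UNIV" and g: "(\<lambda>b. norm (g b)) summable_on UNIV"
    using assms summable_on_iff_abs_summable_on_complex by blast+
  have "(\<lambda>x. norm (case x of (a,b) \<Rightarrow> f a * g b)) summable_on UNIV \<times> UNIV"
  proof (rule summable_on_SigmaI)
    show "((\<lambda>b. norm (case (a, b) of (a,b) \<Rightarrow> f a * g b)) has_sum
        norm (f a) * infsum (\<lambda>b. norm (g b)) UNIV) UNIV" for a
      using has_sum_cmult_right[OF has_sum_infsum[OF g]] by (simp add: norm_mult)
    show "(\<lambda>a. norm (f a) * infsum (\<lambda>b. norm (g b)) UNIV) summable_on UNIV"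
      by (rule summable_on_cmult_left[OF f])
  qed simp
  thus ?thesis by (rule abs_summable_summable)
qed

lemma Cauchy_product:
  fixes c d :: "('n::finite \<Rightarrow> nat) \<Rightarrow> complex"
  assumes f: "((\<lambda>\<alpha>. c \<alpha> * monomial z \<alpha>) has_sum s) UNIV"
    and g: "((\<lambda>\<alpha>. d \<alpha> * monomial z \<alpha>) has_sum t) UNIV"
  shows "((\<lambda>\<gamma>. (\<Sum>\<alpha> | \<alpha> \<le> \<gamma>. c \<alpha> * d (\<lambda>i. \<gamma> i - \<alpha> i)) * monomial z \<gamma>) has_sum (s * t)) UNIV"
proof -
  let ?F = "\<lambda>(\<alpha>,\<beta>). (c \<alpha> * monomial z \<alpha>) * (d \<beta> * monomial z \<beta>)"
  have 1: "(?F has_sum (s * t)) (UNIV \<times> UNIV)"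
  proof (rule has_sum_SigmaI)
    show "((\<lambda>\<beta>. ?F (\<alpha>, \<beta>)) has_sum (c \<alpha> * monomial z \<alpha> * t)) UNIV" for \<alpha>
      using has_sum_cmult_right[OF g] by simp
    show "((\<lambda>\<alpha>. c \<alpha> * monomial z \<alpha> * t) has_sum s * t) UNIV"
      using has_sum_cmult_left[OF f] by simp
    show "?F summable_on (UNIV \<times> UNIV)"
      using f g by (intro summable_Times) (auto simp: summable_on_def)
  qed
  let ?G = "\<lambda>(\<gamma>,\<alpha>). c \<alpha> * d (\<lambda>i. \<gamma> i - \<alpha> i) * monomial z \<gamma>"
  have "(?F has_sum (s * t)) (UNIV \<times> UNIV) = (?G has_sum (s * t)) (Sigma UNIV (\<lambda>\<gamma>. {\<alpha>. \<alpha> \<le> \<gamma>}))"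
    by (rule has_sum_reindex_bij_witness[where i = "\<lambda>(\<gamma>,\<alpha>). (\<alpha>, \<lambda>i. \<gamma> i - \<alpha> i)"
          and j = "\<lambda>(\<alpha>,\<beta>). (\<lambda>i. \<alpha> i + \<beta> i, \<alpha>)"])
       (auto simp: le_fun_def monomial_add)
  with 1 have "(?G has_sum (s * t)) (Sigma UNIV (\<lambda>\<gamma>. {\<alpha>. \<alpha> \<le> \<gamma>}))" by simp
  thus ?thesis
    by (rule has_sum_SigmaD)
       (auto intro!: has_sum_finiteI simp: finite_below sum_distrib_right)
qed

lemma has_power_series_add:
  assumes "has_power_series f p c" "has_power_series g p d"
  shows "has_power_series (\<lambda>z. f z + g z) p (\<lambda>\<alpha>. c \<alpha> + d \<alpha>)"
proof -
  obtain r s where "r > 0" "s > 0"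
    and r: "\<And>z. z \<in> polydisk (\<lambda>_. r) \<Longrightarrow> ((\<lambda>\<alpha>. c \<alpha> * monomial z \<alpha>) has_sum f (p + z)) UNIV"
    and s: "\<And>z. z \<in> polydisk (\<lambda>_. s) \<Longrightarrow> ((\<lambda>\<alpha>. d \<alpha> * monomial z \<alpha>) has_sum g (p + z)) UNIV"
    using assms unfolding has_power_series_def by blast
  show ?thesis unfolding has_power_series_def
    by (rule exI[of _ "min r s"])
       (use \<open>r > 0\<close> \<open>s > 0\<close> in \<open>auto simp: distrib_right polydisk_def intro!: has_sum_add r s\<close>)
qed

lemma has_power_series_mult:
  assumes "has_power_series f p c" "has_power_series g p d"
  shows "has_power_series (\<lambda>z. f z * g z) p (\<lambda>\<gamma>. \<Sum>\<alpha> | \<alpha> \<le> \<gamma>. c \<alpha> * d (\<lambda>i. \<gamma> i - \<alpha> i))"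
proof -
  obtain r s where "r > 0" "s > 0"
    and r: "\<And>z. z \<in> polydisk (\<lambda>_. r) \<Longrightarrow> ((\<lambda>\<alpha>. c \<alpha> * monomial z \<alpha>) has_sum f (p + z)) UNIV"
    and s: "\<And>z. z \<in> polydisk (\<lambda>_. s) \<Longrightarrow> ((\<lambda>\<alpha>. d \<alpha> * monomial z \<alpha>) has_sum g (p + z)) UNIV"
    using assms unfolding has_power_series_def by blast
  show ?thesis unfolding has_power_series_def
    by (rule exI[of _ "min r s"])
       (use \<open>r > 0\<close> \<open>s > 0\<close> in \<open>auto simp: polydisk_def intro!: Cauchy_product r s\<close>)
qed

lemma has_power_series_const: "has_power_series (\<lambda>_. k) p (const_series k)"
proof -
  have "((\<lambda>\<alpha>. const_series k \<alpha> * monomial z \<alpha>) has_sum k) UNIV" for z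
    using has_sum_finiteI[of "{\<lambda>_. 0}" k "\<lambda>\<alpha>. const_series k \<alpha> * monomial z \<alpha>"]
    by (subst has_sum_cong_neutral[where T = "{\<lambda>_. 0}"])
       (auto simp: const_series_def monomial_zero)
  thus ?thesis unfolding has_power_series_def by (intro exI[of _ 1]) auto
qed

lemma has_power_series_cong:
  assumes "has_power_series f p c" "open U" "p \<in> U" "\<And>z. z \<in> U \<Longrightarrow> f z = g z"
  shows "has_power_series g p c"
proof -
  obtain r where "r > 0"
    and r: "\<And>z. z \<in> polydisk (\<lambda>_. r) \<Longrightarrow> ((\<lambda>\<alpha>. c \<alpha> * monomial z \<alpha>) has_sum f (p + z)) UNIV"
    using assms unfolding has_power_series_def by blast
  obtain e where "e > 0" and e: "\<And>y. dist y p < e \<Longrightarrow> y \<in> U"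
    using assms(2,3) unfolding open_dist by blast
  define s where "s = e / (real CARD('a) + 1)"
  have "s > 0" using \<open>e > 0\<close> by (simp add: s_def)
  have "p + z \<in> U" if "z \<in> polydisk (\<lambda>_. s)" for z
  proof (rule e)
    have "norm z \<le> (\<Sum>i\<in>UNIV. norm (z $ i))" unfolding norm_vec_def by (rule L2_set_le_sum) simp
    also have "\<dots> \<le> (\<Sum>i\<in>(UNIV::'a set). s)"
      using that by (intro sum_mono) (auto simp: polydisk_def less_imp_le)
    also have "\<dots> = real CARD('a) * s" by simp
    also have "\<dots> < e" using \<open>e > 0\<close> by (simp add: s_def field_simps)
    finally show "dist (p + z) p < e" by (simp add: dist_norm)
  qed
  hence "((\<lambda>\<alpha>. c \<alpha> * monomial z \<alpha>) has_sum g (p + z)) UNIV"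
    if "z \<in> polydisk (\<lambda>_. min r s)" for z
    using r[of z] assms(4)[of "p + z"] that by (auto simp: polydisk_def)
  thus ?thesis unfolding has_power_series_def using \<open>r > 0\<close> \<open>s > 0\<close>
    by (intro exI[of _ "min r s"]) auto
qed

lemma open_polydisk: "open (polydisk \<rho>)"
proof -
  have "polydisk \<rho> = (\<Inter>i. {z. norm (z $ i) < \<rho> i})" by (auto simp: polydisk_def)
  moreover have "open {z::complex ^ 'a. norm (z $ i) < \<rho> i}" for i
    by (intro open_Collect_less continuous_intros)
  ultimately show ?thesis by auto
qed

lemma vec_Times_polydisk: "vec_Times (polydisk \<rho>) (polydisk \<sigma>) = polydisk (case_sum \<rho> \<sigma>)"
proof (intro equalityI subsetI)
  fix z assume z: "z \<in> polydisk (case_sum \<rho> \<sigma>)"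
  have "z = join_vec (\<chi> i. z $ Inl i) (\<chi> j. z $ Inr j)"
    by (auto simp: join_vec_def vec_eq_iff split: sum.split)
  moreover have "(\<chi> i. z $ Inl i) \<in> polydisk \<rho>" "(\<chi> j. z $ Inr j) \<in> polydisk \<sigma>"
    using z[unfolded polydisk_def, simplified, rule_format, of "Inl _"]
      z[unfolded polydisk_def, simplified, rule_format, of "Inr _"] by (auto simp: polydisk_def)
  ultimately show "z \<in> vec_Times (polydisk \<rho>) (polydisk \<sigma>)"
    unfolding vec_Times_def by blast
qed (auto simp: vec_Times_def polydisk_def join_vec_def split: sum.split)

lemma cring_analytic_functions:
  assumes "open U"
  shows "cring (analytic_functions U)"
proof -
  note [intro] = has_power_series_cong[OF _ assms]
  have add: "\<exists>c. has_power_series (\<lambda>z\<in>U. f z + g z) p c"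
    if "p \<in> U" "\<exists>c. has_power_series f p c" "\<exists>c. has_power_series g p c" for f g p
    using that has_power_series_add[of f p _ g] has_power_series_cong[OF _ assms that(1)]
    by (metis (mono_tags, lifting) restrict_apply')
  have mult: "\<exists>c. has_power_series (\<lambda>z\<in>U. f z * g z) p c"
    if "p \<in> U" "\<exists>c. has_power_series f p c" "\<exists>c. has_power_series g p c" for f g p
    using that has_power_series_mult[of f p _ g] has_power_series_cong[OF _ assms that(1)]
    by (metis (mono_tags, lifting) restrict_apply')
  have const: "\<exists>c. has_power_series (\<lambda>z\<in>U. k) p c" if "p \<in> U" for k p
    using has_power_series_const[of k p] has_power_series_cong[OF _ assms that]
    by (metis (mono_tags, lifting) restrict_apply')
  have neg: "\<exists>c. has_power_series (\<lambda>z\<in>U. - f z) p c"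
    if "p \<in> U" "\<exists>c. has_power_series f p c" for f p
  proof -
    from that(2) obtain c where "has_power_series f p c" ..
    from has_power_series_mult[OF has_power_series_const[of "-1" p] this]
    show ?thesis using has_power_series_cong[OF _ assms that(1), of _ _ "\<lambda>z\<in>U. - f z"]
      by (metis (mono_tags, lifting) mult_minus1 restrict_apply')
  qed
  show ?thesis
  proof (rule cringI)
    show "abelian_group (analytic_functions U)"
    proof (rule abelian_groupI)
      fix f assume f: "f \<in> carrier (analytic_functions U)"
      show "\<exists>g\<in>carrier (analytic_functions U).
          g \<oplus>\<^bsub>analytic_functions U\<^esub> f = \<zero>\<^bsub>analytic_functions U\<^esub>"
        using f neg by (intro bexI[of _ "\<lambda>z\<in>U. - f z"]) (auto simp: analytic_functions_def)
    qed (auto simp: analytic_functions_def add const,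
         auto simp: extensional_def restrict_def add.assoc add.commute)
    show "comm_monoid (analytic_functions U)"
      by (rule comm_monoidI, auto simp: analytic_functions_def mult const)
         (auto simp: extensional_def restrict_def mult.assoc mult.commute)
  qed (auto simp: analytic_functions_def distrib_right restrict_def)
qed

lemma carrier_conv_series_iff: "c \<in> carrier conv_series \<longleftrightarrow> (\<exists>f. has_power_series f 0 c)"
proof
  assume "c \<in> carrier conv_series"
  hence "has_power_series (\<lambda>z. infsum (\<lambda>\<alpha>. c \<alpha> * monomial z \<alpha>) UNIV) 0 c"
    by (auto simp: conv_series_def has_power_series_def)
  thus "\<exists>f. has_power_series f 0 c" by blast
next
  assume "\<exists>f. has_power_series f 0 c"
  then obtain f where "has_power_series f 0 c" ..
  thus "c \<in> carrier conv_series"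
    unfolding conv_series_def has_power_series_def by (auto simp: summable_on_def)
qed

lemma series_assoc:
  fixes a b c :: "('n::finite \<Rightarrow> nat) \<Rightarrow> complex"
  shows "(\<Sum>\<alpha> | \<alpha> \<le> \<gamma>. (\<Sum>\<beta> | \<beta> \<le> \<alpha>. a \<beta> * b (\<lambda>i. \<alpha> i - \<beta> i)) * c (\<lambda>i. \<gamma> i - \<alpha> i)) =
         (\<Sum>\<beta> | \<beta> \<le> \<gamma>. a \<beta> * (\<Sum>\<delta> | \<delta> \<le> (\<lambda>i. \<gamma> i - \<beta> i). b \<delta> * c (\<lambda>i. \<gamma> i - \<beta> i - \<delta> i)))"
proof -
  have "(\<Sum>\<alpha> | \<alpha> \<le> \<gamma>. (\<Sum>\<beta> | \<beta> \<le> \<alpha>. a \<beta> * b (\<lambda>i. \<alpha> i - \<beta> i)) * c (\<lambda>i. \<gamma> i - \<alpha> i)) =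
     (\<Sum>(\<alpha>,\<beta>)\<in>Sigma {\<alpha>. \<alpha> \<le> \<gamma>} (\<lambda>\<alpha>. {\<beta>. \<beta> \<le> \<alpha>}). a \<beta> * b (\<lambda>i. \<alpha> i - \<beta> i) * c (\<lambda>i. \<gamma> i - \<alpha> i))"
    by (subst sum.Sigma[symmetric]) (auto simp: sum_distrib_right finite_below finite_below[unfolded le_fun_def])
  also have "\<dots> = (\<Sum>(\<beta>,\<delta>)\<in>Sigma {\<beta>. \<beta> \<le> \<gamma>} (\<lambda>\<beta>. {\<delta>. \<delta> \<le> (\<lambda>i. \<gamma> i - \<beta> i)}).
        a \<beta> * (b \<delta> * c (\<lambda>i. \<gamma> i - \<beta> i - \<delta> i)))"
    by (rule sum.reindex_bij_witness[where j = "\<lambda>(\<alpha>,\<beta>). (\<beta>, \<lambda>i. \<alpha> i - \<beta> i)"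
          and i = "\<lambda>(\<beta>,\<delta>). (\<lambda>i. \<beta> i + \<delta> i, \<beta>)"])
       (auto simp: le_fun_def mult.assoc le_diff_conv2 add.commute diff_le_mono intro: order_trans)
  also have "\<dots> = (\<Sum>\<beta> | \<beta> \<le> \<gamma>. a \<beta> * (\<Sum>\<delta> | \<delta> \<le> (\<lambda>i. \<gamma> i - \<beta> i). b \<delta> * c (\<lambda>i. \<gamma> i - \<beta> i - \<delta> i)))"
    by (subst sum.Sigma[symmetric]) (auto simp: sum_distrib_left finite_below finite_below[unfolded le_fun_def])
  finally show ?thesis .
qed

lemma series_comm:
  fixes a b :: "('n::finite \<Rightarrow> nat) \<Rightarrow> complex"
  shows "(\<Sum>\<alpha> | \<alpha> \<le> \<gamma>. a \<alpha> * b (\<lambda>i. \<gamma> i - \<alpha> i)) = (\<Sum>\<alpha> | \<alpha> \<le> \<gamma>. b \<alpha> * a (\<lambda>i. \<gamma> i - \<alpha> i))"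
  by (rule sum.reindex_bij_witness[where i = "\<lambda>\<alpha> i. \<gamma> i - \<alpha> i" and j = "\<lambda>\<alpha> i. \<gamma> i - \<alpha> i"])
     (auto simp: le_fun_def)

lemma series_const:
  fixes a :: "('n::finite \<Rightarrow> nat) \<Rightarrow> complex"
  shows "(\<Sum>\<alpha> | \<alpha> \<le> \<gamma>. const_series k \<alpha> * a (\<lambda>i. \<gamma> i - \<alpha> i)) = k * a \<gamma>"
proof -
  have "(\<Sum>\<alpha> | \<alpha> \<le> \<gamma>. const_series k \<alpha> * a (\<lambda>i. \<gamma> i - \<alpha> i)) =
      (\<Sum>\<alpha>\<in>{\<lambda>_. 0}. const_series k \<alpha> * a (\<lambda>i. \<gamma> i - \<alpha> i))"
    by (rule sum.mono_neutral_right) (auto simp: finite_below finite_below[unfolded le_fun_def] le_fun_def const_series_def)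
  thus ?thesis by (simp add: const_series_def)
qed

lemma cring_conv_series: "cring (conv_series :: (('n::finite \<Rightarrow> nat) \<Rightarrow> complex) ring)"
proof -
  let ?R = "conv_series :: (('n \<Rightarrow> nat) \<Rightarrow> complex) ring"
  have add: "c \<oplus>\<^bsub>?R\<^esub> d \<in> carrier ?R" if "c \<in> carrier ?R" "d \<in> carrier ?R" for c d
    using that has_power_series_add unfolding carrier_conv_series_iff
    by (fastforce simp: conv_series_def)
  have mult: "c \<otimes>\<^bsub>?R\<^esub> d \<in> carrier ?R" if "c \<in> carrier ?R" "d \<in> carrier ?R" for c d
    using that has_power_series_mult unfolding carrier_conv_series_iff
    by (fastforce simp: conv_series_def)
  have const: "const_series k \<in> carrier ?R" for k
    using has_power_series_const unfolding carrier_conv_series_iff by blast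
  have one: "\<one>\<^bsub>?R\<^esub> = const_series 1" and zero: "\<zero>\<^bsub>?R\<^esub> = const_series 0"
    by (auto simp: conv_series_def const_series_def)
  have comm: "c \<otimes>\<^bsub>?R\<^esub> d = d \<otimes>\<^bsub>?R\<^esub> c" for c d
    by (simp add: conv_series_def series_comm fun_eq_iff) 
  have assoc: "c \<otimes>\<^bsub>?R\<^esub> d \<otimes>\<^bsub>?R\<^esub> e = c \<otimes>\<^bsub>?R\<^esub> (d \<otimes>\<^bsub>?R\<^esub> e)" for c d e
    by (simp add: conv_series_def series_assoc)
  have cmult: "const_series k \<otimes>\<^bsub>?R\<^esub> c = (\<lambda>\<alpha>. k * c \<alpha>)" for k c
    by (simp add: conv_series_def series_const)
  show ?thesis
  proof (rule cringI)
    show "abelian_group ?R"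
    proof (rule abelian_groupI)
      fix c assume c: "c \<in> carrier ?R"
      have "const_series (-1) \<otimes>\<^bsub>?R\<^esub> c \<in> carrier ?R" by (rule mult[OF const c])
      thus "\<exists>d\<in>carrier ?R. d \<oplus>\<^bsub>?R\<^esub> c = \<zero>\<^bsub>?R\<^esub>"
        by (rule rev_bexI) (simp add: cmult, simp add: conv_series_def)
    next
      show "\<zero>\<^bsub>?R\<^esub> \<in> carrier ?R" by (simp add: zero const)
    qed (auto simp: add, auto simp: conv_series_def add.assoc add.commute)
    show "comm_monoid ?R"
      by (rule comm_monoidI) (auto simp: mult one const assoc cmult intro: comm)
  qed (auto simp: conv_series_def distrib_right sum.distrib)
qed

lemma maximalideal_max_ideal:
  "maximalideal max_ideal (conv_series :: (('n::finite \<Rightarrow> nat) \<Rightarrow> complex) ring)"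
proof -
  let ?R = "conv_series :: (('n \<Rightarrow> nat) \<Rightarrow> complex) ring"
  interpret R: cring ?R by (rule cring_conv_series)
  have const: "const_series k \<in> carrier ?R" for k
    using has_power_series_const unfolding carrier_conv_series_iff by blast
  have one: "\<one>\<^bsub>?R\<^esub> = const_series 1" and zero: "\<zero>\<^bsub>?R\<^esub> = const_series 0"
    by (auto simp: conv_series_def const_series_def)
  have cmult: "const_series k \<otimes>\<^bsub>?R\<^esub> c = (\<lambda>\<alpha>. k * c \<alpha>)" for k c
    by (simp add: conv_series_def series_const)
  have add0: "(c \<oplus>\<^bsub>?R\<^esub> d) (\<lambda>_. 0) = c (\<lambda>_. 0) + d (\<lambda>_. 0)" for c d
    by (simp add: conv_series_def)
  have "{\<alpha>. \<alpha> \<le> (\<lambda>_. 0)} = {\<lambda>_::'n. 0::nat}" by (auto simp: le_fun_def)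
  hence mult0: "(c \<otimes>\<^bsub>?R\<^esub> d) (\<lambda>_. 0) = c (\<lambda>_. 0) * d (\<lambda>_. 0)" for c d
    by (simp add: conv_series_def)
  have neg0: "(\<ominus>\<^bsub>?R\<^esub> c) (\<lambda>_. 0) = - c (\<lambda>_. 0)" if "c \<in> carrier ?R" for c
    using add0[of "\<ominus>\<^bsub>?R\<^esub> c" c] R.l_neg[OF that]
    by (simp add: zero const_series_def eq_neg_iff_add_eq_0)
  have id: "ideal max_ideal ?R"
  proof (rule idealI)
    show "subgroup max_ideal (add_monoid ?R)"
    proof (rule R.add.subgroupI)
      show "(max_ideal :: (('n \<Rightarrow> nat) \<Rightarrow> complex) set) \<noteq> {}"
        using const[of 0] by (auto simp: max_ideal_def const_series_def intro!: exI[of _ "const_series 0"])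
    qed (auto simp: max_ideal_def add0 neg0 simp flip: a_inv_def)
  qed (auto simp: max_ideal_def mult0 R.ring_axioms)
  show ?thesis
  proof (intro maximalideal.intro id maximalideal_axioms.intro)
    have "const_series 1 \<notin> max_ideal"
      by (simp add: max_ideal_def const_series_def)
    thus "carrier ?R \<noteq> max_ideal" using const[of 1] by blast
    fix J assume J: "ideal J ?R" "max_ideal \<subseteq> J" "J \<subseteq> carrier ?R"
    interpret J: ideal J ?R by fact
    show "J = max_ideal \<or> J = carrier ?R"
    proof (rule disjCI)
      assume "J \<noteq> carrier ?R"
      have "c (\<lambda>_. 0) = 0" if c: "c \<in> J" for c
      proof (rule ccontr)
        assume nz: "c (\<lambda>_. 0) \<noteq> 0"
        let ?e = "const_series (inverse (c (\<lambda>_. 0))) \<otimes>\<^bsub>?R\<^esub> c"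
        have e: "?e \<in> J" by (rule J.I_l_closed[OF c const])
        have eR: "?e \<in> carrier ?R" using e J(3) by blast
        have "\<one>\<^bsub>?R\<^esub> \<ominus>\<^bsub>?R\<^esub> ?e \<in> max_ideal"
        proof -
          have "\<one>\<^bsub>?R\<^esub> \<ominus>\<^bsub>?R\<^esub> ?e \<in> carrier ?R" by (rule R.minus_closed[OF R.one_closed eR])
          moreover have "(\<one>\<^bsub>?R\<^esub> \<ominus>\<^bsub>?R\<^esub> ?e) (\<lambda>_. 0) = 0"
            unfolding a_minus_def add0 neg0[OF eR] mult0 one using nz by (simp add: const_series_def)
          ultimately show ?thesis by (simp add: max_ideal_def)
        qed
        hence "(\<one>\<^bsub>?R\<^esub> \<ominus>\<^bsub>?R\<^esub> ?e) \<oplus>\<^bsub>?R\<^esub> ?e \<in> J"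
          using J(2) e by (intro J.a_closed) auto
        moreover have "(\<one>\<^bsub>?R\<^esub> \<ominus>\<^bsub>?R\<^esub> ?e) \<oplus>\<^bsub>?R\<^esub> ?e = \<one>\<^bsub>?R\<^esub>"
          using eR R.one_closed by (simp add: a_minus_def R.a_assoc R.l_neg)
        ultimately have "J = carrier ?R" using J.one_imp_carrier by simp
        with \<open>J \<noteq> carrier ?R\<close> show False by simp
      qed
      with J show "J = max_ideal" by (auto simp: max_ideal_def)
    qed
  qed
qed

end

theory Submission
  imports Defs "HOL-Complex_Analysis.Complex_Analysis"
begin

text \<open>
  The Hilbert-Samuel function of the specialized ideal at \<open>r\<close> counts the monomials of degree at most
  \<open>r\<close> outside the diagram of \<open>a\<close>, the set of initial exponents of the germs of the ideal with
  respect to an order of the monomials that refines the degree (\<open>HSF_eq_hilbert_count\<close>,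
  \<open>HSF_germ_ideal\<close>). Two facts describe how this count depends on the parameter \<open>a\<close>.

  \<^item> Semicontinuity (\<open>hilbert_count_upper_semicontinuous\<close>): the parameters whose count at \<open>r\<close> is at
    least \<open>d\<close> are those where a matrix of analytic functions has small rank, namely the matrix of
    the coefficients of degree at most \<open>r\<close> in \<open>x\<close> of the elements of the ideal. So they are the
    common zeros of a set of analytic functions.
  \<^item> Finiteness (\<open>finitely_many_diagrams\<close>): near a point of \<open>A\<close> only finitely many diagrams occur.

  Polynomials are totally ordered by their values at large integers. Near a point of \<open>A\<close>, finiteness
  yields one \<open>r\<close> that decides for all nearby parameters whether the Hilbert polynomial is at least
  \<open>P\<close>, and likewise whether it is greater than \<open>P\<close>; by semicontinuity both sets of parameters are
  closed analytic (\<open>closed_analytic_superlevel\<close>). The parameters with Hilbert polynomial \<open>P\<close> form the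
  difference of the two, so this set is even locally closed.

  Both facts involve infinite sets of analytic functions on an open set that is not compact. What
  controls them is local Noetherianity (\<open>zero_set_locally_finite\<close>): near a given point, the common
  zeros of any set of analytic functions are those of a finite subset. Its proof is a division
  with respect to initial exponents. Dickson's lemma provides finitely many divisors, and at the points
  with coordinates \<open>p\<^sub>i\<^sup>-\<^sup>s\<close> for distinct primes \<open>p\<^sub>i\<close> and large \<open>s\<close> the leading term of each divisor
  exceeds the sum of the others (\<open>lead_dominates\<close>), so that the division does not increase a weighted
  sum of the absolute values of the coefficients. The estimates hold on one neighbourhood for all
  functions because a power series of an analytic function converges on every polydisk in the domain
  (\<open>power_series_converges_on_polydisk\<close>).

  Local Noetherianity also allows induction over the germs of zero sets, by which finiteness is
  proved. Let \<open>\<pp>\<close> be the ideal of the functions that vanish on the zero set near \<open>a\<close>. If \<open>\<pp>\<close> is prime,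
  then one diagram, computed modulo \<open>\<pp>\<close>, occurs everywhere on the zero set except on a smaller zero set
  (\<open>diagram_eq_generic_diagram\<close>); if not, then the zero set is the union of two smaller ones.
\<close>

section \<open>Orders of exponents and initial exponents\<close>

definition mdeg :: "('n::finite \<Rightarrow> nat) \<Rightarrow> nat"
  where "mdeg \<alpha> = (\<Sum>i\<in>UNIV. \<alpha> i)"

lemma mdeg_add: "mdeg (\<lambda>i. \<alpha> i + \<beta> i) = mdeg \<alpha> + mdeg \<beta>"
  by (simp add: mdeg_def sum.distrib)

lemma mdeg_mono: "\<alpha> \<le> \<beta> \<Longrightarrow> mdeg \<alpha> \<le> mdeg \<beta>"
  by (auto simp: mdeg_def le_fun_def intro: sum_mono)

lemma mdeg_eq_0_iff: "mdeg \<alpha> = 0 \<longleftrightarrow> \<alpha> = (\<lambda>_. 0)"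
  by (auto simp: mdeg_def)

lemma finite_mdeg_le: "finite {\<alpha> :: 'n::finite \<Rightarrow> nat. mdeg \<alpha> \<le> r}"
proof (rule finite_subset[OF _ finite_below])
  have "\<alpha> i \<le> mdeg \<alpha>" for \<alpha> :: "'n \<Rightarrow> nat" and i
    unfolding mdeg_def by (rule member_le_sum) auto
  then show "{\<alpha> :: 'n \<Rightarrow> nat. mdeg \<alpha> \<le> r} \<subseteq> {\<alpha>. \<alpha> \<le> (\<lambda>_. r)}"
    by (auto simp: le_fun_def intro: order_trans)
qed

text \<open>A monotone subsequence is increasing, or else it decreases and becomes constant from the
  point where it attains its least value.\<close>

lemma nat_sequence_has_mono_subsequence:
  fixes s :: "nat \<Rightarrow> nat"
  obtains \<phi> :: "nat \<Rightarrow> nat" where "strict_mono \<phi>" "mono (\<lambda>k. s (\<phi> k))"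
proof -
  obtain f where f: "strict_mono f" "monoseq (\<lambda>n. s (f n))"
    using seq_monosub by blast
  show ?thesis
  proof (cases "mono (\<lambda>n. s (f n))")
    case False
    then have "\<forall>m n. m \<le> n \<longrightarrow> s (f n) \<le> s (f m)"
      using f(2) unfolding monoseq_def mono_def by blast
    then have dec: "s (f n) \<le> s (f m)" if "m \<le> n" for m n using that by blast
    define v where "v = (LEAST v. \<exists>k. s (f k) = v)"
    have "\<exists>k. s (f k) = v"
      unfolding v_def by (rule LeastI[of _ "s (f 0)"]) blast
    then obtain k where k: "s (f k) = v" by blast
    have "v \<le> s (f (k + n))" for n
      unfolding v_def by (rule Least_le) blast
    then have "s (f (k + n)) = v" for n
      using dec[of k "k + n"] k by (simp add: le_antisym)
    moreover have "strict_mono (\<lambda>n. f (k + n))"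
      using f(1) by (auto simp: strict_mono_def)
    ultimately show ?thesis by (intro that[of "\<lambda>n. f (k + n)"]) (auto simp: mono_def)
  next
    case True
    then show ?thesis using f(1) by (intro that[of f])
  qed
qed

lemma exponent_sequence_has_mono_subsequence:
  fixes s :: "nat \<Rightarrow> 'n \<Rightarrow> nat"
  assumes "finite C"
  shows "\<exists>\<phi> :: nat \<Rightarrow> nat. strict_mono \<phi> \<and> (\<forall>i\<in>C. mono (\<lambda>k. s (\<phi> k) i))"
  using assms
proof induction
  case empty
  show ?case by (rule exI[of _ id]) (auto simp: strict_mono_def)
next
  case (insert j C)
  then obtain \<phi> :: "nat \<Rightarrow> nat" where \<phi>: "strict_mono \<phi>" "\<forall>i\<in>C. mono (\<lambda>k. s (\<phi> k) i)" by blast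
  obtain \<psi> :: "nat \<Rightarrow> nat" where \<psi>: "strict_mono \<psi>" "mono (\<lambda>k. s (\<phi> (\<psi> k)) j)"
    using nat_sequence_has_mono_subsequence[of "\<lambda>k. s (\<phi> k) j"] by blast
  show ?case
    using \<phi> \<psi> by (intro exI[of _ "\<phi> \<circ> \<psi>"])
      (auto simp: mono_def strict_mono_less_eq strict_mono_def)
qed

text \<open>The minimal elements of \<open>S\<close> form a finite set, since an infinite sequence of exponents has a
  subsequence that increases in every coordinate.\<close>

lemma Dickson:
  fixes S :: "('n::finite \<Rightarrow> nat) set"
  obtains T where "T \<subseteq> S" "finite T" "\<And>\<alpha>. \<alpha> \<in> S \<Longrightarrow> \<exists>\<tau>\<in>T. \<tau> \<le> \<alpha>"
proof -
  define T where "T = {\<tau> \<in> S. \<forall>\<sigma>\<in>S. \<sigma> \<le> \<tau> \<longrightarrow> \<sigma> = \<tau>}"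
  have "finite T"
  proof (rule ccontr)
    assume "infinite T"
    then obtain s :: "nat \<Rightarrow> _" where s: "inj s" "range s \<subseteq> T"
      using infinite_countable_subset by blast
    obtain \<phi> :: "nat \<Rightarrow> nat" where \<phi>: "strict_mono \<phi>" "\<forall>i. mono (\<lambda>k. s (\<phi> k) i)"
      using exponent_sequence_has_mono_subsequence[of UNIV s] by auto
    have "s (\<phi> 0) \<le> s (\<phi> 1)" using \<phi>(2) by (auto simp: le_fun_def mono_def)
    moreover have "s (\<phi> 0) \<in> T" "s (\<phi> 1) \<in> T" using s(2) by blast+
    ultimately have "s (\<phi> 0) = s (\<phi> 1)" unfolding T_def by blast
    then show False using s(1) \<phi>(1) by (metis injD strict_mono_eq zero_neq_one)
  qed
  moreover have "\<exists>\<tau>\<in>T. \<tau> \<le> \<alpha>" if "\<alpha> \<in> S" for \<alpha>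
    using that
  proof (induction "mdeg \<alpha>" arbitrary: \<alpha> rule: less_induct)
    case less
    show ?case
    proof (cases "\<alpha> \<in> T")
      case False
      then obtain \<sigma> where \<sigma>: "\<sigma> \<in> S" "\<sigma> \<le> \<alpha>" "\<sigma> \<noteq> \<alpha>" using less by (auto simp: T_def)
      then obtain i where "\<sigma> i < \<alpha> i" by (metis le_funD le_neq_implies_less ext)
      then have "mdeg \<sigma> < mdeg \<alpha>"
        unfolding mdeg_def using \<sigma>(2) by (intro sum_strict_mono_ex1) (auto simp: le_fun_def)
      then show ?thesis using less.hyps \<sigma> by (meson order_trans)
    qed auto
  qed
  ultimately show ?thesis by (intro that[of T]) (auto simp: T_def)
qed

text \<open>Orders of exponents are given by injections into the natural numbers. Distinct primes, one for
  each coordinate, make \<open>weight\<close> injective by unique factorization and compatible with addition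
  because it turns sums into products.\<close>

definition coord_prime :: "'n::finite \<Rightarrow> nat"
  where "coord_prime = (SOME p. inj p \<and> (\<forall>i. prime (p i)))"

lemma inj_coord_prime: "inj (coord_prime :: 'n::finite \<Rightarrow> nat)"
  and prime_coord_prime: "prime (coord_prime (i :: 'n))"
proof -
  obtain f :: "'n \<Rightarrow> nat" where f: "inj f"
    using finite_imp_inj_to_nat_seg[of "UNIV :: 'n set"] by auto
  have inf: "infinite {p :: nat. prime p}" by (rule primes_infinite)
  have "inj (enumerate {p :: nat. prime p} \<circ> f)"
    using f strict_mono_enumerate[OF inf] by (simp add: inj_compose strict_mono_imp_inj_on)
  then have "\<exists>p :: 'n \<Rightarrow> nat. inj p \<and> (\<forall>i. prime (p i))"
    using enumerate_in_set[OF inf] by (intro exI[of _ "enumerate {p :: nat. prime p} \<circ> f"]) auto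
  then have "inj (coord_prime :: 'n \<Rightarrow> nat) \<and> (\<forall>i. prime (coord_prime (i :: 'n)))"
    unfolding coord_prime_def by (rule someI_ex)
  then show "inj (coord_prime :: 'n \<Rightarrow> nat)" "prime (coord_prime (i :: 'n))" by blast+
qed

definition weight :: "('n::finite \<Rightarrow> nat) \<Rightarrow> nat"
  where "weight \<alpha> = (\<Prod>i\<in>UNIV. coord_prime i ^ \<alpha> i)"

lemma weight_add: "weight (\<lambda>i. \<alpha> i + \<beta> i) = weight \<alpha> * weight \<beta>"
  by (simp add: weight_def power_add prod.distrib)

lemma weight_pos: "weight \<alpha> > 0"
  unfolding weight_def by (intro prod_pos) (simp add: prime_coord_prime prime_gt_0_nat)

lemma inj_weight: "inj (weight :: ('n::finite \<Rightarrow> nat) \<Rightarrow> nat)"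
proof (rule injI, rule ext)
  fix \<alpha> \<beta> :: "'n \<Rightarrow> nat" and i
  assume eq: "weight \<alpha> = weight \<beta>"
  have "multiplicity (coord_prime i) (weight \<gamma>) = \<gamma> i" for \<gamma> :: "'n \<Rightarrow> nat"
  proof -
    \<comment> \<open>The exponent of \<open>coord_prime i\<close> in the factorization of the weight of \<open>\<gamma>\<close> is \<open>\<gamma> i\<close>.\<close>
    let ?g = "\<lambda>q. \<gamma> (inv_into UNIV coord_prime q)"
    have "weight \<gamma> = (\<Prod>q\<in>range (coord_prime :: 'n \<Rightarrow> nat). q ^ ?g q)"
      unfolding weight_def by (subst prod.reindex) (auto simp: inj_coord_prime)
    then show ?thesis
      using multiplicity_prod_prime_powers[of "range (coord_prime :: 'n \<Rightarrow> nat)" "coord_prime i" ?g]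
        prime_coord_prime
      by (force simp: inj_coord_prime)
  qed
  then show "\<alpha> i = \<beta> i" using eq by metis
qed

text \<open>A monomial order, given by its order-preserving injection into the natural numbers instead of
  a relation; every such order is well-founded with finite initial segments.\<close>

definition exponent_order :: "(('n::finite \<Rightarrow> nat) \<Rightarrow> nat) \<Rightarrow> bool"
  where "exponent_order \<kappa> \<longleftrightarrow> inj \<kappa> \<and>
    (\<forall>\<alpha> \<beta> \<gamma>. \<kappa> \<alpha> < \<kappa> \<beta> \<longrightarrow> \<kappa> (\<lambda>i. \<alpha> i + \<gamma> i) < \<kappa> (\<lambda>i. \<beta> i + \<gamma> i))"

lemma exponent_order_weight: "exponent_order weight"
  by (simp add: exponent_order_def inj_weight weight_add weight_pos)

text \<open>Its powers bound \<open>weight\<close> on the exponents of given degree.\<close>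

definition max_prime :: "'n::finite itself \<Rightarrow> nat"
  where "max_prime _ = Max (range (coord_prime :: 'n \<Rightarrow> nat))"

lemma weight_le: "weight (\<alpha> :: 'n::finite \<Rightarrow> nat) \<le> max_prime TYPE('n) ^ mdeg \<alpha>"
proof -
  have "weight \<alpha> \<le> (\<Prod>i\<in>UNIV. max_prime TYPE('n) ^ \<alpha> i)"
    unfolding weight_def max_prime_def by (intro prod_mono) (auto intro: power_mono)
  then show ?thesis by (simp add: mdeg_def power_sum)
qed

text \<open>The degree is compared first and \<open>weight\<close> decides between exponents of equal degree. The offset
  counts the values that are set aside for the smaller degrees: in degree \<open>d\<close> the weight ranges over
  \<open>{0..M\<^sup>d}\<close>, where \<open>M\<close> is the greatest of the primes.\<close>

definition graded_weight :: "('n::finite \<Rightarrow> nat) \<Rightarrow> nat"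
  where "graded_weight \<alpha> = (\<Sum>d<mdeg \<alpha>. max_prime TYPE('n) ^ d + 1) + weight \<alpha>"

lemma graded_weight_less_if_mdeg_less:
  assumes "mdeg \<alpha> < mdeg \<beta>"
  shows "graded_weight (\<alpha> :: 'n::finite \<Rightarrow> nat) < graded_weight (\<beta> :: 'n \<Rightarrow> nat)"
proof -
  let ?S = "\<lambda>k. \<Sum>d<k. max_prime TYPE('n) ^ d + 1"
  have "graded_weight \<alpha> < ?S (Suc (mdeg \<alpha>))"
    using weight_le[of \<alpha>] by (simp add: graded_weight_def)
  also have "\<dots> \<le> ?S (mdeg \<beta>)" using assms by (intro sum_mono2) auto
  also have "\<dots> \<le> graded_weight \<beta>" by (simp add: graded_weight_def)
  finally show ?thesis .
qed

lemma graded_weight_less_iff: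
  "graded_weight (\<alpha> :: 'n::finite \<Rightarrow> nat) < graded_weight \<beta> \<longleftrightarrow>
    mdeg \<alpha> < mdeg \<beta> \<or> mdeg \<alpha> = mdeg \<beta> \<and> weight \<alpha> < weight (\<beta> :: 'n::finite \<Rightarrow> nat)"
proof -
  consider "mdeg \<alpha> < mdeg \<beta>" | "mdeg \<beta> < mdeg \<alpha>" | "mdeg \<alpha> = mdeg \<beta>" by linarith
  then show ?thesis
  proof cases
    case 1 then show ?thesis using graded_weight_less_if_mdeg_less by blast
  next
    case 2 then show ?thesis using graded_weight_less_if_mdeg_less[OF 2] by simp
  next
    case 3 then show ?thesis by (simp add: graded_weight_def)
  qed
qed

lemma exponent_order_graded_weight: "exponent_order (graded_weight :: ('n::finite \<Rightarrow> nat) \<Rightarrow> nat)"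
proof -
  have "inj (graded_weight :: ('n \<Rightarrow> nat) \<Rightarrow> nat)"
  proof (rule injI)
    fix \<alpha> \<beta> :: "'n \<Rightarrow> nat" assume eq: "graded_weight \<alpha> = graded_weight \<beta>"
    have "mdeg \<alpha> = mdeg \<beta>"
      using graded_weight_less_if_mdeg_less[of \<alpha> \<beta>] graded_weight_less_if_mdeg_less[of \<beta> \<alpha>] eq
      by linarith
    then have "weight \<alpha> = weight \<beta>" using eq by (simp add: graded_weight_def)
    then show "\<alpha> = \<beta>" using inj_weight by (auto dest: injD)
  qed
  then show ?thesis
    unfolding exponent_order_def graded_weight_less_iff mdeg_add weight_add
    using weight_pos by auto
qed

text \<open>For power series, in contrast to polynomials, the least exponent of the support leads.\<close>

definition lead :: "(('n::finite \<Rightarrow> nat) \<Rightarrow> nat) \<Rightarrow> (('n \<Rightarrow> nat) \<Rightarrow> complex) \<Rightarrow> ('n \<Rightarrow> nat) \<Rightarrow> bool"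
  where "lead \<kappa> c \<alpha> \<longleftrightarrow> c \<alpha> \<noteq> 0 \<and> (\<forall>\<beta>. \<kappa> \<beta> < \<kappa> \<alpha> \<longrightarrow> c \<beta> = 0)"

definition initial_exponents ::
    "(('n::finite \<Rightarrow> nat) \<Rightarrow> nat) \<Rightarrow> (('n \<Rightarrow> nat) \<Rightarrow> complex) set \<Rightarrow> ('n \<Rightarrow> nat) set"
  where "initial_exponents \<kappa> V = {\<alpha>. \<exists>c\<in>V. lead \<kappa> c \<alpha>}"

lemma lead_exists:
  assumes "c \<alpha> \<noteq> 0"
  obtains \<beta> where "lead \<kappa> c \<beta>" "\<kappa> \<beta> \<le> \<kappa> \<alpha>"
proof -
  have "\<exists>\<beta>. c \<beta> \<noteq> 0 \<and> \<kappa> \<beta> \<le> \<kappa> \<alpha> \<and> (\<forall>\<gamma>. \<kappa> \<gamma> < \<kappa> \<beta> \<longrightarrow> c \<gamma> = 0)"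
    using assms
  proof (induction "\<kappa> \<alpha>" arbitrary: \<alpha> rule: less_induct)
    case less
    show ?case
    proof (cases "\<forall>\<gamma>. \<kappa> \<gamma> < \<kappa> \<alpha> \<longrightarrow> c \<gamma> = 0")
      case False
      then obtain \<gamma> where "\<kappa> \<gamma> < \<kappa> \<alpha>" "c \<gamma> \<noteq> 0" by blast
      then show ?thesis using less.hyps by (meson less_imp_le_nat order_trans)
    qed (use less.prems in blast)
  qed
  then show ?thesis using that by (auto simp: lead_def)
qed

definition shift :: "('n::finite \<Rightarrow> nat) \<Rightarrow> (('n \<Rightarrow> nat) \<Rightarrow> complex) \<Rightarrow> ('n \<Rightarrow> nat) \<Rightarrow> complex"
  where "shift \<gamma> c = (\<lambda>\<alpha>. if \<gamma> \<le> \<alpha> then c (\<lambda>i. \<alpha> i - \<gamma> i) else 0)"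

lemma exponent_add_diff: "\<gamma> \<le> \<alpha> \<Longrightarrow> (\<lambda>i. \<gamma> i + (\<alpha> i - \<gamma> i)) = (\<alpha> :: 'n \<Rightarrow> nat)"
  "\<gamma> \<le> \<alpha> \<Longrightarrow> (\<lambda>i. (\<alpha> i - \<gamma> i) + \<gamma> i) = (\<alpha> :: 'n \<Rightarrow> nat)"
  "\<gamma> \<le> \<alpha> \<Longrightarrow> (\<lambda>i. \<alpha> i - (\<alpha> i - \<gamma> i)) = (\<gamma> :: 'n \<Rightarrow> nat)"
  "(\<lambda>i. (\<alpha> i + \<gamma> i) - \<gamma> i) = (\<alpha> :: 'n \<Rightarrow> nat)"
  "(\<lambda>i. (\<gamma> i + \<alpha> i) - \<gamma> i) = (\<alpha> :: 'n \<Rightarrow> nat)"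
  by (auto simp: le_fun_def)

lemma exponent_order_cancel:
  assumes "exponent_order \<kappa>" "\<kappa> (\<lambda>i. \<alpha> i + \<gamma> i) < \<kappa> (\<lambda>i. \<beta> i + \<gamma> i)"
  shows "\<kappa> \<alpha> < \<kappa> \<beta>"
proof (rule ccontr)
  assume "\<not> ?thesis"
  moreover have "\<kappa> \<alpha> \<noteq> \<kappa> \<beta>" using assms by (auto simp: exponent_order_def dest: injD)
  ultimately have "\<kappa> \<beta> < \<kappa> \<alpha>" by simp
  then have "\<kappa> (\<lambda>i. \<beta> i + \<gamma> i) < \<kappa> (\<lambda>i. \<alpha> i + \<gamma> i)"
    using assms(1) by (simp add: exponent_order_def)
  then show False using assms(2) by simp
qed

text \<open>Together with \<open>shift_at\<close>: multiplication by a monomial adds its exponent to the leading one, since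
  addition respects the order.\<close>

lemma shift_below:
  assumes "exponent_order \<kappa>" "\<And>\<beta>. \<kappa> \<beta> < \<kappa> \<tau> \<Longrightarrow> c \<beta> = 0" "\<tau> \<le> \<alpha>" "\<kappa> \<beta> < \<kappa> \<alpha>"
  shows "shift (\<lambda>i. \<alpha> i - \<tau> i) c \<beta> = 0"
proof (cases "(\<lambda>i. \<alpha> i - \<tau> i) \<le> \<beta>")
  case True
  let ?\<gamma> = "\<lambda>i. \<alpha> i - \<tau> i"
  have "\<kappa> (\<lambda>i. \<beta> i - ?\<gamma> i) < \<kappa> \<tau>"
    using exponent_order_cancel[OF assms(1), of "\<lambda>i. \<beta> i - ?\<gamma> i" ?\<gamma> \<tau>] assms(3,4) True
    by (simp add: exponent_add_diff)
  then show ?thesis using True assms(2) by (simp add: shift_def)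
qed (simp add: shift_def)

lemma shift_at: "\<tau> \<le> \<alpha> \<Longrightarrow> shift (\<lambda>i. \<alpha> i - \<tau> i) c \<alpha> = c \<tau>"
  by (auto simp: shift_def le_fun_def intro!: arg_cong[of _ _ c])

section \<open>Weighted norms and the uniqueness of power series\<close>

definition weighted_summable :: "nat \<Rightarrow> (('n::finite \<Rightarrow> nat) \<Rightarrow> complex) \<Rightarrow> bool"
  where "weighted_summable s c \<longleftrightarrow> (\<lambda>\<alpha>. norm (c \<alpha>) / real (weight \<alpha>) ^ s) summable_on UNIV"

text \<open>The weight of \<open>\<alpha>\<close> to the power \<open>- s\<close> is the value of the monomial \<open>\<alpha>\<close> at \<open>weight_point s\<close>, so this
  is the sum of the absolute values of the terms of the power series at that point. The points
  \<open>weight_point s\<close> tend to \<open>0\<close> as \<open>s\<close> grows.\<close>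

definition weighted_norm :: "nat \<Rightarrow> (('n::finite \<Rightarrow> nat) \<Rightarrow> complex) \<Rightarrow> real"
  where "weighted_norm s c = (\<Sum>\<^sub>\<infinity>\<alpha>. norm (c \<alpha>) / real (weight \<alpha>) ^ s)"

definition weight_point :: "nat \<Rightarrow> complex ^ 'n::finite"
  where "weight_point s = (\<chi> i. 1 / of_nat (coord_prime i ^ s))"

lemma monomial_weight_point: "monomial (weight_point s) \<alpha> = 1 / of_nat (weight \<alpha> ^ s)"
proof -
  have "(\<Prod>i\<in>UNIV. complex_of_nat (coord_prime i) ^ \<alpha> i) ^ s =
      (\<Prod>i\<in>UNIV. complex_of_nat (coord_prime i) ^ (s * \<alpha> i))"
    by (simp add: prod_power_distrib mult.commute flip: power_mult)
  then show ?thesis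
    by (simp add: monomial_def weight_point_def weight_def power_divide prod_dividef
        flip: power_mult)
qed

text \<open>An increase of \<open>s\<close> costs a term of weight greater than \<open>n\<close> one factor \<open>n + 1\<close> per step.\<close>

lemma inverse_weight_power_mono:
  assumes "s \<le> t" "n < weight \<alpha>"
  shows "1 / real (weight \<alpha>) ^ t \<le> (1 / real (weight \<alpha>) ^ s) / (real n + 1) ^ (t - s)"
proof -
  have "(real n + 1) ^ (t - s) \<le> real (weight \<alpha>) ^ (t - s)"
    using assms(2) by (intro power_mono) auto
  then have "1 / real (weight \<alpha>) ^ (t - s) \<le> 1 / (real n + 1) ^ (t - s)"
    by (intro divide_left_mono) (auto simp: weight_pos)
  then have "1 / real (weight \<alpha>) ^ s * (1 / real (weight \<alpha>) ^ (t - s))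
      \<le> 1 / real (weight \<alpha>) ^ s * (1 / (real n + 1) ^ (t - s))"
    by (intro mult_left_mono) auto
  moreover have "real (weight \<alpha>) ^ t = real (weight \<alpha>) ^ s * real (weight \<alpha>) ^ (t - s)"
    using assms(1) by (simp flip: power_add)
  ultimately show ?thesis by simp
qed

lemma weighted_tail:
  assumes "weighted_summable s c" "s \<le> t" "\<And>\<alpha>. weight \<alpha> \<le> n \<Longrightarrow> c \<alpha> = 0"
  shows "weighted_summable t c" "weighted_norm t c \<le> weighted_norm s c / (real n + 1) ^ (t - s)"
proof -
  let ?f = "\<lambda>t \<alpha>. norm (c \<alpha>) / real (weight \<alpha>) ^ t"
  have le: "?f t \<alpha> \<le> ?f s \<alpha> / (real n + 1) ^ (t - s)" for \<alpha>
  proof (cases "c \<alpha> = 0")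
    case False
    then have "n < weight \<alpha>" using assms(3) by force
    from mult_left_mono[OF inverse_weight_power_mono[OF assms(2) this], of "norm (c \<alpha>)"]
    show ?thesis by simp
  qed simp
  have sum: "(\<lambda>\<alpha>. ?f s \<alpha> / (real n + 1) ^ (t - s)) summable_on UNIV"
    using summable_on_cmult_left[of "?f s" UNIV "1 / (real n + 1) ^ (t - s)"] assms(1)
    by (simp add: weighted_summable_def)
  then show *: "weighted_summable t c"
    unfolding weighted_summable_def by (rule summable_on_comparison_test) (use le in auto)
  have "weighted_norm t c \<le> (\<Sum>\<^sub>\<infinity>\<alpha>. ?f s \<alpha> / (real n + 1) ^ (t - s))"
    unfolding weighted_norm_def
    by (rule infsum_mono) (use * sum le in \<open>auto simp: weighted_summable_def\<close>)
  also have "\<dots> = weighted_norm s c / (real n + 1) ^ (t - s)"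
    unfolding weighted_norm_def by (simp add: divide_inverse infsum_cmult_left')
  finally show "weighted_norm t c \<le> weighted_norm s c / (real n + 1) ^ (t - s)" .
qed

lemma weighted_summable_mono: "weighted_summable s c \<Longrightarrow> s \<le> t \<Longrightarrow> weighted_summable t c"
  using weighted_tail(1)[of s c t 0] weight_pos by (metis le_zero_eq less_numeral_extra(3))

lemma weighted_summable_upd:
  assumes "weighted_summable s c"
  shows "weighted_summable s (c(\<alpha> := 0))"
  using assms unfolding weighted_summable_def by (rule summable_on_comparison_test) auto

text \<open>If \<open>w\<close> is the weight of the leading exponent, then all other exponents of the support have weight
  at least \<open>w + 1\<close>. When \<open>s\<close> increases by one, the leading term is divided by \<open>w\<close> and the sum of the
  others by at least \<open>w + 1\<close>.\<close>

lemma lead_dominates: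
  assumes "lead weight c \<alpha>" "weighted_summable s c" "\<epsilon> > 0"
  shows "\<forall>\<^sub>F t in sequentially. weighted_norm t (c(\<alpha> := 0)) * real (weight \<alpha>) ^ t \<le> \<epsilon>"
proof -
  define w where "w = real (weight \<alpha>)"
  define N where "N = weighted_norm s (c(\<alpha> := 0))"
  have zero: "(c(\<alpha> := 0)) \<beta> = 0" if "weight \<beta> \<le> weight \<alpha>" for \<beta>
    using assms(1) that inj_weight by (auto simp: lead_def le_less dest: injD)
  have w: "w > 0" by (simp add: w_def weight_pos)
  have bound: "weighted_norm t (c(\<alpha> := 0)) * w ^ t \<le> N * w ^ s * (w / (w + 1)) ^ (t - s)"
    if "t \<ge> s" for t
  proof -
    have "weighted_norm t (c(\<alpha> := 0)) * w ^ t \<le> N / (w + 1) ^ (t - s) * w ^ t"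
      using weighted_tail(2)[OF weighted_summable_upd[OF assms(2)] that zero, of "weight \<alpha>"] w
      by (intro mult_right_mono) (simp_all add: N_def w_def fun_upd_def)
    also have "N / (w + 1) ^ (t - s) * w ^ t = N / (w + 1) ^ (t - s) * (w ^ s * w ^ (t - s))"
      using that by (simp flip: power_add)
    finally show ?thesis by (simp add: power_divide mult_ac)
  qed
  have "(\<lambda>k. N * w ^ s * (w / (w + 1)) ^ k) \<longlonglongrightarrow> N * w ^ s * 0"
    using w by (intro tendsto_mult_left LIMSEQ_power_zero) simp
  then have "(\<lambda>k. N * w ^ s * (w / (w + 1)) ^ (k - s)) \<longlonglongrightarrow> 0"
    by (subst LIMSEQ_offset[of _ s]) (auto intro!: LIMSEQ_offset[of _ s])
  then have "\<forall>\<^sub>F t in sequentially. N * w ^ s * (w / (w + 1)) ^ (t - s) < \<epsilon>"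
    using assms(3) by (simp add: order_tendstoD(2))
  then show ?thesis using eventually_ge_at_top[of s]
    by eventually_elim (use bound in \<open>force simp: w_def\<close>)
qed

lemma weight_point_small:
  assumes "r > 0"
  obtains s where "weight_point s \<in> polydisk (\<lambda>_::'n::finite. r)"
proof -
  obtain s where s: "(1 / 2 :: real) ^ s < r"
    using real_arch_pow_inv[OF assms, of "1 / 2"] by auto
  have "1 / real (coord_prime i) ^ s \<le> (1 / 2) ^ s" for i :: 'n
    using prime_ge_2_nat[OF prime_coord_prime[of i]]
    by (auto simp: power_divide intro!: divide_left_mono power_mono)
  then have "1 / real (coord_prime i) ^ s < r" for i :: 'n using s le_less_trans by blast
  then show ?thesis
    by (intro that[of s]) (simp add: polydisk_def weight_point_def norm_divide norm_power)
qed

lemma abs_summable_at_weight_point: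
  assumes "(\<lambda>\<alpha>. c \<alpha> * monomial (weight_point s) \<alpha>) summable_on UNIV"
  shows "weighted_summable s c"
proof -
  have "(\<lambda>\<alpha>. norm (c \<alpha> * monomial (weight_point s) \<alpha>)) summable_on UNIV"
    by (rule summable_on_iff_abs_summable_on_complex[THEN iffD1, OF assms])
  then show ?thesis
    by (simp add: weighted_summable_def monomial_weight_point norm_mult norm_divide norm_power)
qed

lemma norm_term_le_weighted:
  assumes "\<And>i. norm (z $ i) \<le> 1 / real (coord_prime i ^ s)"
  shows "norm (c \<alpha> * monomial z \<alpha>) \<le> norm (c \<alpha>) / real (weight \<alpha>) ^ s"
proof -
  have "norm (monomial z \<alpha>) = (\<Prod>i\<in>UNIV. norm (z $ i) ^ \<alpha> i)"
    by (simp add: monomial_def norm_power flip: prod_norm)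
  also have "\<dots> \<le> (\<Prod>i\<in>UNIV. (1 / real (coord_prime i ^ s)) ^ \<alpha> i)"
    using assms by (intro prod_mono) (auto intro!: power_mono)
  also have "\<dots> = norm (monomial (weight_point s :: complex ^ 'a) \<alpha>)"
    by (simp add: monomial_def weight_point_def norm_divide norm_power flip: prod_norm)
  finally have "norm (monomial z \<alpha>) \<le> 1 / real (weight \<alpha>) ^ s"
    by (simp add: monomial_weight_point norm_divide norm_power)
  from mult_left_mono[OF this, of "norm (c \<alpha>)"] show ?thesis by (simp add: norm_mult)
qed

lemma has_sum_norm_le_weighted_norm:
  assumes "weighted_summable s c" "\<And>i. norm (z $ i) \<le> 1 / real (coord_prime i ^ s)"
    "((\<lambda>\<alpha>. c \<alpha> * monomial z \<alpha>) has_sum v) UNIV"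
  shows "norm v \<le> weighted_norm s c"
proof (rule norm_infsum_le[OF assms(3)])
  show "((\<lambda>\<alpha>. norm (c \<alpha>) / weight \<alpha> ^ s) has_sum weighted_norm s c) UNIV"
    using assms(1) by (simp add: weighted_summable_def weighted_norm_def)
  show "norm (c \<alpha> * monomial z \<alpha>) \<le> norm (c \<alpha>) / weight \<alpha> ^ s" for \<alpha>
    using norm_term_le_weighted[OF assms(2), of c \<alpha>] by simp
qed

lemma has_power_series_uminus:
  assumes "has_power_series f p c"
  shows "has_power_series (\<lambda>z. - f z) p (\<lambda>\<alpha>. - c \<alpha>)"
  using assms unfolding has_power_series_def by (force simp: has_sum_uminus)

lemma has_power_series_diff:
  assumes "has_power_series f p c" "has_power_series g p d"
  shows "has_power_series (\<lambda>z. f z - g z) p (\<lambda>\<alpha>. c \<alpha> - d \<alpha>)"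
  using has_power_series_add[OF assms(1) has_power_series_uminus[OF assms(2)]] by simp

lemma weight_point_norm_le:
  assumes "s \<le> t"
  shows "1 / real (coord_prime i ^ t) \<le> 1 / real (coord_prime i ^ s)"
  using prime_gt_0_nat[OF prime_coord_prime[of i]] assms
  by (intro divide_left_mono) (auto intro!: power_increasing)

text \<open>Were \<open>c\<close> nonzero, then its leading term would exceed the sum of all others at \<open>weight_point t\<close> for
  large \<open>t\<close>, and the value there could not be zero.\<close>

lemma power_series_of_zero:
  assumes "has_power_series (\<lambda>_. 0) p c"
  shows "c \<alpha> = 0"
proof (rule ccontr)
  assume "c \<alpha> \<noteq> 0"
  then obtain \<beta> where lead: "lead weight c \<beta>" by (rule lead_exists)
  obtain r where "r > 0"
    and r: "\<And>z. z \<in> polydisk (\<lambda>_. r) \<Longrightarrow> ((\<lambda>\<alpha>. c \<alpha> * monomial z \<alpha>) has_sum 0) UNIV"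
    using assms unfolding has_power_series_def by blast
  from weight_point_small[OF this(1)] obtain s where s: "weight_point s \<in> polydisk (\<lambda>_::'a. r)" .
  have sum: "weighted_summable s c"
    using r[OF s] by (intro abs_summable_at_weight_point) (auto simp: summable_on_def)
  have pos: "norm (c \<beta>) / 2 > 0" using lead by (simp add: lead_def)
  from lead_dominates[OF lead sum this] eventually_ge_at_top[of s]
  have "\<forall>\<^sub>F t in sequentially. weighted_norm t (c(\<beta> := 0)) * real (weight \<beta>) ^ t \<le> norm (c \<beta>) / 2 \<and> s \<le> t"
    by eventually_elim auto
  then obtain t where t: "weighted_norm t (c(\<beta> := 0)) * real (weight \<beta>) ^ t \<le> norm (c \<beta>) / 2" "s \<le> t"
    using eventually_happens'[OF sequentially_bot] by blast
  let ?z = "weight_point t :: complex ^ 'a"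
  have "?z \<in> polydisk (\<lambda>_. r)"
    using s weight_point_norm_le[OF t(2)]
    by (force simp: polydisk_def weight_point_def norm_divide norm_power intro: le_less_trans)
  moreover have "((\<lambda>\<alpha>. if \<alpha> = \<beta> then - (c \<beta> * monomial ?z \<beta>) else 0) has_sum
      (- (c \<beta> * monomial ?z \<beta>))) UNIV"
    by (subst has_sum_cong_neutral[where T = "{\<beta>}"]) (auto intro: has_sum_finiteI)
  ultimately have "((\<lambda>\<alpha>. c \<alpha> * monomial ?z \<alpha> + (if \<alpha> = \<beta> then - (c \<beta> * monomial ?z \<beta>) else 0))
      has_sum (0 + - (c \<beta> * monomial ?z \<beta>))) UNIV"
    by (intro has_sum_add r)
  moreover have "(\<lambda>\<alpha>. c \<alpha> * monomial ?z \<alpha> + (if \<alpha> = \<beta> then - (c \<beta> * monomial ?z \<beta>) else 0)) =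
      (\<lambda>\<alpha>. (c(\<beta> := 0)) \<alpha> * monomial ?z \<alpha>)"
    by auto
  ultimately have "((\<lambda>\<alpha>. (c(\<beta> := 0)) \<alpha> * monomial ?z \<alpha>) has_sum (- (c \<beta> * monomial ?z \<beta>))) UNIV"
    by simp
  then have "norm (- (c \<beta> * monomial ?z \<beta>)) \<le> weighted_norm t (c(\<beta> := 0))"
    by (intro has_sum_norm_le_weighted_norm weighted_summable_upd
          weighted_summable_mono[OF sum t(2)])
       (auto simp: weight_point_def norm_divide norm_power)
  then have "norm (c \<beta>) \<le> weighted_norm t (c(\<beta> := 0)) * real (weight \<beta>) ^ t"
    using weight_pos[of \<beta>]
    by (simp add: norm_mult monomial_weight_point norm_divide norm_power field_simps)
  with t(1) pos show False by linarith
qed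

lemma has_power_series_unique:
  assumes "has_power_series f p c" "has_power_series f p d"
  shows "c = d"
proof -
  have "has_power_series (\<lambda>_. 0) p (\<lambda>\<alpha>. c \<alpha> - d \<alpha>)"
    using has_power_series_diff[OF assms] by simp
  then show ?thesis using power_series_of_zero by fastforce
qed

section \<open>Convergence on every polydisk in the domain\<close>

definition locally_analytic :: "(complex ^ 'n::finite) set \<Rightarrow> (complex ^ 'n \<Rightarrow> complex) \<Rightarrow> bool"
  where "locally_analytic U f \<longleftrightarrow> (\<forall>p\<in>U. \<exists>c. has_power_series f p c)"

text \<open>On a line through the centre a power series in several variables is a power series in one
  variable, whose coefficients are the values of the homogeneous parts.\<close>

definition homogeneous_part :: "(('n::finite \<Rightarrow> nat) \<Rightarrow> complex) \<Rightarrow> complex ^ 'n \<Rightarrow> nat \<Rightarrow> complex"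
  where "homogeneous_part c z k = (\<Sum>\<alpha> | mdeg \<alpha> = k. c \<alpha> * monomial z \<alpha>)"

lemma finite_mdeg_eq: "finite {\<alpha> :: 'n::finite \<Rightarrow> nat. mdeg \<alpha> = k}"
  by (rule finite_subset[OF _ finite_mdeg_le[of k]]) auto

lemma monomial_scale: "monomial (t *s z) \<alpha> = t ^ mdeg \<alpha> * monomial z \<alpha>"
  by (simp add: monomial_def power_mult_distrib prod.distrib mdeg_def power_sum)

lemma sums_homogeneous_parts:
  assumes "((\<lambda>\<alpha>. c \<alpha> * monomial z \<alpha>) has_sum v) UNIV"
  shows "homogeneous_part c z sums v"
proof -
  have "((\<lambda>(k, \<alpha>). c \<alpha> * monomial z \<alpha>) has_sum v) (Sigma UNIV (\<lambda>k. {\<alpha>. mdeg \<alpha> = k}))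
      = ((\<lambda>\<alpha>. c \<alpha> * monomial z \<alpha>) has_sum v) UNIV"
    by (rule has_sum_reindex_bij_witness[where i = "\<lambda>\<alpha>. (mdeg \<alpha>, \<alpha>)" and j = snd]) auto
  then have "((\<lambda>(k, \<alpha>). c \<alpha> * monomial z \<alpha>) has_sum v) (Sigma UNIV (\<lambda>k. {\<alpha>. mdeg \<alpha> = k}))"
    using assms by simp
  then have "(homogeneous_part c z has_sum v) UNIV"
    by (rule has_sum_SigmaD)
       (auto intro!: has_sum_finiteI finite_mdeg_eq simp: homogeneous_part_def)
  then show ?thesis by (rule has_sum_imp_sums)
qed

lemma scale_into_polydisk:
  assumes "r > 0"
  obtains \<delta> where "\<delta> > 0" "\<And>h. norm h < \<delta> \<Longrightarrow> h *s z \<in> polydisk (\<lambda>_::'n::finite. r)"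
proof -
  define \<delta> where "\<delta> = r / (norm z + 1)"
  have \<delta>: "\<delta> > 0" using assms by (simp add: \<delta>_def add_nonneg_pos)
  have "norm ((h *s z) $ i) < r" if "norm h < \<delta>" for h i
  proof -
    have "norm ((h *s z) $ i) \<le> norm h * norm z"
      by (simp add: norm_mult mult_left_mono Finite_Cartesian_Product.norm_nth_le)
    also have "\<dots> \<le> norm h * (norm z + 1)" by (intro mult_left_mono) auto
    also have "\<dots> < \<delta> * (norm z + 1)" using that by (intro mult_strict_right_mono) (auto simp: add_nonneg_pos)
    also have "\<dots> = r" by (simp add: \<delta>_def add_nonneg_pos[THEN less_imp_neq, symmetric])
    finally show ?thesis .
  qed
  then show ?thesis using \<delta> that by (auto simp: polydisk_def)
qed

lemma slice_sums:
  assumes "has_power_series f q c"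
  obtains \<delta> where "\<delta> > 0"
    "\<And>h. norm h < \<delta> \<Longrightarrow> (\<lambda>k. homogeneous_part c z k * h ^ k) sums f (q + h *s z)"
proof -
  obtain r where "r > 0"
    and r: "\<And>z. z \<in> polydisk (\<lambda>_. r) \<Longrightarrow> ((\<lambda>\<alpha>. c \<alpha> * monomial z \<alpha>) has_sum f (q + z)) UNIV"
    using assms unfolding has_power_series_def by blast
  obtain \<delta> where \<delta>: "\<delta> > 0" "\<And>h. norm h < \<delta> \<Longrightarrow> h *s z \<in> polydisk (\<lambda>_. r)"
    using scale_into_polydisk[OF \<open>r > 0\<close>] by blast
  have "homogeneous_part c (h *s z) = (\<lambda>k. homogeneous_part c z k * h ^ k)" for h
    by (auto simp: homogeneous_part_def fun_eq_iff monomial_scale sum_distrib_left mult_ac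
        intro!: sum.cong)
  then show ?thesis using \<delta> sums_homogeneous_parts[OF r] by (intro that[of \<delta>]) metis+
qed

lemma slice_holomorphic:
  assumes "locally_analytic U f" "\<And>t. t \<in> S \<Longrightarrow> p + t *s z \<in> U"
  shows "(\<lambda>t. f (p + t *s z)) holomorphic_on S"
proof -
  have "(\<lambda>t. f (p + t *s z)) field_differentiable (at t)" if t: "t \<in> S" for t
  proof -
    obtain c where "has_power_series f (p + t *s z) c"
      using assms t by (auto simp: locally_analytic_def)
    from slice_sums[OF this, of z] obtain \<delta> where \<delta>: "\<delta> > 0"
      "\<And>h. norm h < \<delta> \<Longrightarrow> (\<lambda>k. homogeneous_part c z k * h ^ k) sums f (p + t *s z + h *s z)"
      by blast
    have "(\<lambda>u. f (p + u *s z)) holomorphic_on ball t \<delta>"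
    proof (rule power_series_holomorphic)
      fix w assume "w \<in> ball t \<delta>"
      then show "(\<lambda>n. homogeneous_part c z n * (w - t) ^ n) sums f (p + w *s z)"
        using \<delta>(2)[of "w - t"] by (simp add: dist_norm norm_minus_commute algebra_simps)
    qed
    then show ?thesis using \<delta>(1) by (simp add: holomorphic_on_imp_differentiable_at)
  qed
  then show ?thesis
    by (auto simp: holomorphic_on_def field_differentiable_at_within)
qed

lemma homogeneous_part_eq_higher_deriv:
  assumes "has_power_series f p c"
  shows "homogeneous_part c z k = (deriv ^^ k) (\<lambda>t. f (p + t *s z)) 0 / fact k"
proof -
  obtain \<delta> where \<delta>: "\<delta> > 0"
    "\<And>h. norm h < \<delta> \<Longrightarrow> (\<lambda>k. homogeneous_part c z k * h ^ k) sums f (p + h *s z)"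
    using slice_sums[OF assms, of z] by blast
  have "(\<lambda>t. f (p + t *s z)) has_fps_expansion Abs_fps (homogeneous_part c z)"
    by (rule has_fps_expansionI)
       (use \<delta> in \<open>auto simp: eventually_nhds_metric dist_norm\<close>)
  from fps_nth_fps_expansion[OF this, of k] show ?thesis by simp
qed

text \<open>Near a point, \<open>f\<close> is bounded by a weighted norm of its power series.\<close>

lemma locally_analytic_bounded_on_compact:
  assumes "locally_analytic U f" "compact K" "K \<subseteq> U"
  obtains M where "\<And>x. x \<in> K \<Longrightarrow> norm (f x) \<le> M"
proof -
  have "\<exists>V M. open V \<and> q \<in> V \<and> (\<forall>x\<in>V. norm (f x) \<le> M)" if q: "q \<in> U" for q
  proof -
    obtain c r where "r > 0"
      and r: "\<And>z. z \<in> polydisk (\<lambda>_. r) \<Longrightarrow> ((\<lambda>\<alpha>. c \<alpha> * monomial z \<alpha>) has_sum f (q + z)) UNIV"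
      using assms(1) q unfolding locally_analytic_def has_power_series_def by blast
    obtain s where s: "weight_point s \<in> polydisk (\<lambda>_::'a. r)"
      using weight_point_small[OF \<open>r > 0\<close>] .
    define V where "V = (\<lambda>z. q + z) ` polydisk (\<lambda>i::'a. 1 / real (coord_prime i ^ s))"
    have "norm (f x) \<le> weighted_norm s c" if x: "x \<in> V" for x
    proof -
      obtain z where z': "x = q + z" "z \<in> polydisk (\<lambda>i. 1 / real (coord_prime i ^ s))"
        using x unfolding V_def by blast
      then have z: "x = q + z" "\<And>i. norm (z $ i) < 1 / real (coord_prime i ^ s)"
        by (simp_all add: polydisk_def)
      have "z \<in> polydisk (\<lambda>_. r)"
        using z(2) s by (auto simp: polydisk_def weight_point_def norm_divide norm_power
            intro: less_trans)
      from r[OF this] show ?thesis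
        using z(2) r[OF s] unfolding z(1)
        by (intro has_sum_norm_le_weighted_norm[OF abs_summable_at_weight_point])
           (auto simp: summable_on_def intro: less_imp_le)
    qed
    moreover have "open V" unfolding V_def by (intro open_translation open_polydisk)
    moreover have "q \<in> V"
      using prime_gt_0_nat[OF prime_coord_prime]
      by (auto simp: V_def image_iff polydisk_def intro!: bexI[of _ 0])
    ultimately show ?thesis by blast
  qed
  then obtain V M where V: "\<And>q. q \<in> U \<Longrightarrow> open (V q) \<and> q \<in> V q \<and> (\<forall>x\<in>V q. norm (f x) \<le> M q)"
    by metis
  have "K \<subseteq> (\<Union>q\<in>K. V q)" using V assms(3) by blast
  then obtain C where C: "C \<subseteq> K" "finite C" "K \<subseteq> (\<Union>q\<in>C. V q)"
    using compactE_image[OF assms(2), of K V] V assms(3) by blast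
  have "norm (f x) \<le> (\<Sum>q\<in>C. \<bar>M q\<bar>)" if "x \<in> K" for x
  proof -
    obtain q where q: "q \<in> C" "x \<in> V q" using C(3) \<open>x \<in> K\<close> by blast
    have "norm (f x) \<le> \<bar>M q\<bar>" using V q C(1) assms(3) by (meson abs_ge_self order_trans subsetD)
    also have "\<dots> \<le> (\<Sum>q\<in>C. \<bar>M q\<bar>)" by (rule member_le_sum) (use q C in auto)
    finally show ?thesis .
  qed
  then show ?thesis using that by blast
qed

definition root_of_unity :: "nat \<Rightarrow> nat \<Rightarrow> complex"
  where "root_of_unity N j = exp (2 * of_real pi * \<i> * of_nat j / of_nat N)"

lemma root_of_unity_power: "root_of_unity N j ^ b = root_of_unity N (j * b)"
  by (simp add: root_of_unity_def exp_of_nat_mult[symmetric] mult_ac)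

lemma norm_root_of_unity [simp]: "norm (root_of_unity N j) = 1"
proof -
  have "2 * of_real pi * \<i> * of_nat j / of_nat N = \<i> * complex_of_real (2 * pi * j / N)"
    by simp
  then show ?thesis unfolding root_of_unity_def by (metis norm_exp_i_times)
qed

lemma sum_root_of_unity_orthogonal:
  assumes "a < N" "b < N"
  shows "(\<Sum>j<N. root_of_unity N j ^ b * cnj (root_of_unity N j ^ a)) = (if a = b then of_nat N else 0)"
proof -
  have N: "1 \<le> N" using assms by simp
  define x where "x = root_of_unity N b * cnj (root_of_unity N a)"
  have unit: "root_of_unity N j * cnj (root_of_unity N j) = 1" for j
    by (simp add: complex_norm_square[symmetric])
  have geo: "root_of_unity N j ^ b * cnj (root_of_unity N j ^ a) = x ^ j" for j
    by (simp add: x_def power_mult_distrib root_of_unity_power mult.commute flip: complex_cnj_power)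
  show ?thesis
  proof (cases "a = b")
    case True
    then show ?thesis unfolding geo x_def by (simp add: unit)
  next
    case False
    have "root_of_unity N b \<noteq> root_of_unity N a"
      using complex_root_unity_eq[OF N, of b a] False assms by (simp add: root_of_unity_def)
    then have "x \<noteq> 1"
      using unit[of a] unfolding x_def
      by (metis (no_types, opaque_lifting) mult.assoc mult.commute mult.right_neutral)
    moreover have "root_of_unity N (j * N) = 1" for j
      using complex_root_unity_eq_1[OF N, of "j * N"] by (simp add: root_of_unity_def)
    then have "x ^ N = 1"
      by (simp add: x_def power_mult_distrib root_of_unity_power flip: complex_cnj_power)
    ultimately show ?thesis using False unfolding geo by (simp add: sum_gp_strict)
  qed
qed

text \<open>Cauchy's estimate on the torus of radius \<open>r\<close>. Since only monomials of degree \<open>k\<close> are involved,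
  an average over the finite grid of points whose coordinates are \<open>r\<close> times roots of unity of order
  \<open>k + 1\<close> isolates a coefficient, in place of the integral over the torus.\<close>

lemma coefficient_bound_homogeneous:
  fixes c :: "('n::finite \<Rightarrow> nat) \<Rightarrow> complex"
  assumes "r > 0" "\<And>z. (\<And>i. norm (z $ i) = r) \<Longrightarrow> norm (homogeneous_part c z k) \<le> M" "mdeg \<alpha> = k"
  shows "norm (c \<alpha>) * r ^ k \<le> M"
proof -
  \<comment> \<open>Exponents of degree \<open>k\<close> have entries below \<open>N\<close>, so powers of roots of unity of order \<open>N\<close> separate them.\<close>
  define N where "N = Suc k"
  define G where "G = PiE (UNIV :: 'n set) (\<lambda>_. {..<N})"
  define z where "z g = (\<chi> i. of_real r * root_of_unity N (g i))" for g :: "'n \<Rightarrow> nat"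
  define e where "e g = (\<Prod>i\<in>UNIV. cnj (root_of_unity N (g i) ^ \<alpha> i))" for g :: "'n \<Rightarrow> nat"
  have small: "\<beta> i < N" if "mdeg \<beta> = k" for \<beta> :: "'n \<Rightarrow> nat" and i
    using member_le_sum[of i UNIV \<beta>] that by (simp add: mdeg_def N_def)
  have orth: "(\<Sum>g\<in>G. monomial (z g) \<beta> * e g) = (if \<beta> = \<alpha> then of_real r ^ k * of_nat (card G) else 0)"
    if \<beta>: "mdeg \<beta> = k" for \<beta>
  proof -
    have "(\<Sum>g\<in>G. monomial (z g) \<beta> * e g) =
        of_real r ^ k * (\<Sum>g\<in>G. \<Prod>i\<in>UNIV. root_of_unity N (g i) ^ \<beta> i * cnj (root_of_unity N (g i) ^ \<alpha> i))"
      using \<beta> by (auto simp: sum_distrib_left monomial_def z_def e_def power_mult_distrib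
          prod.distrib mdeg_def power_sum intro!: sum.cong)
    also have "(\<Sum>g\<in>G. \<Prod>i\<in>UNIV. root_of_unity N (g i) ^ \<beta> i * cnj (root_of_unity N (g i) ^ \<alpha> i)) =
        (\<Prod>i\<in>UNIV. \<Sum>j<N. root_of_unity N j ^ \<beta> i * cnj (root_of_unity N j ^ \<alpha> i))"
      unfolding G_def by (subst prod_sum_PiE) auto
    also have "\<dots> = (\<Prod>i\<in>UNIV. if \<alpha> i = \<beta> i then of_nat N else 0)"
      by (intro prod.cong refl sum_root_of_unity_orthogonal small assms(3) \<beta>)
    also have "\<dots> = (if \<beta> = \<alpha> then of_nat (card G) else 0)"
      by (auto simp: G_def card_PiE fun_eq_iff prod_zero_iff)
    finally show ?thesis by simp
  qed
  have "(\<Sum>g\<in>G. homogeneous_part c (z g) k * e g) =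
      (\<Sum>\<beta> | mdeg \<beta> = k. c \<beta> * (\<Sum>g\<in>G. monomial (z g) \<beta> * e g))"
    unfolding homogeneous_part_def sum_distrib_right sum_distrib_left
    by (subst sum.swap) (simp add: mult_ac)
  also have "\<dots> = (\<Sum>\<beta> | mdeg \<beta> = k. if \<beta> = \<alpha> then c \<alpha> * (of_real r ^ k * of_nat (card G)) else 0)"
    by (intro sum.cong refl) (auto simp: orth)
  also have "\<dots> = c \<alpha> * (of_real r ^ k * of_nat (card G))"
    using assms(3) by (simp add: sum.delta[OF finite_mdeg_eq])
  finally have "norm (c \<alpha>) * r ^ k * real (card G) = norm (\<Sum>g\<in>G. homogeneous_part c (z g) k * e g)"
    using assms(1) by (simp add: norm_mult norm_power)
  also have "\<dots> \<le> (\<Sum>g\<in>G. M)"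
  proof (rule sum_norm_le)
    fix g
    have "norm (e g) = 1" by (simp add: e_def norm_power flip: prod_norm)
    moreover have "norm (homogeneous_part c (z g) k) \<le> M"
      using assms(1) by (intro assms(2)) (simp add: z_def norm_mult)
    ultimately show "norm (homogeneous_part c (z g) k * e g) \<le> M" by (simp add: norm_mult)
  qed
  finally have "norm (c \<alpha>) * r ^ k * real (card G) \<le> M * real (card G)" by (simp add: mult.commute)
  moreover have "card G > 0" by (simp add: G_def card_PiE N_def)
  ultimately show ?thesis by simp
qed

lemma summable_geometric_multi:
  fixes x :: "'n::finite \<Rightarrow> real"
  assumes "\<And>i. 0 \<le> x i" "\<And>i. x i < 1"
  shows "(\<lambda>\<alpha>. \<Prod>i\<in>UNIV. x i ^ \<alpha> i) summable_on UNIV"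
proof (rule nonneg_bdd_above_summable_on)
  show "bdd_above (sum (\<lambda>\<alpha>. \<Prod>i\<in>UNIV. x i ^ \<alpha> i) ` {F. F \<subseteq> UNIV \<and> finite F})"
  proof (rule bdd_aboveI2)
    fix F :: "('n \<Rightarrow> nat) set" assume "F \<in> {F. F \<subseteq> UNIV \<and> finite F}"
    then have "finite F" by simp
    then obtain K where K: "\<And>\<alpha>. \<alpha> \<in> F \<Longrightarrow> mdeg \<alpha> \<le> K"
      using finite_nat_set_iff_bounded_le[of "mdeg ` F"] by auto
    have sub: "F \<subseteq> PiE UNIV (\<lambda>_. {..K})"
    proof
      fix \<alpha> assume "\<alpha> \<in> F"
      then have "\<alpha> i \<le> K" for i
        using K[of \<alpha>] member_le_sum[of i UNIV \<alpha>] by (simp add: mdeg_def)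
      then show "\<alpha> \<in> PiE UNIV (\<lambda>_. {..K})" by auto
    qed
    have "(\<Sum>\<alpha>\<in>F. \<Prod>i\<in>UNIV. x i ^ \<alpha> i) \<le> (\<Sum>\<alpha>\<in>PiE UNIV (\<lambda>_. {..K}). \<Prod>i\<in>UNIV. x i ^ \<alpha> i)"
      by (intro sum_mono2 sub finite_PiE prod_nonneg) (auto simp: assms)
    also have "\<dots> = (\<Prod>i\<in>UNIV. \<Sum>j\<le>K. x i ^ j)"
      by (subst prod_sum_PiE) auto
    also have "\<dots> \<le> (\<Prod>i\<in>UNIV. 1 / (1 - x i))"
    proof (intro prod_mono conjI sum_nonneg)
      fix i
      have "(\<Sum>j\<le>K. x i ^ j) \<le> suminf (\<lambda>j. x i ^ j)"
        using assms by (intro sum_le_suminf) (auto simp: summable_geometric)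
      also have "\<dots> = 1 / (1 - x i)" using assms by (intro suminf_geometric) auto
      finally show "(\<Sum>j\<le>K. x i ^ j) \<le> 1 / (1 - x i)" .
    qed (use assms in auto)
    finally show "(\<Sum>\<alpha>\<in>F. \<Prod>i\<in>UNIV. x i ^ \<alpha> i) \<le> (\<Prod>i\<in>UNIV. 1 / (1 - x i))" .
  qed
qed (auto intro!: prod_nonneg simp: assms)

text \<open>On lines through \<open>p\<close> the function is holomorphic in one variable. Cauchy's inequality there bounds
  all homogeneous parts on a compact polydisk of radius \<open>r\<close> by the same constant \<open>M\<close>, hence the
  coefficients by \<open>M / r\<^sup>k\<close> in degree \<open>k\<close>, and the series converges by comparison with a geometric one.
  Its value is correct because the Taylor series in one variable has the correct value.\<close>

lemma power_series_converges_on_polydisk: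
  assumes "locally_analytic U f" "has_power_series f p c"
    and U: "\<And>z. z \<in> polydisk (\<lambda>_::'n::finite. R) \<Longrightarrow> p + z \<in> U"
    and z: "z \<in> polydisk (\<lambda>_. R)"
  shows "((\<lambda>\<alpha>. c \<alpha> * monomial z \<alpha>) has_sum f (p + z)) UNIV"
proof -
  have "\<exists>r. 0 < r \<and> r < R \<and> (\<forall>i. norm (z $ i) < r)"
  proof -
    define m where "m = Max (range (\<lambda>i. norm (z $ i)))"
    have m: "norm (z $ i) \<le> m" for i by (simp add: m_def)
    have "m < R" using z by (simp add: m_def polydisk_def)
    moreover have "0 \<le> m" using m norm_ge_zero order_trans by blast
    moreover have "norm (z $ i) < (m + R) / 2" for i
      using m[of i] \<open>m < R\<close> by simp
    ultimately show ?thesis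
      by (intro exI[of _ "(m + R) / 2"]) auto
  qed
  then obtain r where r: "0 < r" "r < R" "\<And>i. norm (z $ i) < r" by blast
  \<comment> \<open>The closed polydisk of radius \<open>r\<close> around \<open>p\<close> is compact and contains \<open>p + z\<close>.\<close>
  define K where "K = {p + w |w. \<forall>i. norm (w $ i) \<le> r}"
  have "K \<subseteq> U"
  proof
    fix x assume "x \<in> K"
    then obtain w :: "complex ^ 'n" where w: "x = p + w" "\<forall>i. norm (w $ i) \<le> r" unfolding K_def by blast
    then have "w \<in> polydisk (\<lambda>_. R)" using r(2) by (auto simp: polydisk_def intro: le_less_trans)
    then show "x \<in> U" using U w(1) by blast
  qed
  have K: "K = {x. \<forall>i. norm ((x - p) $ i) \<le> r}"
  proof (intro equalityI subsetI)
    fix x assume "x \<in> {x. \<forall>i. norm ((x - p) $ i) \<le> r}"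
    then show "x \<in> K" unfolding K_def by (intro CollectI exI[of _ "x - p"]) simp
  qed (auto simp: K_def)
  have "compact K"
  proof -
    have "K = (\<Inter>i. {x. norm ((x - p) $ i) \<le> r})" by (auto simp: K)
    moreover have "closed {x. norm ((x - p) $ i) \<le> r}" for i
      by (intro closed_Collect_le continuous_intros)
    ultimately have "closed K" by auto
    moreover have "bounded K"
    proof (rule boundedI)
      fix x assume "x \<in> K"
      then have "norm (x - p) \<le> (\<Sum>i\<in>(UNIV :: 'n set). r)"
        unfolding norm_vec_def by (intro order_trans[OF L2_set_le_sum] sum_mono) (auto simp: K)
      then show "norm x \<le> norm p + (\<Sum>i\<in>(UNIV :: 'n set). r)"
        using norm_triangle_sub[of x p] by linarith
    qed
    ultimately show ?thesis by (simp add: compact_eq_bounded_closed)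
  qed
  from locally_analytic_bounded_on_compact[OF assms(1) this \<open>K \<subseteq> U\<close>]
  obtain M where M: "\<And>x. x \<in> K \<Longrightarrow> norm (f x) \<le> M" by blast
  \<comment> \<open>The slices are holomorphic on a disk of radius greater than \<open>1\<close>, hence up to the boundary of the unit disk.\<close>
  have slice: "(\<lambda>t. f (p + t *s w)) holomorphic_on ball 0 (R / r)"
    if "\<And>i. norm (w $ i) \<le> r" for w :: "complex ^ 'n"
  proof (rule slice_holomorphic[OF assms(1)], rule U)
    fix t :: complex assume t: "t \<in> ball 0 (R / r)"
    have "norm ((t *s w) $ i) < R" for i
    proof -
      have "norm ((t *s w) $ i) \<le> norm t * r"
        using that[of i] by (simp add: norm_mult mult_left_mono)
      also have "\<dots> < R" using t r by (simp add: field_simps)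
      finally show ?thesis .
    qed
    then show "t *s w \<in> polydisk (\<lambda>_. R)" by (simp add: polydisk_def)
  qed
  have gt1: "1 < R / r" using r by simp
  have part: "norm (homogeneous_part c w k) \<le> M" if w: "\<And>i. norm (w $ i) \<le> r" for w :: "complex ^ 'n" and k
  proof -
    have "norm ((deriv ^^ k) (\<lambda>t. f (p + t *s w)) 0) \<le> fact k * M / 1 ^ k"
    proof (rule Cauchy_inequality)
      have "cball (0::complex) 1 \<subseteq> ball 0 (R / r)" using gt1 by auto
      from holomorphic_on_subset[OF slice[OF w] this]
      show "continuous_on (cball 0 1) (\<lambda>t. f (p + t *s w))"
        by (rule holomorphic_on_imp_continuous_on)
      show "(\<lambda>t. f (p + t *s w)) holomorphic_on ball 0 1"
        by (rule holomorphic_on_subset[OF slice[OF w]]) (use gt1 in auto)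
      show "norm (f (p + t *s w)) \<le> M" if "norm (0 - t) = 1" for t
        by (rule M) (use w that in \<open>auto simp: K norm_mult\<close>)
    qed simp
    then show ?thesis
      by (simp add: homogeneous_part_eq_higher_deriv[OF assms(2)] norm_divide field_simps)
  qed
  have bound: "norm (c \<alpha>) * r ^ mdeg \<alpha> \<le> M" for \<alpha>
    by (rule coefficient_bound_homogeneous[OF r(1)]) (auto intro: part)
  have "(\<lambda>\<alpha>. M * (\<Prod>i\<in>UNIV. (norm (z $ i) / r) ^ \<alpha> i)) summable_on UNIV"
    using r by (intro summable_on_cmult_right summable_geometric_multi) auto
  then have "(\<lambda>\<alpha>. norm (c \<alpha> * monomial z \<alpha>)) summable_on UNIV"
  proof (rule summable_on_comparison_test)
    fix \<alpha>
    have "norm (monomial z \<alpha>) = r ^ mdeg \<alpha> * (\<Prod>i\<in>UNIV. (norm (z $ i) / r) ^ \<alpha> i)"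
      using r(1) by (simp add: monomial_def norm_power mdeg_def power_sum power_divide prod_dividef
          flip: prod_norm)
    then have "norm (c \<alpha> * monomial z \<alpha>) = norm (c \<alpha>) * r ^ mdeg \<alpha> * (\<Prod>i\<in>UNIV. (norm (z $ i) / r) ^ \<alpha> i)"
      by (simp add: norm_mult)
    also have "\<dots> \<le> M * (\<Prod>i\<in>UNIV. (norm (z $ i) / r) ^ \<alpha> i)"
      using r(1) by (intro mult_right_mono bound prod_nonneg) auto
    finally show "norm (c \<alpha> * monomial z \<alpha>) \<le> M * (\<Prod>i\<in>UNIV. (norm (z $ i) / r) ^ \<alpha> i)" .
  qed auto
  then have "(\<lambda>\<alpha>. c \<alpha> * monomial z \<alpha>) summable_on UNIV" by (rule abs_summable_summable)
  then obtain v where v: "((\<lambda>\<alpha>. c \<alpha> * monomial z \<alpha>) has_sum v) UNIV"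
    unfolding summable_on_def by blast
  have "(\<lambda>k. (deriv ^^ k) (\<lambda>t. f (p + t *s z)) 0 / fact k * (1 - 0) ^ k) sums f (p + 1 *s z)"
    by (rule holomorphic_power_series[OF slice]) (use r gt1 in \<open>auto intro: less_imp_le\<close>)
  then have "homogeneous_part c z sums f (p + z)"
    by (simp add: homogeneous_part_eq_higher_deriv[OF assms(2), abs_def])
  with sums_homogeneous_parts[OF v] have "v = f (p + z)" using sums_unique2 by blast
  with v show ?thesis by simp
qed

section \<open>Local Noetherianity\<close>

lemma open_contains_polydisk:
  assumes "open U" "p \<in> U"
  obtains r where "r > 0" "\<forall>z\<in>polydisk (\<lambda>_::'n::finite. r). p + z \<in> U"
proof -
  obtain e where "e > 0" and e: "\<And>y. dist y p < e \<Longrightarrow> y \<in> U"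
    using assms unfolding open_dist by blast
  define r where "r = e / (real CARD('n) + 1)"
  have "p + z \<in> U" if z: "z \<in> polydisk (\<lambda>_. r)" for z
  proof (rule e)
    have "norm z \<le> (\<Sum>i\<in>UNIV. norm (z $ i))" unfolding norm_vec_def by (rule L2_set_le_sum) simp
    also have "\<dots> \<le> (\<Sum>i\<in>(UNIV::'n set). r)"
      using z by (intro sum_mono) (auto simp: polydisk_def less_imp_le)
    also have "\<dots> < e" using \<open>e > 0\<close> by (simp add: r_def field_simps)
    finally show "dist (p + z) p < e" by (simp add: dist_norm)
  qed
  moreover have "r > 0" using \<open>e > 0\<close> by (simp add: r_def)
  ultimately show ?thesis using that by blast
qed

lemma has_sum_shift:
  assumes "((\<lambda>\<alpha>. d \<alpha> * monomial z \<alpha>) has_sum v) UNIV"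
  shows "((\<lambda>\<alpha>. shift \<gamma> d \<alpha> * monomial z \<alpha>) has_sum (monomial z \<gamma> * v)) UNIV"
proof -
  have "((\<lambda>\<alpha>. shift \<gamma> d \<alpha> * monomial z \<alpha>) has_sum (monomial z \<gamma> * v)) {\<alpha>. \<gamma> \<le> \<alpha>}
      = ((\<lambda>\<alpha>. monomial z \<gamma> * (d \<alpha> * monomial z \<alpha>)) has_sum (monomial z \<gamma> * v)) UNIV"
    by (rule has_sum_reindex_bij_witness[where i = "\<lambda>\<alpha> i. \<alpha> i + \<gamma> i" and j = "\<lambda>\<alpha> i. \<alpha> i - \<gamma> i"])
       (auto simp: shift_def exponent_add_diff monomial_add[symmetric] le_fun_def)
  moreover have "((\<lambda>\<alpha>. shift \<gamma> d \<alpha> * monomial z \<alpha>) has_sum (monomial z \<gamma> * v)) UNIV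
      = ((\<lambda>\<alpha>. shift \<gamma> d \<alpha> * monomial z \<alpha>) has_sum (monomial z \<gamma> * v)) {\<alpha>. \<gamma> \<le> \<alpha>}"
    by (rule has_sum_cong_neutral) (auto simp: shift_def)
  ultimately show ?thesis using has_sum_cmult_right[OF assms] by simp
qed

lemma has_sum_weighted_norm:
  assumes "weighted_summable s c"
  shows "((\<lambda>\<alpha>. norm (c \<alpha>) / real (weight \<alpha>) ^ s) has_sum weighted_norm s c) UNIV"
  using assms by (simp add: weighted_summable_def weighted_norm_def)

lemma weighted_shift:
  assumes "weighted_summable s d"
  shows "weighted_summable s (shift \<gamma> d)"
    and "weighted_norm s (shift \<gamma> d) = weighted_norm s d / real (weight \<gamma>) ^ s"
proof -
  let ?f = "\<lambda>\<alpha>. norm (shift \<gamma> d \<alpha>) / real (weight \<alpha>) ^ s"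
  let ?v = "weighted_norm s d / real (weight \<gamma>) ^ s"
  have eq: "1 / real (weight \<gamma>) ^ s * (norm (d (\<lambda>i. \<alpha> i - \<gamma> i)) / real (weight (\<lambda>i. \<alpha> i - \<gamma> i)) ^ s) =
      norm (shift \<gamma> d \<alpha>) / real (weight \<alpha>) ^ s" if "\<gamma> \<le> \<alpha>" for \<alpha>
  proof -
    have "weight \<alpha> = weight \<gamma> * weight (\<lambda>i. \<alpha> i - \<gamma> i)"
      using that by (simp add: exponent_add_diff flip: weight_add)
    then show ?thesis using that by (simp add: shift_def power_mult_distrib)
  qed
  have "(?f has_sum ?v) {\<alpha>. \<gamma> \<le> \<alpha>}
      = ((\<lambda>\<alpha>. 1 / real (weight \<gamma>) ^ s * (norm (d \<alpha>) / real (weight \<alpha>) ^ s)) has_sum ?v) UNIV"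
    by (rule has_sum_reindex_bij_witness[where i = "\<lambda>\<alpha> i. \<alpha> i + \<gamma> i" and j = "\<lambda>\<alpha> i. \<alpha> i - \<gamma> i"])
       (use eq in \<open>auto simp: exponent_add_diff le_fun_def\<close>)
  moreover have "(?f has_sum ?v) UNIV = (?f has_sum ?v) {\<alpha>. \<gamma> \<le> \<alpha>}"
    by (rule has_sum_cong_neutral) (auto simp: shift_def)
  moreover have "((\<lambda>\<alpha>. norm (d \<alpha>) / real (weight \<alpha>) ^ s) has_sum weighted_norm s d) UNIV"
    using has_sum_weighted_norm[OF assms] .
  moreover from this have "((\<lambda>\<alpha>. 1 / real (weight \<gamma>) ^ s * (norm (d \<alpha>) / real (weight \<alpha>) ^ s)) has_sum
      (1 / real (weight \<gamma>) ^ s * weighted_norm s d)) UNIV"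
    by (intro has_sum_cmult_right) simp
  ultimately have "(?f has_sum ?v) UNIV" by simp
  then show "weighted_summable s (shift \<gamma> d)"
    and "weighted_norm s (shift \<gamma> d) = weighted_norm s d / real (weight \<gamma>) ^ s"
    unfolding weighted_summable_def weighted_norm_def summable_on_def by (auto intro: infsumI)
qed

lemma weighted_add_cmult:
  assumes "weighted_summable s c" "weighted_summable s d"
  shows "weighted_summable s (\<lambda>\<alpha>. c \<alpha> + k * d \<alpha>)"
    and "weighted_norm s (\<lambda>\<alpha>. c \<alpha> + k * d \<alpha>) \<le> weighted_norm s c + norm k * weighted_norm s d"
proof -
  let ?N = "\<lambda>c \<alpha>. norm (c \<alpha>) / real (weight \<alpha>) ^ s"
  have le: "?N (\<lambda>\<alpha>. c \<alpha> + k * d \<alpha>) \<alpha> \<le> ?N c \<alpha> + norm k * ?N d \<alpha>" for \<alpha>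
    using norm_triangle_ineq[of "c \<alpha>" "k * d \<alpha>"]
    by (simp add: norm_mult divide_right_mono flip: add_divide_distrib)
  have sum: "((\<lambda>\<alpha>. ?N c \<alpha> + norm k * ?N d \<alpha>) has_sum (weighted_norm s c + norm k * weighted_norm s d)) UNIV"
    using assms by (intro has_sum_add has_sum_cmult_right has_sum_weighted_norm)
  then show *: "weighted_summable s (\<lambda>\<alpha>. c \<alpha> + k * d \<alpha>)"
    unfolding weighted_summable_def
    by (intro summable_on_comparison_test[OF _ le]) (auto simp: summable_on_def)
  show "weighted_norm s (\<lambda>\<alpha>. c \<alpha> + k * d \<alpha>) \<le> weighted_norm s c + norm k * weighted_norm s d"
    by (rule has_sum_mono[OF has_sum_weighted_norm[OF *] sum le])
qed

lemma weighted_norm_split: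
  assumes "weighted_summable s c"
  shows "weighted_norm s c = weighted_norm s (c(\<alpha> := 0)) + norm (c \<alpha>) / real (weight \<alpha>) ^ s"
proof -
  let ?N = "\<lambda>c \<alpha>. norm (c \<alpha>) / real (weight \<alpha>) ^ s"
  have "(?N (c(\<alpha> := 0)) has_sum weighted_norm s (c(\<alpha> := 0))) UNIV"
    by (rule has_sum_weighted_norm[OF weighted_summable_upd[OF assms]])
  moreover have "((\<lambda>\<beta>. if \<beta> = \<alpha> then ?N c \<alpha> else 0) has_sum ?N c \<alpha>) UNIV"
    by (subst has_sum_cong_neutral[where T = "{\<alpha>}"]) (auto intro: has_sum_finiteI)
  ultimately have "((\<lambda>\<beta>. ?N (c(\<alpha> := 0)) \<beta> + (if \<beta> = \<alpha> then ?N c \<alpha> else 0)) has_sum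
      (weighted_norm s (c(\<alpha> := 0)) + ?N c \<alpha>)) UNIV" by (rule has_sum_add)
  moreover have "(\<lambda>\<beta>. ?N (c(\<alpha> := 0)) \<beta> + (if \<beta> = \<alpha> then ?N c \<alpha> else 0)) = ?N c" by auto
  ultimately show ?thesis by (simp add: weighted_norm_def infsumI)
qed

text \<open>The combinations of members of \<open>F\<close> with polynomial coefficients, built up one term at a time.
  Each power series is paired with the function that it represents, because the division below
  cancels terms of the power series and must know what happens to the values of the function.\<close>

inductive_set polynomial_combinations ::
    "((('n::finite \<Rightarrow> nat) \<Rightarrow> complex) \<times> (complex ^ 'n \<Rightarrow> complex)) set
      \<Rightarrow> ((('n \<Rightarrow> nat) \<Rightarrow> complex) \<times> (complex ^ 'n \<Rightarrow> complex)) set"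
  for F where
  zero: "(\<lambda>_. 0, \<lambda>_. 0) \<in> polynomial_combinations F"
| add: "(c, f) \<in> polynomial_combinations F \<Longrightarrow> (d, g) \<in> F \<Longrightarrow>
    (\<lambda>\<alpha>. c \<alpha> + k * shift \<gamma> d \<alpha>, \<lambda>z. f z + k * (monomial z \<gamma> * g z)) \<in> polynomial_combinations F"

lemma shift_zero: "shift \<gamma> (\<lambda>_. 0) = (\<lambda>_. 0)"
  by (auto simp: shift_def)

lemma shift_add_cmult: "shift \<gamma> (\<lambda>\<alpha>. c \<alpha> + k * d \<alpha>) \<alpha> = shift \<gamma> c \<alpha> + k * shift \<gamma> d \<alpha>"
  by (simp add: shift_def)

lemma shift_shift: "shift \<gamma> (shift \<delta> c) = shift (\<lambda>i. \<gamma> i + \<delta> i) c"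
proof
  fix \<alpha>
  have "\<gamma> i \<le> \<alpha> i \<and> \<delta> i \<le> \<alpha> i - \<gamma> i \<longleftrightarrow> \<gamma> i + \<delta> i \<le> \<alpha> i" for i by arith
  then have "\<gamma> \<le> \<alpha> \<and> \<delta> \<le> (\<lambda>i. \<alpha> i - \<gamma> i) \<longleftrightarrow> (\<lambda>i. \<gamma> i + \<delta> i) \<le> \<alpha>"
    unfolding le_fun_def by blast
  then show "shift \<gamma> (shift \<delta> c) \<alpha> = shift (\<lambda>i. \<gamma> i + \<delta> i) c \<alpha>"
    by (auto simp: shift_def)
qed

lemma shift_0: "shift (\<lambda>_. 0) c = c"
  by (auto simp: shift_def le_fun_def)

lemma polynomial_combinations_add_shift:
  assumes "(d, g) \<in> polynomial_combinations F" "(c, f) \<in> polynomial_combinations F"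
  shows "(\<lambda>\<alpha>. c \<alpha> + k * shift \<gamma> d \<alpha>, \<lambda>z. f z + k * (monomial z \<gamma> * g z)) \<in> polynomial_combinations F"
  using assms
proof induction
  case zero
  then show ?case by (simp add: shift_zero)
next
  case (add d g e h l \<delta>)
  note * = polynomial_combinations.add[OF add.IH[OF add.prems] add.hyps(2), of "k * l" "\<lambda>i. \<gamma> i + \<delta> i"]
  have 1: "(\<lambda>\<alpha>. c \<alpha> + k * shift \<gamma> (\<lambda>\<alpha>. d \<alpha> + l * shift \<delta> e \<alpha>) \<alpha>) =
      (\<lambda>\<alpha>. c \<alpha> + k * shift \<gamma> d \<alpha> + k * l * shift (\<lambda>i. \<gamma> i + \<delta> i) e \<alpha>)"
    by (simp only: shift_add_cmult shift_shift distrib_left mult.assoc add.assoc)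
  have alg: "x + y * (m * (u + w * (n * v))) = x + y * (m * u) + y * w * (m * n * v)"
    for x y m u w n v :: complex
    by (simp add: algebra_simps)
  have 2: "(\<lambda>z. f z + k * (monomial z \<gamma> * (g z + l * (monomial z \<delta> * h z)))) =
      (\<lambda>z. f z + k * (monomial z \<gamma> * g z) + k * l * (monomial z (\<lambda>i. \<gamma> i + \<delta> i) * h z))"
    by (simp only: alg monomial_add)
  show ?case unfolding 1 2 by (fact *)
qed

lemma polynomial_combinations_base: "(d, g) \<in> F \<Longrightarrow> (d, g) \<in> polynomial_combinations F"
  using polynomial_combinations.add[OF polynomial_combinations.zero, of d g F 1 "\<lambda>_. 0"]
  by (simp add: shift_0 monomial_zero)

lemma polynomial_combinations_has_sum:
  assumes "(c, f) \<in> polynomial_combinations F"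
    "\<And>d g. (d, g) \<in> F \<Longrightarrow> ((\<lambda>\<alpha>. d \<alpha> * monomial z \<alpha>) has_sum g z) UNIV"
  shows "((\<lambda>\<alpha>. c \<alpha> * monomial z \<alpha>) has_sum f z) UNIV"
  using assms(1)
proof induction
  case (add c f d g k \<gamma>)
  from has_sum_add[OF add.IH has_sum_cmult_right[OF has_sum_shift[OF assms(2)[OF add.hyps(2)]], of k]]
  show ?case by (simp add: distrib_right mult.assoc)
qed simp

lemma polynomial_combinations_finite_support:
  assumes "(c, f) \<in> polynomial_combinations F"
  shows "\<exists>F0\<subseteq>F. finite F0 \<and> (\<forall>z. (\<forall>(d, g)\<in>F0. g z = 0) \<longrightarrow> f z = 0)"
  using assms
proof induction
  case zero
  show ?case by (rule exI[of _ "{}"]) auto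
next
  case (add c f d g k \<gamma>)
  then obtain F0 where "F0 \<subseteq> F" "finite F0" "\<forall>z. (\<forall>(d, g)\<in>F0. g z = 0) \<longrightarrow> f z = 0" by blast
  with add.hyps(2) show ?case by (intro exI[of _ "insert (d, g) F0"]) auto
qed

text \<open>A step of the division removes the term of weight \<open>n\<close> with a multiple of the divisor \<open>h \<tau>\<close>. The
  other terms of \<open>h \<tau>\<close> have together at most the norm of its leading term, so the norm that they add
  is at most that of the term removed. The function does not change at the common zeros of the
  divisors.\<close>

lemma reduction_step:
  assumes c: "(c, f) \<in> polynomial_combinations F" "\<And>\<alpha>. weight \<alpha> < n \<Longrightarrow> c \<alpha> = 0" "weighted_summable s c"
    and T: "\<And>\<alpha>. \<alpha> \<in> initial_exponents weight (fst ` polynomial_combinations F) \<Longrightarrow> \<exists>\<tau>\<in>T. \<tau> \<le> \<alpha>"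
    and h: "\<And>\<tau>. \<tau> \<in> T \<Longrightarrow> (h \<tau>, \<phi> \<tau>) \<in> polynomial_combinations F \<and> lead weight (h \<tau>) \<tau> \<and>
        weighted_summable s (h \<tau>) \<and>
        weighted_norm s ((h \<tau>)(\<tau> := 0)) * real (weight \<tau>) ^ s \<le> norm (h \<tau> \<tau>)"
  shows "\<exists>c' f'. (c', f') \<in> polynomial_combinations F \<and> (\<forall>\<alpha>. weight \<alpha> < Suc n \<longrightarrow> c' \<alpha> = 0) \<and>
    weighted_summable s c' \<and> weighted_norm s c' \<le> weighted_norm s c \<and>
    (\<forall>z. (\<forall>\<tau>\<in>T. \<phi> \<tau> z = 0) \<longrightarrow> f' z = f z)"
proof (cases "\<exists>\<alpha>. weight \<alpha> = n \<and> c \<alpha> \<noteq> 0")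
  case False
  then show ?thesis using c by (intro exI[of _ c] exI[of _ f]) (auto simp: less_Suc_eq)
next
  case True
  then obtain \<alpha> where \<alpha>: "weight \<alpha> = n" "c \<alpha> \<noteq> 0" by blast
  then have "lead weight c \<alpha>" using c(2) by (auto simp: lead_def)
  then have "\<alpha> \<in> initial_exponents weight (fst ` polynomial_combinations F)"
    using c(1) unfolding initial_exponents_def by force
  then obtain \<tau> where \<tau>: "\<tau> \<in> T" "\<tau> \<le> \<alpha>" using T by blast
  note h = h[OF \<tau>(1)]
  have h0: "h \<tau> \<tau> \<noteq> 0" using h by (simp add: lead_def)
  define \<gamma> where "\<gamma> = (\<lambda>i. \<alpha> i - \<tau> i)"
  define k where "k = - (c \<alpha> / h \<tau> \<tau>)"
  define c' where "c' = (\<lambda>\<beta>. c \<beta> + k * shift \<gamma> (h \<tau>) \<beta>)"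
  have in_F: "(c', \<lambda>z. f z + k * (monomial z \<gamma> * \<phi> \<tau> z)) \<in> polynomial_combinations F"
    unfolding c'_def using h c(1) by (intro polynomial_combinations_add_shift) auto
  have weight: "weight \<alpha> = weight \<tau> * weight \<gamma>"
    using \<tau>(2) by (simp add: \<gamma>_def exponent_add_diff flip: weight_add)
  have zero: "c' \<beta> = 0" if "weight \<beta> < Suc n" for \<beta>
  proof (cases "\<beta> = \<alpha>")
    case True
    then show ?thesis using h0 \<tau>(2) by (simp add: c'_def \<gamma>_def shift_at k_def)
  next
    case False
    then have "weight \<beta> < weight \<alpha>"
      using that \<alpha>(1) inj_weight by (auto simp: less_Suc_eq dest: injD)
    moreover from this have "shift \<gamma> (h \<tau>) \<beta> = 0"
      unfolding \<gamma>_def using h \<tau>(2)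
      by (intro shift_below[OF exponent_order_weight]) (auto simp: lead_def)
    ultimately show ?thesis using c(2) \<alpha>(1) by (simp add: c'_def)
  qed
  \<comment> \<open>The two terms at \<open>\<alpha>\<close> cancel, so both leading terms may be omitted before norms are taken.\<close>
  have c'_eq: "c' = (\<lambda>\<beta>. (c(\<alpha> := 0)) \<beta> + k * shift \<gamma> ((h \<tau>)(\<tau> := 0)) \<beta>)"
  proof
    fix \<beta>
    show "c' \<beta> = (c(\<alpha> := 0)) \<beta> + k * shift \<gamma> ((h \<tau>)(\<tau> := 0)) \<beta>"
    proof (cases "\<beta> = \<alpha>")
      case True
      then show ?thesis using zero[of \<alpha>] \<alpha>(1) \<tau>(2) by (simp add: \<gamma>_def shift_at)
    next
      case False
      have "(\<lambda>i. \<beta> i - \<gamma> i) \<noteq> \<tau>" if "\<gamma> \<le> \<beta>"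
      proof
        assume eq: "(\<lambda>i. \<beta> i - \<gamma> i) = \<tau>"
        have "\<beta> = (\<lambda>i. \<gamma> i + (\<beta> i - \<gamma> i))" using that by (simp only: exponent_add_diff)
        also have "\<dots> = (\<lambda>i. \<gamma> i + \<tau> i)" using fun_cong[OF eq] by simp
        also have "\<dots> = \<alpha>" using \<tau>(2) by (simp add: \<gamma>_def exponent_add_diff)
        finally show False using False by simp
      qed
      then show ?thesis using False by (simp add: c'_def shift_def)
    qed
  qed
  have sum: "weighted_summable s (c(\<alpha> := 0))" "weighted_summable s ((h \<tau>)(\<tau> := 0))"
    using c(3) h by (auto intro: weighted_summable_upd)
  have "weighted_norm s c' \<le> weighted_norm s (c(\<alpha> := 0)) +
      norm k * (weighted_norm s ((h \<tau>)(\<tau> := 0)) / real (weight \<gamma>) ^ s)"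
    using weighted_add_cmult(2)[OF sum(1) weighted_shift(1)[OF sum(2)]]
    unfolding c'_eq weighted_shift(2)[OF sum(2), symmetric] .
  also have "norm k * (weighted_norm s ((h \<tau>)(\<tau> := 0)) / real (weight \<gamma>) ^ s) \<le> norm (c \<alpha>) / real (weight \<alpha>) ^ s"
  proof -
    have pos: "real (weight \<tau>) ^ s > 0" "real (weight \<gamma>) ^ s > 0" by (simp_all add: weight_pos)
    have "weighted_norm s ((h \<tau>)(\<tau> := 0)) \<le> norm (h \<tau> \<tau>) / real (weight \<tau>) ^ s"
      using h pos by (simp add: pos_le_divide_eq)
    then have "norm k * (weighted_norm s ((h \<tau>)(\<tau> := 0)) / real (weight \<gamma>) ^ s) \<le>
        norm k * (norm (h \<tau> \<tau>) / real (weight \<tau>) ^ s / real (weight \<gamma>) ^ s)"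
      using pos by (intro mult_left_mono divide_right_mono) auto
    also have "\<dots> = norm (c \<alpha>) / real (weight \<alpha>) ^ s"
      using h0 by (simp add: k_def norm_divide weight power_mult_distrib)
    finally show ?thesis .
  qed
  finally have "weighted_norm s c' \<le> weighted_norm s c"
    unfolding weighted_norm_split[OF c(3), of \<alpha>] by (simp only: add_left_mono)
  moreover have "weighted_summable s c'"
    unfolding c'_eq by (intro weighted_add_cmult sum weighted_shift)
  ultimately show ?thesis
    using in_F zero \<tau>(1)
    by (intro exI[of _ c'] exI[of _ "\<lambda>z. f z + k * (monomial z \<gamma> * \<phi> \<tau> z)"]) auto
qed

text \<open>After \<open>n\<close> steps only terms of weight greater than \<open>n\<close> are left while the norm for \<open>s\<close> has not
  increased; so the norm for \<open>s + 1\<close>, which bounds the value at \<open>z\<close>, is at most \<open>1 / (n + 1)\<close> times the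
  original norm for \<open>s\<close>.\<close>

lemma reduction_vanishes:
  assumes c: "(c, f) \<in> polynomial_combinations F" "weighted_summable s c"
    and T: "\<And>\<alpha>. \<alpha> \<in> initial_exponents weight (fst ` polynomial_combinations F) \<Longrightarrow> \<exists>\<tau>\<in>T. \<tau> \<le> \<alpha>"
    and h: "\<And>\<tau>. \<tau> \<in> T \<Longrightarrow> (h \<tau>, \<phi> \<tau>) \<in> polynomial_combinations F \<and> lead weight (h \<tau>) \<tau> \<and>
        weighted_summable s (h \<tau>) \<and>
        weighted_norm s ((h \<tau>)(\<tau> := 0)) * real (weight \<tau>) ^ s \<le> norm (h \<tau> \<tau>)"
    and F: "\<And>d g. (d, g) \<in> F \<Longrightarrow> ((\<lambda>\<alpha>. d \<alpha> * monomial z \<alpha>) has_sum g z) UNIV"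
    and z: "\<And>i. norm (z $ i) \<le> 1 / real (coord_prime i ^ Suc s)" "\<And>\<tau>. \<tau> \<in> T \<Longrightarrow> \<phi> \<tau> z = 0"
  shows "f z = 0"
proof -
  have reduced: "\<exists>c' f'. (c', f') \<in> polynomial_combinations F \<and> (\<forall>\<alpha>. weight \<alpha> < n \<longrightarrow> c' \<alpha> = 0) \<and>
      weighted_summable s c' \<and> weighted_norm s c' \<le> weighted_norm s c \<and>
      (\<forall>z. (\<forall>\<tau>\<in>T. \<phi> \<tau> z = 0) \<longrightarrow> f' z = f z)" for n
  proof (induction n)
    case 0
    show ?case using c by (intro exI[of _ c] exI[of _ f]) auto
  next
    case (Suc n)
    then obtain c' f' where c': "(c', f') \<in> polynomial_combinations F" "\<And>\<alpha>. weight \<alpha> < n \<Longrightarrow> c' \<alpha> = 0"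
      "weighted_summable s c'" "weighted_norm s c' \<le> weighted_norm s c"
      "\<And>z. (\<forall>\<tau>\<in>T. \<phi> \<tau> z = 0) \<Longrightarrow> f' z = f z" by blast
    from reduction_step[OF c'(1-3) T h] obtain c2 f2 where
      "(c2, f2) \<in> polynomial_combinations F" "\<forall>\<alpha>. weight \<alpha> < Suc n \<longrightarrow> c2 \<alpha> = 0"
      "weighted_summable s c2" "weighted_norm s c2 \<le> weighted_norm s c'"
      "\<forall>z. (\<forall>\<tau>\<in>T. \<phi> \<tau> z = 0) \<longrightarrow> f2 z = f' z" by blast
    with c'(4,5) show ?case by (intro exI[of _ c2] exI[of _ f2]) auto
  qed
  have bound: "norm (f z) \<le> weighted_norm s c / (real n + 1)" for n
  proof -
    obtain c' f' where c': "(c', f') \<in> polynomial_combinations F" "\<And>\<alpha>. weight \<alpha> < Suc n \<Longrightarrow> c' \<alpha> = 0"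
      "weighted_summable s c'" "weighted_norm s c' \<le> weighted_norm s c"
      "\<And>z. (\<forall>\<tau>\<in>T. \<phi> \<tau> z = 0) \<Longrightarrow> f' z = f z"
      using reduced[of "Suc n"] by blast
    have tail: "weighted_summable (Suc s) c'"
        "weighted_norm (Suc s) c' \<le> weighted_norm s c' / (real n + 1) ^ (Suc s - s)"
      using weighted_tail[OF c'(3), of "Suc s" n] c'(2) by auto
    have "norm (f z) = norm (f' z)" using c'(5) z(2) by simp
    also have "\<dots> \<le> weighted_norm (Suc s) c'"
      by (rule has_sum_norm_le_weighted_norm[OF tail(1) z(1)],
          rule polynomial_combinations_has_sum[OF c'(1)], rule F)
    also have "\<dots> \<le> weighted_norm s c / (real n + 1)"
      using tail(2) divide_right_mono[OF c'(4), of "real n + 1"] by simp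
    finally show ?thesis .
  qed
  have "(\<lambda>n. weighted_norm s c / (real n + 1)) \<longlonglongrightarrow> 0"
    by (intro tendsto_divide_0[OF tendsto_const] filterlim_at_top_imp_at_infinity
          filterlim_tendsto_add_at_top[OF tendsto_const, where c = 1, unfolded add.commute[of 1]]
          filterlim_real_sequentially)
  then have "norm (f z) \<le> 0" using bound by (intro LIMSEQ_le_const) auto
  then show ?thesis by simp
qed

text \<open>Finitely many polynomial combinations, found by Dickson's lemma, divide all others, and each of
  them involves finitely many members of \<open>F\<close>. All these power series converge on a common polydisk, so
  a single large \<open>s\<close> makes the leading terms of the divisors dominate, and then \<open>reduction_vanishes\<close>
  applies to every member of \<open>F\<close> on the same neighbourhood.\<close>

theorem zero_set_locally_finite:
  fixes F :: "(complex ^ 'n::finite \<Rightarrow> complex) set"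
  assumes "open U" "a \<in> U" "\<And>f. f \<in> F \<Longrightarrow> locally_analytic U f"
  obtains F0 where "finite F0" "F0 \<subseteq> F"
    "\<forall>\<^sub>F z in nhds a. (\<forall>f\<in>F0. f z = 0) \<longrightarrow> (\<forall>f\<in>F. f z = 0)"
proof -
  obtain R where R: "R > 0" "\<forall>z\<in>polydisk (\<lambda>_::'n. R). a + z \<in> U"
    by (rule open_contains_polydisk[OF assms(1,2)])
  \<comment> \<open>The members of \<open>F\<close> as functions of the displacement from \<open>a\<close>, with their power series.\<close>
  define P where "P = {(c, \<lambda>z. f (a + z)) |c f. f \<in> F \<and> has_power_series f a c}"
  have P: "((\<lambda>\<alpha>. d \<alpha> * monomial z \<alpha>) has_sum g z) UNIV"
    if dg: "(d, g) \<in> P" and z: "z \<in> polydisk (\<lambda>_. R)" for d g z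
  proof -
    obtain f where f: "f \<in> F" "has_power_series f a d" "g = (\<lambda>z. f (a + z))"
      using dg unfolding P_def by blast
    show ?thesis
      unfolding f(3)
      by (rule power_series_converges_on_polydisk[OF assms(3)[OF f(1)] f(2) bspec[OF R(2)] z])
  qed
  \<comment> \<open>The norm for \<open>s0\<close> is finite for all members of \<open>F\<close> at once.\<close>
  obtain s0 where s0: "weight_point s0 \<in> polydisk (\<lambda>_::'n. R)"
    using weight_point_small[OF R(1)] .
  have summable: "weighted_summable s c" if "(c, f) \<in> polynomial_combinations P" "s0 \<le> s" for c f s
  proof -
    have "((\<lambda>\<alpha>. c \<alpha> * monomial (weight_point s0) \<alpha>) has_sum f (weight_point s0)) UNIV"
      by (rule polynomial_combinations_has_sum[OF that(1)]) (rule P[OF _ s0])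
    then have "(\<lambda>\<alpha>. c \<alpha> * monomial (weight_point s0) \<alpha>) summable_on UNIV"
      unfolding summable_on_def by blast
    from weighted_summable_mono[OF abs_summable_at_weight_point[OF this] that(2)]
    show ?thesis .
  qed
  obtain T where T: "T \<subseteq> initial_exponents weight (fst ` polynomial_combinations P)" "finite T"
    "\<And>\<alpha>. \<alpha> \<in> initial_exponents weight (fst ` polynomial_combinations P) \<Longrightarrow> \<exists>\<tau>\<in>T. \<tau> \<le> \<alpha>"
    using Dickson[of "initial_exponents weight (fst ` polynomial_combinations P)"] by blast
  have "\<exists>h \<phi>. (h, \<phi>) \<in> polynomial_combinations P \<and> lead weight h \<tau>" if "\<tau> \<in> T" for \<tau>
    using T(1) that unfolding initial_exponents_def by fastforce
  then obtain h \<phi> where h: "\<And>\<tau>. \<tau> \<in> T \<Longrightarrow> (h \<tau>, \<phi> \<tau>) \<in> polynomial_combinations P \<and> lead weight (h \<tau>) \<tau>"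
    by metis
  have "\<forall>\<^sub>F s in sequentially. weighted_norm s ((h \<tau>)(\<tau> := 0)) * real (weight \<tau>) ^ s \<le> norm (h \<tau> \<tau>)"
    if "\<tau> \<in> T" for \<tau>
    using h[OF that]
    by (intro lead_dominates[where s = s0] summable[where f = "\<phi> \<tau>"]) (auto simp: lead_def)
  then have "\<forall>\<^sub>F s in sequentially. s0 \<le> s \<and>
      (\<forall>\<tau>\<in>T. weighted_norm s ((h \<tau>)(\<tau> := 0)) * real (weight \<tau>) ^ s \<le> norm (h \<tau> \<tau>))"
    using T(2) by (intro eventually_conj eventually_ge_at_top eventually_ball_finite) auto
  then obtain s where s: "s0 \<le> s"
      "\<And>\<tau>. \<tau> \<in> T \<Longrightarrow> weighted_norm s ((h \<tau>)(\<tau> := 0)) * real (weight \<tau>) ^ s \<le> norm (h \<tau> \<tau>)"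
    using eventually_happens'[OF sequentially_bot] by blast
  have "\<exists>F0\<subseteq>P. finite F0 \<and> (\<forall>z. (\<forall>(d, g)\<in>F0. g z = 0) \<longrightarrow> \<phi> \<tau> z = 0)" if "\<tau> \<in> T" for \<tau>
    using h[OF that] polynomial_combinations_finite_support by blast
  then obtain S where S: "\<And>\<tau>. \<tau> \<in> T \<Longrightarrow> S \<tau> \<subseteq> P \<and> finite (S \<tau>) \<and>
      (\<forall>z. (\<forall>(d, g)\<in>S \<tau>. g z = 0) \<longrightarrow> \<phi> \<tau> z = 0)" by metis
  have "\<forall>q\<in>P. \<exists>f. f \<in> F \<and> snd q = (\<lambda>z. f (a + z))" by (auto simp: P_def)
  then obtain pre where pre: "\<And>q. q \<in> P \<Longrightarrow> pre q \<in> F \<and> snd q = (\<lambda>z. pre q (a + z))" by metis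
  \<comment> \<open>The members of \<open>F\<close> from which the divisors are combined.\<close>
  define F0 where "F0 = pre ` (\<Union>\<tau>\<in>T. S \<tau>)"
  define V where "V = (\<lambda>z. a + z) ` polydisk (\<lambda>i::'n. 1 / real (coord_prime i ^ Suc s))"
  have small: "z \<in> polydisk (\<lambda>_. R)" if "z \<in> polydisk (\<lambda>i::'n. 1 / real (coord_prime i ^ Suc s))" for z
  proof -
    have "norm (z $ i) < R" for i
    proof -
      have "norm (z $ i) < 1 / real (coord_prime i ^ Suc s)" using that by (simp add: polydisk_def)
      also have "\<dots> \<le> 1 / real (coord_prime i ^ s0)" by (intro weight_point_norm_le le_SucI s(1))
      also have "\<dots> < R" using s0 by (simp add: polydisk_def weight_point_def norm_divide norm_power)
      finally show ?thesis .
    qed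
    then show ?thesis by (simp add: polydisk_def)
  qed
  show ?thesis
  proof (rule that[of F0])
    show "finite F0" using S T(2) unfolding F0_def by blast
    have "(\<Union>\<tau>\<in>T. S \<tau>) \<subseteq> P" using S by blast
    then show "F0 \<subseteq> F" using pre unfolding F0_def by blast
    have "open V" unfolding V_def by (intro open_translation open_polydisk)
    moreover have "a \<in> V"
      using prime_gt_0_nat[OF prime_coord_prime]
      by (auto simp: V_def image_iff polydisk_def simp del: power_Suc intro!: bexI[of _ 0])
    moreover have "f (a + z) = 0"
      if z: "z \<in> polydisk (\<lambda>i::'n. 1 / real (coord_prime i ^ Suc s))"
        and F0: "\<forall>f\<in>F0. f (a + z) = 0" and f: "f \<in> F" for f z
    proof -
      obtain c where "has_power_series f a c"
        using assms(2,3) f by (auto simp: locally_analytic_def)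
      then have "(c, \<lambda>z. f (a + z)) \<in> P" using f by (auto simp: P_def)
      then have c: "(c, \<lambda>z. f (a + z)) \<in> polynomial_combinations P"
        by (rule polynomial_combinations_base)
      have "\<phi> \<tau> z = 0" if \<tau>: "\<tau> \<in> T" for \<tau>
      proof -
        have "g z = 0" if "(d, g) \<in> S \<tau>" for d g
        proof -
          have "pre (d, g) \<in> F0" using that \<tau> by (auto simp: F0_def)
          moreover have "(d, g) \<in> P" using that S[OF \<tau>] by blast
          ultimately show ?thesis
            using F0 fun_cong[OF conjunct2[OF pre[of "(d, g)"]], of z] by simp
        qed
        then show ?thesis using S[OF \<tau>] by blast
      qed
      moreover have "norm (z $ i) \<le> 1 / real (coord_prime i ^ Suc s)" for i
        using z by (simp add: polydisk_def less_imp_le)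
      ultimately show ?thesis
        using h s small[OF z] summable
        by (intro reduction_vanishes[OF c summable[OF c s(1)] T(3), of h \<phi>] P) blast+
    qed
    ultimately show "\<forall>\<^sub>F z in nhds a. (\<forall>f\<in>F0. f z = 0) \<longrightarrow> (\<forall>f\<in>F. f z = 0)"
      unfolding eventually_nhds by (intro exI[of _ V]) (auto simp: V_def)
  qed
qed

section \<open>Closed analytic sets and induction over germs of zero sets\<close>

lemma locally_analytic_const: "locally_analytic U (\<lambda>_. k)"
  using has_power_series_const by (auto simp: locally_analytic_def)

lemma locally_analytic_diff:
  "locally_analytic U f \<Longrightarrow> locally_analytic U g \<Longrightarrow> locally_analytic U (\<lambda>z. f z - g z)"
  unfolding locally_analytic_def using has_power_series_diff by blast

lemma locally_analytic_mult:
  "locally_analytic U f \<Longrightarrow> locally_analytic U g \<Longrightarrow> locally_analytic U (\<lambda>z. f z * g z)"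
  unfolding locally_analytic_def using has_power_series_mult by blast

lemma locally_analytic_prod:
  assumes "finite I" "\<And>i. i \<in> I \<Longrightarrow> locally_analytic U (f i)"
  shows "locally_analytic U (\<lambda>z. \<Prod>i\<in>I. f i z)"
  using assms by induction (auto intro: locally_analytic_const locally_analytic_mult)

lemma carrier_analytic_functions_iff:
  "f \<in> carrier (analytic_functions U) \<longleftrightarrow> f \<in> extensional U \<and> locally_analytic U f"
  by (auto simp: analytic_functions_def locally_analytic_def)

lemma restrict_in_carrier:
  assumes "open U" "locally_analytic U f"
  shows "restrict f U \<in> carrier (analytic_functions U)"
proof -
  have "\<exists>c. has_power_series (restrict f U) p c" if p: "p \<in> U" for p
  proof -
    obtain c where "has_power_series f p c" using assms(2) p by (auto simp: locally_analytic_def)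
    then have "has_power_series (restrict f U) p c"
      by (rule has_power_series_cong[OF _ assms(1) p]) simp
    then show ?thesis by blast
  qed
  then show ?thesis by (simp add: carrier_analytic_functions_iff locally_analytic_def)
qed

definition zero_set :: "(complex ^ 'n::finite) set \<Rightarrow> (complex ^ 'n \<Rightarrow> complex) set \<Rightarrow> (complex ^ 'n) set"
  where "zero_set U F = {a \<in> U. \<forall>f\<in>F. f a = 0}"

text \<open>Local Noetherianity turns the possibly infinite systems of equations into finite ones, as the
  definition of a closed analytic subset requires.\<close>

lemma closed_analytic_in_if_locally_zero_set:
  assumes "open A" "Z \<subseteq> A"
    and "\<And>a. a \<in> A \<Longrightarrow> \<exists>F. (\<forall>f\<in>F. locally_analytic A f) \<and>
      (\<forall>\<^sub>F z in nhds a. z \<in> A \<longrightarrow> (z \<in> Z \<longleftrightarrow> z \<in> zero_set A F))"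
  shows "closed_analytic_in A Z"
  unfolding closed_analytic_in_def
proof (intro conjI ballI)
  fix a assume a: "a \<in> A"
  obtain F where F: "\<And>f. f \<in> F \<Longrightarrow> locally_analytic A f"
    and ev: "\<forall>\<^sub>F z in nhds a. z \<in> A \<longrightarrow> (z \<in> Z \<longleftrightarrow> z \<in> zero_set A F)"
    using assms(3)[OF a] by blast
  obtain F0 where F0: "finite F0" "F0 \<subseteq> F" "\<forall>\<^sub>F z in nhds a. (\<forall>f\<in>F0. f z = 0) \<longrightarrow> (\<forall>f\<in>F. f z = 0)"
    using zero_set_locally_finite[OF assms(1) a F] by blast
  from ev F0(3) eventually_nhds_in_open[OF assms(1) a]
  have "\<forall>\<^sub>F z in nhds a. z \<in> A \<and> (z \<in> Z \<longleftrightarrow> z \<in> zero_set A F) \<and>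
      ((\<forall>f\<in>F0. f z = 0) \<longrightarrow> (\<forall>f\<in>F. f z = 0))"
    by eventually_elim blast
  then obtain U where U: "open U" "a \<in> U" "\<forall>z\<in>U. z \<in> A \<and> (z \<in> Z \<longleftrightarrow> z \<in> zero_set A F) \<and>
      ((\<forall>f\<in>F0. f z = 0) \<longrightarrow> (\<forall>f\<in>F. f z = 0))"
    unfolding eventually_nhds by blast
  let ?G = "(\<lambda>f. restrict f U) ` F0"
  have "restrict f U \<in> carrier (analytic_functions U)" if f: "f \<in> F0" for f
  proof (rule restrict_in_carrier[OF U(1)])
    have "locally_analytic A f" by (rule F) (use F0(2) f in blast)
    then show "locally_analytic U f" using U(3) by (simp add: locally_analytic_def)
  qed
  then have "?G \<subseteq> carrier (analytic_functions U)" by blast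
  moreover have "Z \<inter> U = {z \<in> U. \<forall>g\<in>?G. g z = 0}"
  proof (intro equalityI subsetI)
    fix z assume z: "z \<in> {z \<in> U. \<forall>g\<in>?G. g z = 0}"
    then have "\<forall>f\<in>F0. f z = 0" by auto
    then show "z \<in> Z \<inter> U" using z U(3) by (auto simp: zero_set_def)
  next
    fix z assume z: "z \<in> Z \<inter> U"
    then have "z \<in> zero_set A F" using U(3) by blast
    then show "z \<in> {z \<in> U. \<forall>g\<in>?G. g z = 0}" using z F0(2) by (auto simp: zero_set_def)
  qed
  ultimately show "\<exists>U F. open U \<and> a \<in> U \<and> U \<subseteq> A \<and> finite F \<and>
      F \<subseteq> carrier (analytic_functions U) \<and> Z \<inter> U = {z \<in> U. \<forall>f\<in>F. f z = 0}"
    using U F0(1) by (intro exI[of _ U] exI[of _ ?G]) auto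
qed (use assms(2) in auto)

text \<open>Near \<open>a\<close>, finitely many equations suffice for the union of all the systems, and they are implied by
  one member of the chain.\<close>

lemma zero_set_chain_stabilizes:
  assumes "open A" "a \<in> A" "\<And>k f. f \<in> F k \<Longrightarrow> locally_analytic A f"
    "\<And>k. zero_set A (F (Suc k)) \<subseteq> zero_set A (F k)"
  shows "\<exists>k. \<forall>\<^sub>F z in nhds a. z \<in> zero_set A (F (Suc k)) \<longleftrightarrow> z \<in> zero_set A (F k)"
proof -
  have "locally_analytic A f" if "f \<in> (\<Union>k. F k)" for f using assms(3) that by blast
  from zero_set_locally_finite[OF assms(1,2) this] obtain F0 where
    F0: "finite F0" "F0 \<subseteq> (\<Union>k. F k)" "\<forall>\<^sub>F z in nhds a. (\<forall>f\<in>F0. f z = 0) \<longrightarrow> (\<forall>f\<in>\<Union>k. F k. f z = 0)"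
    by blast
  have mono: "zero_set A (F l) \<subseteq> zero_set A (F k)" if "k \<le> l" for k l
    by (rule lift_Suc_antimono_le[of "\<lambda>k. zero_set A (F k)", OF assms(4) that])
  have "\<forall>f\<in>F0. \<exists>k. f \<in> F k" using F0(2) by blast
  then obtain \<iota> where \<iota>: "\<And>f. f \<in> F0 \<Longrightarrow> f \<in> F (\<iota> f)" by metis
  obtain K where K: "\<And>f. f \<in> F0 \<Longrightarrow> \<iota> f \<le> K"
    using F0(1) finite_nat_set_iff_bounded_le[of "\<iota> ` F0"] by auto
  have vanish: "\<forall>f\<in>F0. f z = 0" if "z \<in> zero_set A (F K)" for z
    using mono[OF K] \<iota> that by (fastforce simp: zero_set_def)
  have "\<forall>\<^sub>F z in nhds a. z \<in> zero_set A (F (Suc K)) \<longleftrightarrow> z \<in> zero_set A (F K)"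
    using F0(3)
  proof eventually_elim
    case (elim z)
    then show ?case using vanish[of z] assms(4)[of K] by (auto simp: zero_set_def)
  qed
  then show ?thesis ..
qed

text \<open>Descending chains of germs of zero sets at \<open>a\<close> stabilize, which justifies Noetherian induction.\<close>

lemma zero_set_germ_induct [consumes 3, case_names less]:
  fixes A :: "(complex ^ 'n::finite) set"
  assumes "open A" "a \<in> A" "\<forall>f\<in>F. locally_analytic A f"
    and step: "\<And>F. \<forall>f\<in>F. locally_analytic A f \<Longrightarrow>
      (\<And>G. \<forall>f\<in>G. locally_analytic A f \<Longrightarrow> zero_set A G \<subseteq> zero_set A F \<Longrightarrow>
        \<not> (\<forall>\<^sub>F z in nhds a. z \<in> zero_set A G \<longleftrightarrow> z \<in> zero_set A F) \<Longrightarrow> P G) \<Longrightarrow> P F"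
  shows "P F"
proof -
  define R where "R = {(G, F). (\<forall>f\<in>G. locally_analytic A f) \<and> (\<forall>f\<in>F. locally_analytic A f) \<and>
    zero_set A G \<subseteq> zero_set A F \<and> \<not> (\<forall>\<^sub>F z in nhds a. z \<in> zero_set A G \<longleftrightarrow> z \<in> zero_set A F)}"
  have "wf R"
    unfolding wf_iff_no_infinite_down_chain
  proof
    assume "\<exists>F. \<forall>k. (F (Suc k), F k) \<in> R"
    then obtain F where F: "\<And>k. (F (Suc k), F k) \<in> R" by blast
    have "\<exists>k. \<forall>\<^sub>F z in nhds a. z \<in> zero_set A (F (Suc k)) \<longleftrightarrow> z \<in> zero_set A (F k)"
      by (rule zero_set_chain_stabilizes[OF assms(1,2)]) (use F in \<open>auto simp: R_def\<close>)
    then show False using F by (auto simp: R_def)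
  qed
  then have "(\<forall>f\<in>F. locally_analytic A f) \<longrightarrow> P F"
  proof induction
    case (less F)
    show ?case
    proof
      assume F: "\<forall>f\<in>F. locally_analytic A f"
      show "P F"
        by (rule step) (use F less.IH in \<open>auto simp: R_def\<close>)
    qed
  qed
  then show ?thesis using assms(3) by blast
qed

section \<open>Local finiteness of the diagrams of a family\<close>

text \<open>A member \<open>w\<close> of \<open>W\<close> is a power series in \<open>x\<close> with coefficients that are analytic functions of the
  parameter. The axioms express that \<open>W\<close> is a module over the analytic functions on \<open>A\<close> and stable
  under multiplication by monomials in \<open>x\<close>; the model is the set of the expansions in \<open>x\<close> of the
  elements of an ideal of analytic functions in \<open>a\<close> and \<open>x\<close>.\<close>

locale coefficient_family =
  fixes A :: "(complex ^ 'm::finite) set"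
    and W :: "(complex ^ 'm \<Rightarrow> ('n::finite \<Rightarrow> nat) \<Rightarrow> complex) set"
  assumes open_A: "open A"
    and analytic: "\<And>w \<alpha>. w \<in> W \<Longrightarrow> locally_analytic A (\<lambda>a. w a \<alpha>)"
    and add: "\<And>v w. v \<in> W \<Longrightarrow> w \<in> W \<Longrightarrow> (\<lambda>a \<alpha>. v a \<alpha> + w a \<alpha>) \<in> W"
    and mult: "\<And>f w. locally_analytic A f \<Longrightarrow> w \<in> W \<Longrightarrow> (\<lambda>a \<alpha>. f a * w a \<alpha>) \<in> W"
    and shift: "\<And>\<gamma> w. w \<in> W \<Longrightarrow> (\<lambda>a. shift \<gamma> (w a)) \<in> W"
    and zero: "(\<lambda>_ _. 0) \<in> W"
begin

definition diagram :: "complex ^ 'm \<Rightarrow> ('n \<Rightarrow> nat) set"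
  where "diagram a = initial_exponents graded_weight ((\<lambda>w. w a) ` W)"

text \<open>The initial exponents when coefficients are considered modulo \<open>\<pp>\<close>. For a prime ideal \<open>\<pp>\<close> this is
  the diagram over the field of fractions of the analytic functions modulo \<open>\<pp>\<close>.\<close>

definition generic_diagram :: "(complex ^ 'm \<Rightarrow> complex) set \<Rightarrow> ('n \<Rightarrow> nat) set"
  where "generic_diagram \<pp> = {\<alpha>. \<exists>w\<in>W. (\<forall>\<beta>. graded_weight \<beta> < graded_weight \<alpha> \<longrightarrow> (\<lambda>a. w a \<beta>) \<in> \<pp>) \<and>
    (\<lambda>a. w a \<alpha>) \<notin> \<pp>}"

lemma diff: "v \<in> W \<Longrightarrow> w \<in> W \<Longrightarrow> (\<lambda>a \<alpha>. v a \<alpha> - w a \<alpha>) \<in> W"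
  using add[OF _ mult[OF locally_analytic_const[of A "-1"]], of v w] by simp

lemma diagram_upward_closed:
  assumes "\<alpha> \<in> diagram a" "\<alpha> \<le> \<beta>"
  shows "\<beta> \<in> diagram a"
proof -
  obtain w where w: "w \<in> W" "lead graded_weight (w a) \<alpha>"
    using assms(1) by (auto simp: diagram_def initial_exponents_def)
  let ?v = "\<lambda>a. shift (\<lambda>i. \<beta> i - \<alpha> i) (w a)"
  have "lead graded_weight (?v a) \<beta>"
    using w(2) assms(2) unfolding lead_def
    by (auto simp: shift_at intro!: shift_below[OF exponent_order_graded_weight])
  moreover have "?v \<in> W" by (rule shift[OF w(1)])
  ultimately show ?thesis by (auto simp: diagram_def initial_exponents_def)
qed

text \<open>The members \<open>h \<tau>\<close> of \<open>W\<close> generate the generic diagram and remain usable at \<open>a\<close>, where \<open>\<pp>\<close> vanishes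
  and their leading coefficients do not. For the converse inclusion, let \<open>\<alpha>\<close> be the initial exponent at
  \<open>a\<close> of some member of \<open>W\<close>. Its coefficients below \<open>\<alpha>\<close> are zero at \<open>a\<close> but need not lie in \<open>\<pp>\<close>; a
  division by the \<open>h \<tau>\<close> without denominators moves them into \<open>\<pp>\<close> one after the other and does not
  change the initial exponent at \<open>a\<close>.\<close>

lemma diagram_eq_generic_diagram:
  assumes \<pp>: "\<And>f. f \<in> \<pp> \<Longrightarrow> f a = 0" "(\<lambda>_. 0) \<in> \<pp>"
    "\<And>f g. f \<in> \<pp> \<Longrightarrow> g \<in> \<pp> \<Longrightarrow> (\<lambda>a. f a - g a) \<in> \<pp>"
    "\<And>f g. f \<in> \<pp> \<Longrightarrow> locally_analytic A g \<Longrightarrow> (\<lambda>a. g a * f a) \<in> \<pp>"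
    and T: "\<And>\<alpha>. \<alpha> \<in> generic_diagram \<pp> \<Longrightarrow> \<exists>\<tau>\<in>T. \<tau> \<le> \<alpha>"
    and h: "\<And>\<tau>. \<tau> \<in> T \<Longrightarrow> h \<tau> \<in> W"
      "\<And>\<tau> \<beta>. \<tau> \<in> T \<Longrightarrow> graded_weight \<beta> < graded_weight \<tau> \<Longrightarrow> (\<lambda>a. h \<tau> a \<beta>) \<in> \<pp>"
      "\<And>\<tau>. \<tau> \<in> T \<Longrightarrow> h \<tau> a \<tau> \<noteq> 0"
  shows "diagram a = generic_diagram \<pp>"
proof (intro equalityI subsetI)
  fix \<alpha> assume "\<alpha> \<in> generic_diagram \<pp>"
  then obtain \<tau> where \<tau>: "\<tau> \<in> T" "\<tau> \<le> \<alpha>" using T by blast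
  have "lead graded_weight (h \<tau> a) \<tau>"
    unfolding lead_def using h(2)[OF \<tau>(1), THEN \<pp>(1)] h(3)[OF \<tau>(1)] by blast
  then have "\<tau> \<in> diagram a" using h(1)[OF \<tau>(1)] by (auto simp: diagram_def initial_exponents_def)
  then show "\<alpha> \<in> diagram a" using \<tau>(2) by (rule diagram_upward_closed)
next
  fix \<alpha> assume "\<alpha> \<in> diagram a"
  then obtain w0 where w0: "w0 \<in> W" "lead graded_weight (w0 a) \<alpha>"
    by (auto simp: diagram_def initial_exponents_def)
  have "n \<le> graded_weight \<alpha> \<Longrightarrow> \<exists>w\<in>W. lead graded_weight (w a) \<alpha> \<and>
      (\<forall>\<beta>. graded_weight \<beta> < n \<longrightarrow> (\<lambda>a. w a \<beta>) \<in> \<pp>)" for n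
  proof (induction n)
    case 0
    then show ?case using w0 by auto
  next
    case (Suc n)
    then obtain w where w: "w \<in> W" "lead graded_weight (w a) \<alpha>"
      "\<And>\<beta>. graded_weight \<beta> < n \<Longrightarrow> (\<lambda>a. w a \<beta>) \<in> \<pp>" by auto
    show ?case
    proof (cases "\<exists>\<beta>. graded_weight \<beta> = n \<and> (\<lambda>a. w a \<beta>) \<notin> \<pp>")
      case False
      then show ?thesis using w by (intro bexI[of _ w]) (auto simp: less_Suc_eq)
    next
      case True
      then obtain \<beta> where \<beta>: "graded_weight \<beta> = n" "(\<lambda>a. w a \<beta>) \<notin> \<pp>" by blast
      then have "\<beta> \<in> generic_diagram \<pp>" using w by (auto simp: generic_diagram_def)
      then obtain \<tau> where \<tau>: "\<tau> \<in> T" "\<tau> \<le> \<beta>" using T by blast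
      let ?s = "\<lambda>a. shift (\<lambda>i. \<beta> i - \<tau> i) (h \<tau> a)"
      \<comment> \<open>At the given parameter \<open>w\<close> vanishes at \<open>\<beta>\<close>, so there this is a nonzero multiple of \<open>w\<close>.\<close>
      define v where "v = (\<lambda>a \<delta>. h \<tau> a \<tau> * w a \<delta> - w a \<beta> * ?s a \<delta>)"
      have "v \<in> W"
        unfolding v_def by (intro diff mult shift analytic w(1) h(1) \<tau>(1))
      moreover have "(\<lambda>a. v a \<delta>) \<in> \<pp>" if "graded_weight \<delta> < Suc n" for \<delta>
      proof (cases "\<delta> = \<beta>")
        case True
        then show ?thesis using \<tau>(2) \<pp>(2) by (simp add: v_def shift_at mult.commute)
      next
        case False
        then have less: "graded_weight \<delta> < graded_weight \<beta>"
          using that \<beta>(1) exponent_order_graded_weight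
          by (auto simp: exponent_order_def less_Suc_eq dest: injD)
        have "(\<lambda>a. ?s a \<delta>) \<in> \<pp>"
        proof (cases "(\<lambda>i. \<beta> i - \<tau> i) \<le> \<delta>")
          case True
          let ?\<epsilon> = "\<lambda>i. \<delta> i - (\<beta> i - \<tau> i)"
          have "graded_weight ?\<epsilon> < graded_weight \<tau>"
            using exponent_order_cancel[OF exponent_order_graded_weight, of ?\<epsilon> "\<lambda>i. \<beta> i - \<tau> i" \<tau>]
              less \<tau>(2) True by (simp add: exponent_add_diff)
          from h(2)[OF \<tau>(1) this] show ?thesis using True by (simp add: shift_def)
        qed (simp add: shift_def \<pp>(2))
        then show ?thesis
          unfolding v_def using less \<beta>(1)
          by (intro \<pp>(3) \<pp>(4) w(3) analytic w(1) h(1) \<tau>(1)) auto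
      qed
      moreover have "lead graded_weight (v a) \<alpha>"
      proof -
        have "w a \<beta> = 0" using w(2) \<beta>(1) Suc.prems by (simp add: lead_def)
        then have "v a = (\<lambda>\<delta>. h \<tau> a \<tau> * w a \<delta>)" by (simp add: v_def)
        then show ?thesis using w(2) h(3)[OF \<tau>(1)] by (simp add: lead_def)
      qed
      ultimately show ?thesis by blast
    qed
  qed
  from this[OF order_refl] obtain w where w: "w \<in> W" "lead graded_weight (w a) \<alpha>"
    "\<And>\<beta>. graded_weight \<beta> < graded_weight \<alpha> \<Longrightarrow> (\<lambda>a. w a \<beta>) \<in> \<pp>" by blast
  moreover have "(\<lambda>a. w a \<alpha>) \<notin> \<pp>" using w(2) \<pp>(1) by (auto simp: lead_def)
  ultimately show "\<alpha> \<in> generic_diagram \<pp>" by (auto simp: generic_diagram_def)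
qed

text \<open>By induction over the germ of the zero set at \<open>a\<close>. On the zeros of a function that is not in \<open>\<pp>\<close>
  the induction hypothesis applies. If \<open>\<pp>\<close> is not prime, two such functions cover the zero set. If it is
  prime, then the product \<open>\<Lambda>\<close> of the leading coefficients of the generators of the generic diagram is
  not in \<open>\<pp>\<close>, and away from its zeros the diagram is the generic one.\<close>

lemma finitely_many_diagrams_on_zero_set:
  assumes "a \<in> A" "\<forall>f\<in>F. locally_analytic A f"
  shows "\<exists>\<D>. finite \<D> \<and> (\<forall>\<^sub>F z in nhds a. z \<in> zero_set A F \<longrightarrow> diagram z \<in> \<D>)"
  using open_A assms
proof (induction F rule: zero_set_germ_induct)
  case (less F)
  let ?Z = "zero_set A F"
  define \<pp> where "\<pp> = {f. locally_analytic A f \<and> (\<forall>\<^sub>F z in nhds a. z \<in> ?Z \<longrightarrow> f z = 0)}"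
  have smaller: "\<exists>\<D>. finite \<D> \<and> (\<forall>\<^sub>F z in nhds a. z \<in> ?Z \<longrightarrow> f z = 0 \<longrightarrow> diagram z \<in> \<D>)"
    if f: "locally_analytic A f" "f \<notin> \<pp>" for f
  proof -
    have "zero_set A (insert f F) \<subseteq> ?Z" by (auto simp: zero_set_def)
    moreover have "\<not> (\<forall>\<^sub>F z in nhds a. z \<in> zero_set A (insert f F) \<longleftrightarrow> z \<in> ?Z)"
    proof
      assume "\<forall>\<^sub>F z in nhds a. z \<in> zero_set A (insert f F) \<longleftrightarrow> z \<in> ?Z"
      then have "\<forall>\<^sub>F z in nhds a. z \<in> ?Z \<longrightarrow> f z = 0"
        by eventually_elim (auto simp: zero_set_def)
      then show False using f by (simp add: \<pp>_def)
    qed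
    ultimately obtain \<D> where \<D>: "finite \<D>"
      "\<forall>\<^sub>F z in nhds a. z \<in> zero_set A (insert f F) \<longrightarrow> diagram z \<in> \<D>"
      using less.IH[of "insert f F"] less.hyps f(1) by blast
    from \<D>(2) have "\<forall>\<^sub>F z in nhds a. z \<in> ?Z \<longrightarrow> f z = 0 \<longrightarrow> diagram z \<in> \<D>"
      by eventually_elim (auto simp: zero_set_def)
    with \<D>(1) show ?thesis by blast
  qed
  show ?case
  proof (cases "(\<lambda>_. 1) \<in> \<pp>")
    case True
    then have "\<forall>\<^sub>F z in nhds a. z \<in> ?Z \<longrightarrow> diagram z \<in> {}" by (simp add: \<pp>_def)
    then show ?thesis by blast
  next
    case one: False
    show ?thesis
    proof (cases "\<exists>f g. locally_analytic A f \<and> locally_analytic A g \<and> f \<notin> \<pp> \<and> g \<notin> \<pp> \<and> (\<lambda>z. f z * g z) \<in> \<pp>")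
      case True
      then obtain f g where fg: "locally_analytic A f" "locally_analytic A g" "f \<notin> \<pp>" "g \<notin> \<pp>"
        "(\<lambda>z. f z * g z) \<in> \<pp>" by blast
      obtain \<D> where \<D>: "finite \<D>" "\<forall>\<^sub>F z in nhds a. z \<in> ?Z \<longrightarrow> f z = 0 \<longrightarrow> diagram z \<in> \<D>"
        using smaller[OF fg(1,3)] by blast
      obtain \<E> where \<E>: "finite \<E>" "\<forall>\<^sub>F z in nhds a. z \<in> ?Z \<longrightarrow> g z = 0 \<longrightarrow> diagram z \<in> \<E>"
        using smaller[OF fg(2,4)] by blast
      have "\<forall>\<^sub>F z in nhds a. z \<in> ?Z \<longrightarrow> f z * g z = 0" using fg(5) by (simp add: \<pp>_def)
      with \<D>(2) \<E>(2) have "\<forall>\<^sub>F z in nhds a. z \<in> ?Z \<longrightarrow> diagram z \<in> \<D> \<union> \<E>"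
        by eventually_elim auto
      then show ?thesis using \<D>(1) \<E>(1) by blast
    next
      case False
      then have prime: "f \<in> \<pp> \<or> g \<in> \<pp>"
        if "locally_analytic A f" "locally_analytic A g" "(\<lambda>z. f z * g z) \<in> \<pp>" for f g
        using that by blast
      obtain T where T: "T \<subseteq> generic_diagram \<pp>" "finite T"
        "\<And>\<alpha>. \<alpha> \<in> generic_diagram \<pp> \<Longrightarrow> \<exists>\<tau>\<in>T. \<tau> \<le> \<alpha>"
        using Dickson[of "generic_diagram \<pp>"] by blast
      have "\<forall>\<tau>\<in>T. \<exists>w. w \<in> W \<and> (\<forall>\<beta>. graded_weight \<beta> < graded_weight \<tau> \<longrightarrow> (\<lambda>a. w a \<beta>) \<in> \<pp>) \<and>
          (\<lambda>a. w a \<tau>) \<notin> \<pp>"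
        using T(1) unfolding generic_diagram_def by blast
      then obtain h where h: "\<And>\<tau>. \<tau> \<in> T \<Longrightarrow> h \<tau> \<in> W"
        "\<And>\<tau> \<beta>. \<tau> \<in> T \<Longrightarrow> graded_weight \<beta> < graded_weight \<tau> \<Longrightarrow> (\<lambda>a. h \<tau> a \<beta>) \<in> \<pp>"
        "\<And>\<tau>. \<tau> \<in> T \<Longrightarrow> (\<lambda>a. h \<tau> a \<tau>) \<notin> \<pp>" by metis
      define \<Lambda> where "\<Lambda> = (\<lambda>z. \<Prod>\<tau>\<in>T. h \<tau> z \<tau>)"
      have \<Lambda>: "locally_analytic A \<Lambda>"
        unfolding \<Lambda>_def by (intro locally_analytic_prod T(2) analytic[OF h(1)])
      have "(\<lambda>z. \<Prod>\<tau>\<in>S. h \<tau> z \<tau>) \<notin> \<pp>" if "S \<subseteq> T" for S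
        using finite_subset[OF that T(2)] that
      proof induction
        case empty
        then show ?case using one by simp
      next
        case (insert \<tau> S)
        then have "locally_analytic A (\<lambda>z. h \<sigma> z \<sigma>)" if "\<sigma> \<in> insert \<tau> S" for \<sigma>
          using that by (intro analytic[OF h(1)]) auto
        then have "locally_analytic A (\<lambda>z. \<Prod>\<tau>\<in>S. h \<tau> z \<tau>)" "locally_analytic A (\<lambda>z. h \<tau> z \<tau>)"
          using insert.hyps(1) by (simp_all add: locally_analytic_prod)
        then show ?case using prime[of "\<lambda>z. h \<tau> z \<tau>" "\<lambda>z. \<Prod>\<tau>\<in>S. h \<tau> z \<tau>"] insert h(3) by auto
      qed
      then have "\<Lambda> \<notin> \<pp>" by (simp add: \<Lambda>_def)
      from smaller[OF \<Lambda> this] obtain \<D> where \<D>: "finite \<D>"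
        "\<forall>\<^sub>F z in nhds a. z \<in> ?Z \<longrightarrow> \<Lambda> z = 0 \<longrightarrow> diagram z \<in> \<D>" by blast
      have "\<forall>\<^sub>F z in nhds a. z \<in> ?Z \<longrightarrow> (\<forall>f\<in>\<pp>. f z = 0)"
      proof -
        obtain P0 where P0: "finite P0" "P0 \<subseteq> \<pp>"
          "\<forall>\<^sub>F z in nhds a. (\<forall>f\<in>P0. f z = 0) \<longrightarrow> (\<forall>f\<in>\<pp>. f z = 0)"
          by (rule zero_set_locally_finite[OF open_A assms(1), of \<pp>]) (auto simp: \<pp>_def)
        have "\<forall>f\<in>P0. \<forall>\<^sub>F z in nhds a. z \<in> ?Z \<longrightarrow> f z = 0" using P0(2) by (auto simp: \<pp>_def)
        then have "\<forall>\<^sub>F z in nhds a. \<forall>f\<in>P0. z \<in> ?Z \<longrightarrow> f z = 0"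
          by (rule eventually_ball_finite[OF P0(1)])
        with P0(3) show ?thesis by eventually_elim blast
      qed
      with \<D>(2) have "\<forall>\<^sub>F z in nhds a. z \<in> ?Z \<longrightarrow> diagram z \<in> insert (generic_diagram \<pp>) \<D>"
      proof eventually_elim
        case (elim z)
        show ?case
        proof (cases "z \<in> ?Z \<and> \<Lambda> z \<noteq> 0")
          case True
          have "(\<lambda>a. f a - g a) \<in> \<pp>" if "f \<in> \<pp>" "g \<in> \<pp>" for f g
          proof -
            have "\<forall>\<^sub>F z in nhds a. z \<in> ?Z \<longrightarrow> f z = 0" "\<forall>\<^sub>F z in nhds a. z \<in> ?Z \<longrightarrow> g z = 0"
              using that by (auto simp: \<pp>_def)
            then have "\<forall>\<^sub>F z in nhds a. z \<in> ?Z \<longrightarrow> f z - g z = 0"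
              by eventually_elim auto
            then show ?thesis using that by (simp add: \<pp>_def locally_analytic_diff)
          qed
          moreover have "(\<lambda>a. g a * f a) \<in> \<pp>" if "f \<in> \<pp>" "locally_analytic A g" for f g
          proof -
            have "\<forall>\<^sub>F z in nhds a. z \<in> ?Z \<longrightarrow> f z = 0" using that by (auto simp: \<pp>_def)
            then have "\<forall>\<^sub>F z in nhds a. z \<in> ?Z \<longrightarrow> g z * f z = 0"
              by eventually_elim auto
            then show ?thesis using that by (simp add: \<pp>_def locally_analytic_mult)
          qed
          moreover have "(\<lambda>_. 0) \<in> \<pp>" by (simp add: \<pp>_def locally_analytic_const)
          moreover have "h \<tau> z \<tau> \<noteq> 0" if "\<tau> \<in> T" for \<tau>
            using True that T(2) by (auto simp: \<Lambda>_def)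
          ultimately have "diagram z = generic_diagram \<pp>"
            using elim True T(3) h(1,2) by (intro diagram_eq_generic_diagram[of \<pp> z T h]) blast+
          then show ?thesis by simp
        qed (use elim in blast)
      qed
      then show ?thesis using \<D>(1) by (meson finite_insert)
    qed
  qed
qed

corollary finitely_many_diagrams:
  assumes "a \<in> A"
  shows "\<exists>\<D>. finite \<D> \<and> (\<forall>\<^sub>F z in nhds a. z \<in> A \<longrightarrow> diagram z \<in> \<D>)"
  using finitely_many_diagrams_on_zero_set[OF assms, of "{}"] by (simp add: zero_set_def)

end

section \<open>Semicontinuity\<close>

text \<open>The initial exponents of the restrictions to \<open>E\<close> of the members of \<open>V\<close>. For a vector space \<open>V\<close> and
  finite \<open>E\<close> their number is the dimension of the space of these restrictions, and it serves here as the
  rank.\<close>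

definition leads_in :: "('n::finite \<Rightarrow> nat) set \<Rightarrow> (('n \<Rightarrow> nat) \<Rightarrow> complex) set \<Rightarrow> ('n \<Rightarrow> nat) set"
  where "leads_in E V = {\<alpha> \<in> E. \<exists>v\<in>V. v \<alpha> \<noteq> 0 \<and>
    (\<forall>\<beta>\<in>E. graded_weight \<beta> < graded_weight \<alpha> \<longrightarrow> v \<beta> = 0)}"

lemma leads_in_exists:
  fixes v :: "('n::finite \<Rightarrow> nat) \<Rightarrow> complex"
  assumes "v \<alpha> \<noteq> 0" "\<alpha> \<in> E"
  obtains \<beta> where "\<beta> \<in> E" "v \<beta> \<noteq> 0" "\<forall>\<gamma>\<in>E. graded_weight \<gamma> < graded_weight \<beta> \<longrightarrow> v \<gamma> = 0"
proof -
  have "\<exists>\<beta>\<in>E. v \<beta> \<noteq> 0 \<and> (\<forall>\<gamma>\<in>E. graded_weight \<gamma> < graded_weight \<beta> \<longrightarrow> v \<gamma> = 0)"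
    using assms
  proof (induction "graded_weight \<alpha>" arbitrary: \<alpha> rule: less_induct)
    case less
    then show ?case by blast
  qed
  then show ?thesis using that by blast
qed

lemma leads_in_mono: "V \<subseteq> V' \<Longrightarrow> leads_in E V \<subseteq> leads_in E V'"
  unfolding leads_in_def by blast

text \<open>The result of the elimination is the hyperplane of the vectors of \<open>V\<close> that vanish at \<open>\<alpha>\<close>. Let
  \<open>\<beta>\<close> be the greatest leading exponent of the vectors that are nonzero at \<open>\<alpha>\<close>. No vector of the
  hyperplane leads with \<open>\<beta>\<close>, since its subtraction would cancel \<open>\<beta>\<close> and leave a vector that is nonzero
  at \<open>\<alpha>\<close> and has a greater leading exponent.\<close>

lemma leads_in_elimination:
  fixes V :: "(('n::finite \<Rightarrow> nat) \<Rightarrow> complex) set"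
  assumes V: "\<And>v w k. v \<in> V \<Longrightarrow> w \<in> V \<Longrightarrow> (\<lambda>\<beta>. v \<beta> + k * w \<beta>) \<in> V"
    and E: "finite E" "\<alpha> \<in> E" and f: "f \<in> V" "f \<alpha> \<noteq> 0"
  shows "Suc (card (leads_in E {\<lambda>\<beta>. f \<alpha> * g \<beta> - g \<alpha> * f \<beta> |g. g \<in> V})) \<le> card (leads_in E V)"
proof -
  let ?V' = "{\<lambda>\<beta>. f \<alpha> * g \<beta> - g \<alpha> * f \<beta> |g. g \<in> V}"
  let ?L = "{\<beta> \<in> E. \<exists>v\<in>V. v \<alpha> \<noteq> 0 \<and> v \<beta> \<noteq> 0 \<and>
    (\<forall>\<gamma>\<in>E. graded_weight \<gamma> < graded_weight \<beta> \<longrightarrow> v \<gamma> = 0)}"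
  have "?V' \<subseteq> V"
  proof
    fix v assume "v \<in> ?V'"
    then obtain g where g: "g \<in> V" "v = (\<lambda>\<beta>. f \<alpha> * g \<beta> - g \<alpha> * f \<beta>)" by blast
    have "(\<lambda>\<beta>. (g \<beta> + (f \<alpha> - 1) * g \<beta>) + (- g \<alpha>) * f \<beta>) \<in> V"
      by (intro V g f)
    then show "v \<in> V" by (simp add: g(2) algebra_simps)
  qed
  then have sub: "leads_in E ?V' \<subseteq> leads_in E V" by (rule leads_in_mono)
  have V'\<alpha>: "v \<alpha> = 0" if "v \<in> ?V'" for v
    using that by (elim CollectE exE) simp
  obtain \<beta>0 where "\<beta>0 \<in> E" "f \<beta>0 \<noteq> 0"
    "\<forall>\<gamma>\<in>E. graded_weight \<gamma> < graded_weight \<beta>0 \<longrightarrow> f \<gamma> = 0"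
    by (rule leads_in_exists[of f \<alpha> E, OF f(2) E(2)])
  then have "\<beta>0 \<in> ?L" using f by (intro CollectI conjI bexI[of _ f])
  then have ne: "?L \<noteq> {}" by (metis empty_iff)
  have fin: "finite ?L" using E(1) by simp
  have "Max (graded_weight ` ?L) \<in> graded_weight ` ?L"
    using ne by (intro Max_in finite_imageI fin) simp
  then obtain \<beta> where Max: "Max (graded_weight ` ?L) = graded_weight \<beta>" and \<beta>: "\<beta> \<in> ?L"
    by (rule imageE)
  have max: "graded_weight \<gamma> \<le> graded_weight \<beta>" if "\<gamma> \<in> ?L" for \<gamma>
    unfolding Max[symmetric] by (rule Max_ge[OF finite_imageI[OF fin] imageI[OF that]])
  obtain v where v: "\<beta> \<in> E" "v \<in> V" "v \<alpha> \<noteq> 0" "v \<beta> \<noteq> 0"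
    "\<And>\<gamma>. \<gamma> \<in> E \<Longrightarrow> graded_weight \<gamma> < graded_weight \<beta> \<Longrightarrow> v \<gamma> = 0" using \<beta> by blast
  have "\<beta> \<notin> leads_in E ?V'"
  proof
    assume "\<beta> \<in> leads_in E ?V'"
    then have "\<exists>g\<in>?V'. g \<beta> \<noteq> 0 \<and> (\<forall>\<gamma>\<in>E. graded_weight \<gamma> < graded_weight \<beta> \<longrightarrow> g \<gamma> = 0)"
      by (simp only: leads_in_def mem_Collect_eq)
    then obtain g where g1: "g \<in> ?V'"
      and g2: "g \<beta> \<noteq> 0 \<and> (\<forall>\<gamma>\<in>E. graded_weight \<gamma> < graded_weight \<beta> \<longrightarrow> g \<gamma> = 0)"
      by (rule bexE)
    have gV: "g \<in> V" using g1 \<open>?V' \<subseteq> V\<close> by (rule subsetD[rotated])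
    \<comment> \<open>The leading exponent of \<open>u\<close> exceeds \<open>\<beta>\<close>, and \<open>u\<close> is nonzero at \<open>\<alpha>\<close> like \<open>v\<close>.\<close>
    define u where "u = (\<lambda>\<gamma>. v \<gamma> + (- (v \<beta> / g \<beta>)) * g \<gamma>)"
    have u: "u \<in> V" unfolding u_def by (intro V v(2) gV)
    have u\<alpha>: "u \<alpha> \<noteq> 0" using V'\<alpha>[OF g1] v(3) by (simp add: u_def)
    obtain \<gamma> where \<gamma>: "\<gamma> \<in> E" "u \<gamma> \<noteq> 0"
      "\<forall>\<delta>\<in>E. graded_weight \<delta> < graded_weight \<gamma> \<longrightarrow> u \<delta> = 0"
      by (rule leads_in_exists[of u \<alpha> E, OF u\<alpha> E(2)])
    then have "graded_weight \<gamma> \<le> graded_weight \<beta>"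
      using u u\<alpha> by (intro max CollectI conjI bexI[of _ u])
    moreover have "\<gamma> \<noteq> \<beta>" using \<gamma>(2) g2 by (auto simp: u_def)
    ultimately have "graded_weight \<gamma> < graded_weight \<beta>"
      using exponent_order_graded_weight by (auto simp: exponent_order_def le_less dest: injD)
    then show False using \<gamma>(1,2) v(5) g2 by (simp add: u_def)
  qed
  moreover have "\<beta> \<in> leads_in E V" unfolding leads_in_def using v by blast
  ultimately have "leads_in E ?V' \<subset> leads_in E V" using sub by blast
  moreover have "finite (leads_in E V)" using E(1) by (simp add: leads_in_def)
  ultimately show ?thesis by (simp add: Suc_le_eq psubset_card_mono)
qed

text \<open>If \<open>\<alpha>\<close> is the least leading exponent, then vectors with other leading exponents vanish at \<open>\<alpha>\<close>, so that
  elimination at \<open>\<alpha>\<close> only multiplies them by a nonzero constant.\<close>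

lemma leads_in_elimination_at_minimum:
  fixes V :: "(('n::finite \<Rightarrow> nat) \<Rightarrow> complex) set"
  assumes E: "finite E" and L: "leads_in E V \<noteq> {}"
  obtains f \<alpha> where "f \<in> V" "\<alpha> \<in> E" "f \<alpha> \<noteq> 0"
    "card (leads_in E V) \<le> Suc (card (leads_in E {\<lambda>\<beta>. f \<alpha> * g \<beta> - g \<alpha> * f \<beta> |g. g \<in> V}))"
proof -
  have fin: "finite (leads_in E V)" for V :: "(('n \<Rightarrow> nat) \<Rightarrow> complex) set"
    using E by (simp add: leads_in_def)
  define \<alpha> where "\<alpha> = arg_min_on graded_weight (leads_in E V)"
  have \<alpha>: "\<alpha> \<in> leads_in E V" "\<And>\<beta>. \<beta> \<in> leads_in E V \<Longrightarrow> graded_weight \<alpha> \<le> graded_weight \<beta>"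
    unfolding \<alpha>_def using arg_min_if_finite[OF fin L] arg_min_least[OF fin L] by auto
  then obtain f where f: "f \<in> V" "\<alpha> \<in> E" "f \<alpha> \<noteq> 0" unfolding leads_in_def by blast
  let ?V' = "{\<lambda>\<beta>. f \<alpha> * g \<beta> - g \<alpha> * f \<beta> |g. g \<in> V}"
  have "leads_in E V - {\<alpha>} \<subseteq> leads_in E ?V'"
  proof
    fix \<beta> assume \<beta>: "\<beta> \<in> leads_in E V - {\<alpha>}"
    then obtain g where g: "g \<in> V" "\<beta> \<in> E" "g \<beta> \<noteq> 0"
      "\<forall>\<gamma>\<in>E. graded_weight \<gamma> < graded_weight \<beta> \<longrightarrow> g \<gamma> = 0" unfolding leads_in_def by blast
    have "graded_weight \<alpha> < graded_weight \<beta>"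
      using \<alpha>(2)[of \<beta>] \<beta> exponent_order_graded_weight
      by (auto simp: exponent_order_def le_less dest: injD)
    then have "g \<alpha> = 0" using g(4) f(2) by blast
    then have "(\<lambda>\<beta>. f \<alpha> * g \<beta> - g \<alpha> * f \<beta>) \<beta> \<noteq> 0 \<and> (\<forall>\<gamma>\<in>E. graded_weight \<gamma> < graded_weight \<beta> \<longrightarrow>
        (\<lambda>\<beta>. f \<alpha> * g \<beta> - g \<alpha> * f \<beta>) \<gamma> = 0)"
      using g(3,4) f(3) by simp
    moreover have "(\<lambda>\<beta>. f \<alpha> * g \<beta> - g \<alpha> * f \<beta>) \<in> ?V'" using g(1) by blast
    ultimately show "\<beta> \<in> leads_in E ?V'"
      unfolding leads_in_def using g(2)
      by (intro CollectI conjI bexI[of _ "\<lambda>\<beta>. f \<alpha> * g \<beta> - g \<alpha> * f \<beta>"]) blast+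
  qed
  then have "card (leads_in E V - {\<alpha>}) \<le> card (leads_in E ?V')" by (rule card_mono[OF fin])
  then show ?thesis using that[OF f] \<alpha>(1) by (simp add: fin)
qed

text \<open>A step of Gaussian elimination with the pivot \<open>f a \<alpha>\<close>, without division so that the coefficients
  remain analytic where the pivot vanishes.\<close>

definition elimination ::
    "(complex ^ 'm \<Rightarrow> ('n \<Rightarrow> nat) \<Rightarrow> complex) \<Rightarrow> ('n \<Rightarrow> nat) \<Rightarrow> (complex ^ 'm::finite \<Rightarrow> ('n::finite \<Rightarrow> nat) \<Rightarrow> complex) set
      \<Rightarrow> (complex ^ 'm \<Rightarrow> ('n \<Rightarrow> nat) \<Rightarrow> complex) set"
  where "elimination f \<alpha> W = {\<lambda>a \<beta>. f a \<alpha> * g a \<beta> - g a \<alpha> * f a \<beta> |g. g \<in> W}"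

text \<open>The products of the \<open>k\<close> successive pivots of all possible eliminations. They replace the minors of
  size \<open>k\<close> of the matrix with rows \<open>W\<close> and columns \<open>E\<close>: all of them are zero at \<open>a\<close> if and only if the
  rank at \<open>a\<close> is less than \<open>k\<close>.\<close>

primrec minors ::
    "nat \<Rightarrow> ('n \<Rightarrow> nat) set \<Rightarrow> (complex ^ 'm::finite \<Rightarrow> ('n::finite \<Rightarrow> nat) \<Rightarrow> complex) set \<Rightarrow> (complex ^ 'm \<Rightarrow> complex) set"
  where
    "minors 0 E W = {\<lambda>_. 1}"
  | "minors (Suc k) E W =
      {\<lambda>a. f a \<alpha> * \<mu> a |f \<alpha> \<mu>. f \<in> W \<and> \<alpha> \<in> E \<and> \<mu> \<in> minors k E (elimination f \<alpha> W)}"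

lemma locally_analytic_minors:
  assumes "\<And>w \<alpha>. w \<in> W \<Longrightarrow> locally_analytic A (\<lambda>a. w a \<alpha>)" "\<mu> \<in> minors k E W"
  shows "locally_analytic A \<mu>"
  using assms
proof (induction k arbitrary: W \<mu>)
  case 0
  then show ?case by (simp add: locally_analytic_const)
next
  case (Suc k)
  then obtain f \<alpha> \<nu> where \<mu>: "f \<in> W" "\<alpha> \<in> E" "\<nu> \<in> minors k E (elimination f \<alpha> W)"
    "\<mu> = (\<lambda>a. f a \<alpha> * \<nu> a)" by auto
  have "locally_analytic A (\<lambda>a. w a \<beta>)" if w: "w \<in> elimination f \<alpha> W" for w \<beta>
  proof -
    obtain g where g: "g \<in> W" "w = (\<lambda>a \<beta>. f a \<alpha> * g a \<beta> - g a \<alpha> * f a \<beta>)"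
      using w unfolding elimination_def by blast
    show ?thesis
      unfolding g(2)
      by (intro locally_analytic_diff locally_analytic_mult Suc.prems(1) g(1) \<mu>(1))
  qed
  then have "locally_analytic A \<nu>" by (rule Suc.IH[OF _ \<mu>(3)])
  with Suc.prems(1)[OF \<mu>(1)] show ?case unfolding \<mu>(4) by (rule locally_analytic_mult)
qed

text \<open>A step with nonzero pivot lowers the rank by at least one, and by exactly one for a suitable
  pivot.\<close>

lemma minors_nonzero_iff:
  assumes "finite E" "\<And>v w k. v \<in> W \<Longrightarrow> w \<in> W \<Longrightarrow> (\<lambda>a \<beta>. v a \<beta> + k * w a \<beta>) \<in> W"
  shows "(\<exists>\<mu>\<in>minors k E W. \<mu> a \<noteq> 0) \<longleftrightarrow> k \<le> card (leads_in E ((\<lambda>w. w a) ` W))"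
  using assms(2)
proof (induction k arbitrary: W)
  case (Suc k)
  let ?V = "(\<lambda>w. w a) ` W"
  have lin: "(\<lambda>a \<beta>. v a \<beta> + c * w a \<beta>) \<in> elimination f \<alpha> W"
    if vw: "v \<in> elimination f \<alpha> W" "w \<in> elimination f \<alpha> W" for f \<alpha> v w c
  proof -
    obtain g where g: "g \<in> W" "v = (\<lambda>a \<beta>. f a \<alpha> * g a \<beta> - g a \<alpha> * f a \<beta>)"
      using vw(1) unfolding elimination_def by blast
    obtain h where h: "h \<in> W" "w = (\<lambda>a \<beta>. f a \<alpha> * h a \<beta> - h a \<alpha> * f a \<beta>)"
      using vw(2) unfolding elimination_def by blast
    show ?thesis
      unfolding elimination_def
      using Suc.prems[OF g(1) h(1), of c]
      by (intro CollectI exI[of _ "\<lambda>a \<beta>. g a \<beta> + c * h a \<beta>"])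
         (auto simp: g(2) h(2) algebra_simps)
  qed
  have V: "(\<lambda>\<beta>. v \<beta> + c * w \<beta>) \<in> ?V" if "v \<in> ?V" "w \<in> ?V" for v w c
  proof -
    obtain v' w' where "v' \<in> W" "w' \<in> W" "v = v' a" "w = w' a" using \<open>v \<in> ?V\<close> \<open>w \<in> ?V\<close> by blast
    then show ?thesis
      using Suc.prems[of v' w' c] by (intro image_eqI[of _ _ "\<lambda>a \<beta>. v' a \<beta> + c * w' a \<beta>"]) auto
  qed
  have eval: "(\<lambda>w. w a) ` elimination f \<alpha> W = {\<lambda>\<beta>. f a \<alpha> * g \<beta> - g \<alpha> * f a \<beta> |g. g \<in> ?V}"
    for f \<alpha>
    unfolding elimination_def Setcompr_eq_image image_image ..
  have IH: "(\<exists>\<mu>\<in>minors k E (elimination f \<alpha> W). \<mu> a \<noteq> 0) \<longleftrightarrow>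
      k \<le> card (leads_in E {\<lambda>\<beta>. f a \<alpha> * g \<beta> - g \<alpha> * f a \<beta> |g. g \<in> ?V})" for f \<alpha>
    unfolding eval[symmetric] by (rule Suc.IH) (rule lin)
  show ?case
  proof
    assume "\<exists>\<mu>\<in>minors (Suc k) E W. \<mu> a \<noteq> 0"
    then obtain f \<alpha> \<mu> where \<mu>: "f \<in> W" "\<alpha> \<in> E" "\<mu> \<in> minors k E (elimination f \<alpha> W)"
      "f a \<alpha> \<noteq> 0" "\<mu> a \<noteq> 0" by auto
    then have "k \<le> card (leads_in E {\<lambda>\<beta>. f a \<alpha> * g \<beta> - g \<alpha> * f a \<beta> |g. g \<in> ?V})"
      using IH by blast
    also have "Suc \<dots> \<le> card (leads_in E ?V)"
      using \<mu> by (intro leads_in_elimination V assms(1)) auto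
    finally show "Suc k \<le> card (leads_in E ?V)" by simp
  next
    assume k: "Suc k \<le> card (leads_in E ?V)"
    then have "leads_in E ?V \<noteq> {}" by auto
    from leads_in_elimination_at_minimum[OF assms(1) this] obtain u \<alpha> where u:
      "u \<in> ?V" "\<alpha> \<in> E" "u \<alpha> \<noteq> 0"
      "card (leads_in E ?V) \<le> Suc (card (leads_in E {\<lambda>\<beta>. u \<alpha> * g \<beta> - g \<alpha> * u \<beta> |g. g \<in> ?V}))"
      by blast
    then obtain f where f: "f \<in> W" "u = f a" by blast
    have "\<exists>\<mu>\<in>minors k E (elimination f \<alpha> W). \<mu> a \<noteq> 0"
      unfolding IH using k u(4) f(2) by simp
    then obtain \<mu> where \<mu>: "\<mu> \<in> minors k E (elimination f \<alpha> W)" "\<mu> a \<noteq> 0" by blast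
    have "(\<lambda>a. f a \<alpha> * \<mu> a) \<in> minors (Suc k) E W" using \<mu>(1) f(1) u(2) by auto
    then show "\<exists>\<mu>\<in>minors (Suc k) E W. \<mu> a \<noteq> 0" using \<mu>(2) u(3) f(2) by force
  qed
qed simp

text \<open>The affine Hilbert function of the quotient by the monomial ideal with the exponents \<open>D\<close>.\<close>

definition hilbert_count :: "('n::finite \<Rightarrow> nat) set \<Rightarrow> nat \<Rightarrow> nat"
  where "hilbert_count D r = card {\<alpha>. mdeg \<alpha> \<le> r \<and> \<alpha> \<notin> D}"

context coefficient_family
begin

text \<open>The order refines the degree, so the coefficients of degree at most \<open>r\<close> determine the initial
  exponents of degree at most \<open>r\<close>.\<close>

lemma diagram_le_eq_leads_in:
  "{\<alpha>. mdeg \<alpha> \<le> r} \<inter> diagram a = leads_in {\<alpha>. mdeg \<alpha> \<le> r} ((\<lambda>w. w a) ` W)"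
proof -
  have deg: "mdeg \<beta> \<le> r" if "graded_weight \<beta> < graded_weight \<alpha>" "mdeg \<alpha> \<le> r"
    for \<alpha> \<beta> :: "'n \<Rightarrow> nat"
    using that by (auto simp: graded_weight_less_iff)
  show ?thesis
  proof (intro equalityI subsetI)
    fix \<alpha> assume "\<alpha> \<in> {\<alpha>. mdeg \<alpha> \<le> r} \<inter> diagram a"
    then obtain w where "w \<in> W" "mdeg \<alpha> \<le> r" "lead graded_weight (w a) \<alpha>"
      by (auto simp: diagram_def initial_exponents_def)
    then show "\<alpha> \<in> leads_in {\<alpha>. mdeg \<alpha> \<le> r} ((\<lambda>w. w a) ` W)"
      by (auto simp: leads_in_def lead_def)
  next
    fix \<alpha> assume "\<alpha> \<in> leads_in {\<alpha>. mdeg \<alpha> \<le> r} ((\<lambda>w. w a) ` W)"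
    then obtain w where w: "w \<in> W" "mdeg \<alpha> \<le> r" "w a \<alpha> \<noteq> 0"
      "\<forall>\<beta>. mdeg \<beta> \<le> r \<longrightarrow> graded_weight \<beta> < graded_weight \<alpha> \<longrightarrow> w a \<beta> = 0"
      by (auto simp: leads_in_def)
    then have "lead graded_weight (w a) \<alpha>" using deg by (simp add: lead_def)
    then show "\<alpha> \<in> {\<alpha>. mdeg \<alpha> \<le> r} \<inter> diagram a"
      using w(1,2) by (auto simp: diagram_def initial_exponents_def)
  qed
qed

lemma hilbert_count_upper_semicontinuous:
  "\<exists>F. (\<forall>f\<in>F. locally_analytic A f) \<and>
    (\<forall>a\<in>A. d \<le> hilbert_count (diagram a) r \<longleftrightarrow> a \<in> zero_set A F)"
proof -
  let ?E = "{\<alpha> :: 'n \<Rightarrow> nat. mdeg \<alpha> \<le> r}"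
  have count: "hilbert_count (diagram a) r = card ?E - card (leads_in ?E ((\<lambda>w. w a) ` W))"
    "card (leads_in ?E ((\<lambda>w. w a) ` W)) \<le> card ?E" for a
  proof -
    have "hilbert_count (diagram a) r = card (?E - (?E \<inter> diagram a))"
      unfolding hilbert_count_def by (rule arg_cong[of _ _ card]) auto
    then show "hilbert_count (diagram a) r = card ?E - card (leads_in ?E ((\<lambda>w. w a) ` W))"
      unfolding diagram_le_eq_leads_in
      by (subst (asm) card_Diff_subset)
         (auto simp: leads_in_def intro: finite_subset[OF _ finite_mdeg_le[of r]])
    show "card (leads_in ?E ((\<lambda>w. w a) ` W)) \<le> card ?E"
      by (intro card_mono finite_mdeg_le) (auto simp: leads_in_def)
  qed
  show ?thesis
  proof (cases "d \<le> card ?E")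
    case True
    \<comment> \<open>The count is at least \<open>d\<close> if and only if the rank is less than \<open>card ?E + 1 - d\<close>.\<close>
    let ?F = "minors (card ?E + 1 - d) ?E W"
    have "d \<le> hilbert_count (diagram a) r \<longleftrightarrow> a \<in> zero_set A ?F" if "a \<in> A" for a
    proof -
      have "(\<exists>\<mu>\<in>?F. \<mu> a \<noteq> 0) \<longleftrightarrow> card ?E + 1 - d \<le> card (leads_in ?E ((\<lambda>w. w a) ` W))"
        by (intro minors_nonzero_iff finite_mdeg_le add mult locally_analytic_const)
      then show ?thesis
        using True that count[of a] by (auto simp: zero_set_def)
    qed
    moreover have "\<forall>f\<in>?F. locally_analytic A f" using locally_analytic_minors[where W = W and A = A] analytic by blast
    ultimately show ?thesis by (intro exI[of _ ?F]) blast
  next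
    case False
    have "\<not> d \<le> hilbert_count (diagram a) r" for a using False count(1)[of a] by linarith
    then show ?thesis
      by (intro exI[of _ "{\<lambda>_. 1}"]) (auto simp: zero_set_def locally_analytic_const)
  qed
qed

end

section \<open>The Hilbert polynomial of a diagram\<close>

text \<open>Stars and bars: \<open>r - mdeg \<alpha>\<close> as an additional entry makes the degree equal to \<open>r\<close>.\<close>

lemma card_mdeg_le: "card {\<alpha> :: 'n::finite \<Rightarrow> nat. mdeg \<alpha> \<le> r} = (r + CARD('n)) choose CARD('n)"
proof -
  obtain e :: "nat \<Rightarrow> 'n" where e: "bij_betw e {..<CARD('n)} UNIV"
    using ex_bij_betw_nat_finite[OF finite, of "UNIV :: 'n set"] by (auto simp: atLeast0LessThan)
  define xs where "xs = map e [0..<CARD('n)]"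
  have xs: "distinct xs" "set xs = UNIV" "length xs = CARD('n)"
    using e by (auto simp: xs_def distinct_map bij_betw_def atLeast0LessThan)
  have sum: "sum_list (map \<alpha> xs) = mdeg \<alpha>" for \<alpha> :: "'n \<Rightarrow> nat"
    using sum_list_distinct_conv_sum_set[OF xs(1), of \<alpha>] by (simp add: xs(2) mdeg_def)
  let ?L = "{l :: nat list. length l = CARD('n) + 1 \<and> sum_list l = r}"
  have "bij_betw (\<lambda>\<alpha>. (r - mdeg \<alpha>) # map \<alpha> xs) {\<alpha> :: 'n \<Rightarrow> nat. mdeg \<alpha> \<le> r} ?L"
  proof (rule bij_betwI')
    fix \<alpha> \<beta> :: "'n \<Rightarrow> nat"
    have "map \<alpha> xs = map \<beta> xs \<longleftrightarrow> \<alpha> = \<beta>" using xs(2) by (auto simp: fun_eq_iff)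
    then show "((r - mdeg \<alpha>) # map \<alpha> xs = (r - mdeg \<beta>) # map \<beta> xs) = (\<alpha> = \<beta>)" by auto
  next
    fix \<alpha> :: "'n \<Rightarrow> nat" assume "\<alpha> \<in> {\<alpha>. mdeg \<alpha> \<le> r}"
    then show "(r - mdeg \<alpha>) # map \<alpha> xs \<in> ?L" by (simp add: sum xs(3))
  next
    fix l assume "l \<in> ?L"
    then obtain h t where l: "l = h # t" "length t = CARD('n)" "h + sum_list t = r"
      by (cases l) auto
    define \<alpha> where "\<alpha> = (\<lambda>i. t ! (inv_into {..<CARD('n)} e i))"
    have "map \<alpha> xs = t"
      using bij_betw_inv_into_left[OF e] l(2)
      by (intro nth_equalityI) (auto simp: \<alpha>_def xs_def)
    moreover from this have "mdeg \<alpha> = sum_list t" using sum[of \<alpha>] by simp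
    ultimately show "\<exists>\<alpha>\<in>{\<alpha>. mdeg \<alpha> \<le> r}. l = (r - mdeg \<alpha>) # map \<alpha> xs"
      using l by (intro bexI[of _ \<alpha>]) auto
  qed
  then have "card {\<alpha> :: 'n \<Rightarrow> nat. mdeg \<alpha> \<le> r} = card ?L" by (rule bij_betw_same_card)
  also have "\<dots> = (r + CARD('n)) choose r" by (subst card_length_sum_list) simp
  also have "\<dots> = (r + CARD('n)) choose CARD('n)"
    by (subst binomial_symmetric) auto
  finally show ?thesis .
qed

definition eventually_polynomial :: "(nat \<Rightarrow> rat) \<Rightarrow> bool"
  where "eventually_polynomial f \<longleftrightarrow> (\<exists>P. \<forall>\<^sub>F r in sequentially. poly P (of_nat r) = f r)"

lemma eventually_polynomial_binomial:
  "eventually_polynomial (\<lambda>r. of_nat ((r + n) choose n))"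
proof -
  let ?P = "Polynomial.smult (1 / fact n) (\<Prod>i = 0..<n. [:of_nat n - of_nat i, 1:]) :: rat poly"
  have "poly ?P (of_nat r) = of_nat ((r + n) choose n)" for r
    unfolding binomial_gbinomial gbinomial_prod_rev
    by (simp add: poly_prod algebra_simps)
  then show ?thesis
    unfolding eventually_polynomial_def by (intro exI[of _ ?P] always_eventually) blast
qed

lemma eventually_polynomial_diff:
  assumes "eventually_polynomial f" "eventually_polynomial g"
  shows "eventually_polynomial (\<lambda>r. f r - g r)"
proof -
  obtain P Q where "\<forall>\<^sub>F r in sequentially. poly P (of_nat r) = f r"
    "\<forall>\<^sub>F r in sequentially. poly Q (of_nat r) = g r"
    using assms unfolding eventually_polynomial_def by blast
  then have "\<forall>\<^sub>F r in sequentially. poly (P - Q) (of_nat r) = f r - g r"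
    by eventually_elim simp
  then show ?thesis unfolding eventually_polynomial_def by blast
qed

lemma eventually_polynomial_shift:
  assumes "eventually_polynomial f" "\<And>r. d \<le> r \<Longrightarrow> g r = f (r - d)"
  shows "eventually_polynomial g"
proof -
  obtain P r0 where P: "\<And>r. r0 \<le> r \<Longrightarrow> poly P (of_nat r) = f r"
    using assms(1) unfolding eventually_polynomial_def eventually_sequentially by blast
  have "poly (pcompose P [:- of_nat d, 1:]) (of_nat r) = g r" if "r0 + d \<le> r" for r
  proof -
    have "poly (pcompose P [:- of_nat d, 1:]) (of_nat r) = poly P (of_nat (r - d))"
      using that by (simp add: poly_pcompose of_nat_diff)
    then show ?thesis using P[of "r - d"] assms(2)[of r] that by simp
  qed
  then show ?thesis unfolding eventually_polynomial_def eventually_sequentially by blast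
qed

lemma card_above:
  assumes r: "mdeg (\<delta> :: 'n::finite \<Rightarrow> nat) \<le> r"
  shows "card {\<alpha>. mdeg \<alpha> \<le> r \<and> \<delta> \<le> \<alpha>} = card {\<alpha> :: 'n \<Rightarrow> nat. mdeg \<alpha> \<le> r - mdeg \<delta>}"
proof (rule bij_betw_same_card[of "\<lambda>\<alpha> i. \<alpha> i - \<delta> i"],
    rule bij_betw_byWitness[where f' = "\<lambda>\<alpha> i. \<alpha> i + \<delta> i"])
  show "(\<lambda>\<alpha> i. \<alpha> i - \<delta> i) ` {\<alpha>. mdeg \<alpha> \<le> r \<and> \<delta> \<le> \<alpha>} \<subseteq> {\<alpha>. mdeg \<alpha> \<le> r - mdeg \<delta>}"
  proof clarify
    fix \<alpha> assume \<alpha>: "mdeg \<alpha> \<le> r" "\<delta> \<le> \<alpha>"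
    have "mdeg (\<lambda>i. \<alpha> i - \<delta> i) + mdeg \<delta> = mdeg \<alpha>"
      using \<alpha>(2) by (simp add: exponent_add_diff flip: mdeg_add)
    then show "mdeg (\<lambda>i. \<alpha> i - \<delta> i) \<le> r - mdeg \<delta>" using \<alpha>(1) by simp
  qed
  show "(\<lambda>\<alpha> i. \<alpha> i + \<delta> i) ` {\<alpha>. mdeg \<alpha> \<le> r - mdeg \<delta>} \<subseteq> {\<alpha>. mdeg \<alpha> \<le> r \<and> \<delta> \<le> \<alpha>}"
    using r by (auto simp: mdeg_add le_fun_def)
qed (auto simp: exponent_add_diff)

text \<open>Inclusion and exclusion, one forbidden divisor \<open>\<tau>\<close> at a time: the multiples of \<open>\<delta>\<close> that are also
  multiples of \<open>\<tau>\<close> are the multiples of \<open>sup \<delta> \<tau>\<close>. The lower bound \<open>\<delta>\<close> keeps the induction hypothesis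
  applicable.\<close>

lemma eventually_polynomial_avoiding:
  fixes T :: "('n::finite \<Rightarrow> nat) set"
  assumes "finite T"
  shows "eventually_polynomial (\<lambda>r. of_nat (card {\<alpha>. mdeg \<alpha> \<le> r \<and> \<delta> \<le> \<alpha> \<and> (\<forall>\<tau>\<in>T. \<not> \<tau> \<le> \<alpha>)}))"
  using assms
proof (induction T arbitrary: \<delta>)
  case empty
  have "eventually_polynomial (\<lambda>r. of_nat (card {\<alpha> :: 'n \<Rightarrow> nat. mdeg \<alpha> \<le> r}))"
    unfolding card_mdeg_le by (rule eventually_polynomial_binomial)
  then show ?case
    by (rule eventually_polynomial_shift[where d = "mdeg \<delta>"]) (simp add: card_above)
next
  case (insert \<tau> T)
  let ?N = "\<lambda>T \<delta> r. {\<alpha> :: 'n \<Rightarrow> nat. mdeg \<alpha> \<le> r \<and> \<delta> \<le> \<alpha> \<and> (\<forall>\<tau>\<in>T. \<not> \<tau> \<le> \<alpha>)}"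
  have fin: "finite (?N T \<delta> r)" for T \<delta> r by (rule finite_subset[OF _ finite_mdeg_le[of r]]) auto
  have eq: "of_nat (card (?N (insert \<tau> T) \<delta> r)) =
      of_nat (card (?N T \<delta> r)) - (of_nat (card (?N T (sup \<delta> \<tau>) r)) :: rat)" for r
  proof -
    have "?N (insert \<tau> T) \<delta> r = ?N T \<delta> r - ?N T (sup \<delta> \<tau>) r" by auto
    moreover have sub: "?N T (sup \<delta> \<tau>) r \<subseteq> ?N T \<delta> r" by auto
    ultimately have "card (?N (insert \<tau> T) \<delta> r) = card (?N T \<delta> r) - card (?N T (sup \<delta> \<tau>) r)"
      using card_Diff_subset[OF fin sub] by metis
    then show ?thesis using card_mono[OF fin sub] by (simp add: of_nat_diff)
  qed
  show ?case unfolding eq by (rule eventually_polynomial_diff[OF insert.IH insert.IH])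
qed

lemma eventually_polynomial_hilbert_count:
  fixes D :: "('n::finite \<Rightarrow> nat) set"
  assumes "\<And>\<alpha> \<beta>. \<alpha> \<in> D \<Longrightarrow> \<alpha> \<le> \<beta> \<Longrightarrow> \<beta> \<in> D"
  shows "eventually_polynomial (\<lambda>r. of_nat (hilbert_count D r))"
proof -
  obtain T where T: "T \<subseteq> D" "finite T" "\<And>\<alpha>. \<alpha> \<in> D \<Longrightarrow> \<exists>\<tau>\<in>T. \<tau> \<le> \<alpha>" using Dickson[of D] by blast
  have "\<alpha> \<notin> D \<longleftrightarrow> (\<lambda>_. 0) \<le> \<alpha> \<and> (\<forall>\<tau>\<in>T. \<not> \<tau> \<le> \<alpha>)" for \<alpha>
  proof -
    have "(\<lambda>_. 0) \<le> \<alpha>" by (simp add: le_fun_def)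
    then show ?thesis using T(1) T(3)[of \<alpha>] assms by blast
  qed
  then show ?thesis
    using eventually_polynomial_avoiding[OF T(2), of "\<lambda>_. 0"] by (simp add: hilbert_count_def)
qed

lemma rat_poly_eventually_ge:
  fixes R :: "rat poly"
  assumes "lead_coeff R > 0"
  shows "\<exists>c>0. \<forall>\<^sub>F r in sequentially. c \<le> poly R (of_nat r)"
  using assms
proof (induction R)
  case (pCons a R)
  show ?case
  proof (cases "R = 0")
    case True
    then show ?thesis using pCons.prems by (intro exI[of _ a]) auto
  next
    case False
    then obtain c where c: "c > 0" "\<forall>\<^sub>F r in sequentially. c \<le> poly R (of_nat r)"
      using pCons by auto
    obtain r0 where r0: "(1 - a) / c < of_nat r0" using reals_Archimedean2 by blast
    from c(2) eventually_ge_at_top[of r0]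
    have "\<forall>\<^sub>F r in sequentially. 1 \<le> poly (pCons a R) (of_nat r)"
    proof eventually_elim
      case (elim r)
      have "(1 - a) / c \<le> of_nat r" using r0 elim(2) by (meson less_imp_le of_nat_le_iff order_trans)
      then have "1 - a \<le> of_nat r * c" using c(1) by (simp add: pos_divide_le_eq)
      also have "\<dots> \<le> of_nat r * poly R (of_nat r)" using elim(1) by (intro mult_left_mono) auto
      finally show ?case by simp
    qed
    then show ?thesis by (intro exI[of _ 1]) auto
  qed
qed simp

text \<open>The order of polynomials by their values at large integers is total.\<close>

lemma rat_poly_trichotomy:
  fixes R :: "rat poly"
  obtains (pos) "\<forall>\<^sub>F r in sequentially. poly R (of_nat r) > 0"
  | (zero) "R = 0"
  | (neg) "\<forall>\<^sub>F r in sequentially. poly R (of_nat r) < 0"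
proof -
  have pos': "\<forall>\<^sub>F r in sequentially. poly S (of_nat r) > 0" if S: "lead_coeff S > 0" for S :: "rat poly"
  proof -
    obtain c where c: "c > 0" "\<forall>\<^sub>F r in sequentially. c \<le> poly S (of_nat r)"
      using rat_poly_eventually_ge[OF S] by blast
    from c(2) show ?thesis by eventually_elim (use c(1) in linarith)
  qed
  consider "lead_coeff R > 0" | "R = 0" | "lead_coeff (- R) > 0"
    by (metis leading_coeff_0_iff lead_coeff_minus neg_0_less_iff_less linorder_neqE_linordered_idom)
  then show ?thesis
  proof cases
    case 1 then show ?thesis using pos' pos by blast
  next
    case 2 then show ?thesis using zero by blast
  next
    case 3
    have "\<forall>\<^sub>F r in sequentially. poly R (of_nat r) < 0" using pos'[OF 3] by eventually_elim simp
    then show ?thesis by (rule neg)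
  qed
qed

section \<open>Convergent power series\<close>

lemma conv_series_simps:
  "c \<oplus>\<^bsub>conv_series\<^esub> d = (\<lambda>\<alpha>. c \<alpha> + d \<alpha>)"
  "c \<otimes>\<^bsub>conv_series\<^esub> d = (\<lambda>\<gamma>. \<Sum>\<alpha> | \<alpha> \<le> \<gamma>. c \<alpha> * d (\<lambda>i. \<gamma> i - \<alpha> i))"
  "\<zero>\<^bsub>conv_series\<^esub> = (\<lambda>_. 0)" "\<one>\<^bsub>conv_series\<^esub> = const_series 1"
  by (auto simp: conv_series_def const_series_def)

lemma const_series_mult: "const_series k \<otimes>\<^bsub>conv_series\<^esub> c = (\<lambda>\<alpha>. k * c \<alpha>)"
  by (simp add: conv_series_simps series_const)

lemma const_series_mult_const_series:
  "const_series k \<otimes>\<^bsub>conv_series\<^esub> const_series l = const_series (k * l)"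
  unfolding const_series_mult by (auto simp: const_series_def)

lemma const_series_closed: "const_series k \<in> carrier conv_series"
  using has_power_series_const unfolding carrier_conv_series_iff by blast

lemma conv_series_uminus:
  assumes "c \<in> carrier (conv_series :: (('n::finite \<Rightarrow> nat) \<Rightarrow> complex) ring)"
  shows "\<ominus>\<^bsub>conv_series\<^esub> c = (\<lambda>\<alpha>. - c \<alpha>)"
proof -
  interpret R: cring "conv_series :: (('n \<Rightarrow> nat) \<Rightarrow> complex) ring" by (rule cring_conv_series)
  have "(\<lambda>\<alpha>. - c \<alpha>) \<in> carrier conv_series"
    using R.m_closed[OF const_series_closed[of "- 1"] assms] by (simp add: const_series_mult)
  then show ?thesis
    using assms by (intro R.minus_equality) (simp_all add: conv_series_simps)
qed

text \<open>The points \<open>weight_point s\<close> lie in any given polydisk for large \<open>s\<close>, and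
  summability at such a point implies summability on the polydisk that it bounds.\<close>

lemma carrier_conv_series_iff_weighted:
  "c \<in> carrier conv_series \<longleftrightarrow> (\<exists>s. weighted_summable s (c :: ('n::finite \<Rightarrow> nat) \<Rightarrow> complex))"
proof
  assume "c \<in> carrier conv_series"
  then obtain r where "r > 0"
    and r: "\<And>z. z \<in> polydisk (\<lambda>_. r) \<Longrightarrow> (\<lambda>\<alpha>. c \<alpha> * monomial z \<alpha>) summable_on UNIV"
    by (auto simp: conv_series_def)
  obtain s where "weight_point s \<in> polydisk (\<lambda>_::'n. r)"
    using weight_point_small[OF \<open>r > 0\<close>] .
  from abs_summable_at_weight_point[OF r[OF this]] show "\<exists>s. weighted_summable s c" by blast
next
  assume "\<exists>s. weighted_summable s c"
  then obtain s where s: "weighted_summable s c" by blast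
  define r where "r = 1 / real (max_prime TYPE('n) ^ s)"
  have le: "coord_prime (i :: 'n) \<le> max_prime TYPE('n)" for i by (simp add: max_prime_def)
  have pos: "0 < coord_prime (i :: 'n)" for i using prime_gt_0_nat[OF prime_coord_prime] .
  have max_pos: "0 < max_prime TYPE('n)" using pos le by (rule less_le_trans)
  have "r > 0" using max_pos by (simp add: r_def)
  moreover have "(\<lambda>\<alpha>. c \<alpha> * monomial z \<alpha>) summable_on UNIV" if z: "z \<in> polydisk (\<lambda>_. r)" for z
  proof -
    have "norm (z $ i) \<le> 1 / real (coord_prime i ^ s)" for i
    proof -
      have "norm (z $ i) \<le> r" using z by (simp add: polydisk_def less_imp_le)
      also have "r \<le> 1 / real (coord_prime i ^ s)"
        unfolding r_def using pos[of i] le[of i] max_pos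
        by (intro divide_left_mono) (auto intro!: power_mono mult_pos_pos)
      finally show ?thesis .
    qed
    from norm_term_le_weighted[OF this]
    have "norm (c \<alpha> * monomial z \<alpha>) \<le> norm (c \<alpha>) / real (weight \<alpha>) ^ s" for \<alpha> .
    then have "(\<lambda>\<alpha>. norm (c \<alpha> * monomial z \<alpha>)) summable_on UNIV"
      by (rule summable_on_comparison_test[OF s[unfolded weighted_summable_def]]) simp
    then show ?thesis by (rule abs_summable_summable)
  qed
  ultimately show "c \<in> carrier conv_series" by (auto simp: conv_series_def)
qed

definition monomial_series :: "('n::finite \<Rightarrow> nat) \<Rightarrow> ('n \<Rightarrow> nat) \<Rightarrow> complex"
  where "monomial_series \<gamma> = (\<lambda>\<alpha>. if \<alpha> = \<gamma> then 1 else 0)"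

lemma finite_support_closed:
  assumes "finite {\<alpha>. c \<alpha> \<noteq> 0}"
  shows "c \<in> carrier conv_series"
proof -
  have "(\<lambda>\<alpha>. norm (c \<alpha>) / real (weight \<alpha>) ^ 0) summable_on {\<alpha>. c \<alpha> \<noteq> 0}"
    using assms by (rule summable_on_finite)
  then have "weighted_summable 0 c"
    unfolding weighted_summable_def
    by (rule summable_on_cong_neutral[THEN iffD1, rotated -1]) auto
  then show ?thesis unfolding carrier_conv_series_iff_weighted by blast
qed

lemma monomial_series_closed: "monomial_series \<gamma> \<in> carrier conv_series"
  by (rule finite_support_closed) (auto simp: monomial_series_def intro: finite_subset[of _ "{\<gamma>}"])

lemma monomial_series_mult: "monomial_series \<gamma> \<otimes>\<^bsub>conv_series\<^esub> c = shift \<gamma> c"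
proof
  fix \<delta>
  have "(\<Sum>\<alpha> | \<alpha> \<le> \<delta>. monomial_series \<gamma> \<alpha> * c (\<lambda>i. \<delta> i - \<alpha> i)) =
      (\<Sum>\<alpha> | \<alpha> \<le> \<delta>. if \<alpha> = \<gamma> then c (\<lambda>i. \<delta> i - \<gamma> i) else 0)"
    by (intro sum.cong) (auto simp: monomial_series_def)
  also have "\<dots> = shift \<gamma> c \<delta>"
    by (subst sum.delta) (auto simp: finite_below shift_def)
  finally show "(monomial_series \<gamma> \<otimes>\<^bsub>conv_series\<^esub> c) \<delta> = shift \<gamma> c \<delta>"
    by (simp add: conv_series_simps)
qed

lemma weighted_summable_shiftD:
  assumes "weighted_summable s (shift \<gamma> d)"
  shows "weighted_summable s d"
proof -
  let ?f = "\<lambda>\<alpha>. norm (shift \<gamma> d \<alpha>) / real (weight \<alpha>) ^ s"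
  have "inj (\<lambda>\<beta> i. \<beta> i + \<gamma> i :: nat)" by (auto simp: inj_def fun_eq_iff)
  from summable_on_reindex[OF this, of ?f]
  have "?f summable_on range (\<lambda>\<beta> i. \<beta> i + \<gamma> i) \<longleftrightarrow> (\<lambda>\<beta>. ?f (\<lambda>i. \<beta> i + \<gamma> i)) summable_on UNIV"
    by (simp add: o_def)
  moreover have "?f summable_on range (\<lambda>\<beta> i. \<beta> i + \<gamma> i)"
    using assms unfolding weighted_summable_def by (rule summable_on_subset_banach) simp
  ultimately have "(\<lambda>\<beta>. ?f (\<lambda>i. \<beta> i + \<gamma> i)) summable_on UNIV" by blast
  from summable_on_cmult_left[OF this, of "real (weight \<gamma>) ^ s"]
  show ?thesis
    by (simp add: weighted_summable_def weight_add power_mult_distrib shift_def exponent_add_diff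
        le_fun_def weight_pos[THEN less_imp_neq, symmetric] nonzero_divide_eq_eq)
qed

section \<open>Powers of the maximal ideal\<close>

text \<open>The power series of order at least \<open>k\<close>.\<close>

definition order_ideal :: "nat \<Rightarrow> (('n::finite \<Rightarrow> nat) \<Rightarrow> complex) set"
  where "order_ideal k = {c \<in> carrier conv_series. \<forall>\<alpha>. mdeg \<alpha> < k \<longrightarrow> c \<alpha> = 0}"

lemma max_ideal_eq_order_ideal: "max_ideal = order_ideal 1"
  by (auto simp: max_ideal_def order_ideal_def mdeg_eq_0_iff)

lemma order_ideal_mult:
  assumes "c \<in> order_ideal k" "d \<in> order_ideal l"
  shows "c \<otimes>\<^bsub>conv_series\<^esub> d \<in> order_ideal (k + l)"
proof -
  interpret R: cring "conv_series :: (('a \<Rightarrow> nat) \<Rightarrow> complex) ring" by (rule cring_conv_series)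
  have vanish: "c \<alpha> * d (\<lambda>i. \<gamma> i - \<alpha> i) = 0" if "mdeg \<gamma> < k + l" "\<alpha> \<le> \<gamma>" for \<alpha> \<gamma> :: "'a \<Rightarrow> nat"
  proof -
    have "mdeg \<alpha> + mdeg (\<lambda>i. \<gamma> i - \<alpha> i) = mdeg \<gamma>"
      using that(2) by (simp add: exponent_add_diff flip: mdeg_add)
    then have "mdeg \<alpha> < k \<or> mdeg (\<lambda>i. \<gamma> i - \<alpha> i) < l" using that(1) by linarith
    then show ?thesis using assms by (auto simp: order_ideal_def)
  qed
  have "(\<Sum>\<alpha> | \<alpha> \<le> \<gamma>. c \<alpha> * d (\<lambda>i. \<gamma> i - \<alpha> i)) = 0" if "mdeg \<gamma> < k + l" for \<gamma> :: "'a \<Rightarrow> nat"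
    by (rule sum.neutral) (use vanish[OF that] in blast)
  then show ?thesis
    using assms R.m_closed[of c d] by (simp add: order_ideal_def conv_series_simps(2))
qed

lemma order_ideal_add:
  assumes "c \<in> order_ideal k" "d \<in> order_ideal k"
  shows "c \<oplus>\<^bsub>conv_series\<^esub> d \<in> order_ideal k"
proof -
  interpret R: cring "conv_series :: (('a \<Rightarrow> nat) \<Rightarrow> complex) ring" by (rule cring_conv_series)
  show ?thesis
    using assms R.a_closed[of c d] by (auto simp: order_ideal_def conv_series_simps)
qed

text \<open>The monomials that are divisible by the coordinate \<open>i\<close> are split off as a product with this
  coordinate, and the rest involves fewer coordinates.\<close>

lemma order_ideal_Suc_subset_prod:
  fixes c :: "('n::finite \<Rightarrow> nat) \<Rightarrow> complex"
  assumes "finite I" "c \<in> order_ideal (Suc k)" "\<And>\<alpha>. c \<alpha> \<noteq> 0 \<Longrightarrow> \<exists>i\<in>I. \<alpha> i > 0"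
  shows "c \<in> ideal_prod conv_series (order_ideal k) max_ideal"
  using assms
proof (induction I arbitrary: c)
  case empty
  then have "c = \<zero>\<^bsub>conv_series\<^esub> \<otimes>\<^bsub>conv_series\<^esub> \<zero>\<^bsub>conv_series\<^esub>"
    by (auto simp: conv_series_simps)
  moreover have "\<zero>\<^bsub>conv_series\<^esub> \<in> order_ideal l" for l
    using cring.cring_simprules(2)[OF cring_conv_series]
    by (auto simp: order_ideal_def conv_series_simps)
  ultimately show ?case
    unfolding max_ideal_eq_order_ideal by (metis ideal_prod.prod)
next
  case (insert i I)
  define e where "e = (\<lambda>j. if j = i then 1 else 0 :: nat)"
  have le: "e \<le> \<alpha> \<longleftrightarrow> \<alpha> i > 0" for \<alpha> by (auto simp: le_fun_def e_def)
  have mdeg_e: "mdeg e = 1" by (simp add: mdeg_def e_def)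
  define d where "d = (\<lambda>\<beta>. c (\<lambda>j. \<beta> j + e j))"
  define c' where "c' = (\<lambda>\<alpha>. if \<alpha> i = 0 then c \<alpha> else 0)"
  obtain s where s: "weighted_summable s c"
    using insert.prems(1) carrier_conv_series_iff_weighted by (auto simp: order_ideal_def)
  have shift_d: "shift e d = (\<lambda>\<alpha>. if \<alpha> i > 0 then c \<alpha> else 0)"
  proof
    fix \<alpha>
    show "shift e d \<alpha> = (if \<alpha> i > 0 then c \<alpha> else 0)"
    proof (cases "e \<le> \<alpha>")
      case True
      from exponent_add_diff(2)[OF this] show ?thesis using True by (simp add: shift_def d_def le)
    qed (simp add: shift_def le)
  qed
  have restrict: "weighted_summable s (\<lambda>\<alpha>. if P \<alpha> then c \<alpha> else 0)" for P
    using s unfolding weighted_summable_def by (rule summable_on_comparison_test) auto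
  have "weighted_summable s d"
    using restrict[of "\<lambda>\<alpha>. \<alpha> i > 0"] unfolding shift_d[symmetric] by (rule weighted_summable_shiftD)
  then have d: "d \<in> order_ideal k"
    using insert.prems(1) by (auto simp: order_ideal_def carrier_conv_series_iff_weighted d_def mdeg_add mdeg_e)
  have c': "c' \<in> ideal_prod conv_series (order_ideal k) max_ideal"
  proof (rule insert.IH)
    show "c' \<in> order_ideal (Suc k)"
      using insert.prems(1) restrict[of "\<lambda>\<alpha>. \<alpha> i = 0"]
      unfolding order_ideal_def carrier_conv_series_iff_weighted c'_def by auto
    show "\<exists>j\<in>I. 0 < \<alpha> j" if "c' \<alpha> \<noteq> 0" for \<alpha>
      using insert.prems(2)[of \<alpha>] that by (auto simp: c'_def split: if_splits)
  qed
  have "(\<lambda>_. 0) \<noteq> e" using mdeg_e mdeg_eq_0_iff[of e] by (metis zero_neq_one)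
  then have "monomial_series e (\<lambda>_. 0) = 0" unfolding monomial_series_def by (rule if_not_P)
  then have "monomial_series e \<in> max_ideal" by (simp add: max_ideal_def monomial_series_closed)
  with d have "d \<otimes>\<^bsub>conv_series\<^esub> monomial_series e \<in> ideal_prod conv_series (order_ideal k) max_ideal"
    by (rule ideal_prod.prod)
  also have "d \<otimes>\<^bsub>conv_series\<^esub> monomial_series e = shift e d"
    unfolding monomial_series_mult[symmetric]
    using d monomial_series_closed
    by (intro cring.cring_simprules(14)[OF cring_conv_series]) (auto simp: order_ideal_def)
  finally have "c' \<oplus>\<^bsub>conv_series\<^esub> shift e d \<in> ideal_prod conv_series (order_ideal k) max_ideal"
    by (rule ideal_prod.sum[OF c'])
  also have "c' \<oplus>\<^bsub>conv_series\<^esub> shift e d = c"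
    by (auto simp: conv_series_simps shift_d c'_def)
  finally show ?case .
qed

lemma max_ideal_power:
  "max_ideal [^]\<^bsub>ideals_set conv_series\<^esub> k = (order_ideal k :: (('n::finite \<Rightarrow> nat) \<Rightarrow> complex) set)"
proof -
  let ?R = "conv_series :: (('n \<Rightarrow> nat) \<Rightarrow> complex) ring"
  interpret R: cring ?R by (rule cring_conv_series)
  interpret S: comm_monoid "ideals_set ?R" by (rule R.ideals_set_is_comm_monoid)
  show ?thesis
  proof (induction k)
    case 0
    show ?case by (auto simp: S.nat_pow_0 ideals_set_def order_ideal_def)
  next
    case (Suc k)
    have "ideal_prod ?R (order_ideal k) max_ideal = order_ideal (Suc k)"
    proof (intro equalityI subsetI)
      fix c assume "c \<in> ideal_prod ?R (order_ideal k) max_ideal"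
      then show "c \<in> order_ideal (Suc k)"
      proof induction
        case (prod c d)
        then show ?case using order_ideal_mult[of c k d 1] by (simp add: max_ideal_eq_order_ideal)
      next
        case (sum c d)
        then show ?case by (intro order_ideal_add)
      qed
    next
      fix c :: "('n \<Rightarrow> nat) \<Rightarrow> complex" assume c: "c \<in> order_ideal (Suc k)"
      show "c \<in> ideal_prod ?R (order_ideal k) max_ideal"
      proof (rule order_ideal_Suc_subset_prod[of UNIV])
        fix \<alpha> assume "c \<alpha> \<noteq> 0"
        then have "\<not> mdeg \<alpha> < Suc k" using c unfolding order_ideal_def by blast
        then have "\<alpha> \<noteq> (\<lambda>_. 0)" unfolding mdeg_eq_0_iff[symmetric] by simp
        then show "\<exists>i\<in>UNIV. 0 < \<alpha> i" by (auto simp: fun_eq_iff)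
      qed (use c in auto)
    qed
    then show ?case using Suc.IH by (simp add: ideals_set_def)
  qed
qed

section \<open>The Hilbert-Samuel function as a count of monomials\<close>

text \<open>Modulo the power \<open>r + 1\<close> of the maximal ideal only the coefficients of degree at most \<open>r\<close> are
  left.\<close>

lemma HS_ideal_iff:
  assumes "ideal I conv_series"
  shows "c \<in> HS_ideal I r \<longleftrightarrow> c \<in> carrier conv_series \<and>
    (\<exists>g\<in>I. \<forall>\<alpha> :: 'n::finite \<Rightarrow> nat. mdeg \<alpha> \<le> r \<longrightarrow> g \<alpha> = c \<alpha>)"
proof -
  interpret R: cring "conv_series :: (('n \<Rightarrow> nat) \<Rightarrow> complex) ring" by (rule cring_conv_series)
  interpret I: ideal I "conv_series :: (('n \<Rightarrow> nat) \<Rightarrow> complex) ring" by fact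
  have sum: "HS_ideal I r = {\<lambda>\<alpha>. g \<alpha> + e \<alpha> |g e. g \<in> I \<and> e \<in> order_ideal (r + 1)}"
    unfolding HS_ideal_def max_ideal_power by (auto simp: set_add_def' conv_series_simps(1))
  show ?thesis
  proof
    assume "c \<in> HS_ideal I r"
    then obtain g e where ge: "g \<in> I" "e \<in> order_ideal (r + 1)" "c = (\<lambda>\<alpha>. g \<alpha> + e \<alpha>)"
      unfolding sum by blast
    have "c \<in> carrier conv_series"
      using R.a_closed[OF I.Icarr[OF ge(1)], of e] ge by (simp add: order_ideal_def conv_series_simps)
    moreover have "\<forall>\<alpha>. mdeg \<alpha> \<le> r \<longrightarrow> g \<alpha> = c \<alpha>" using ge(2,3) by (auto simp: order_ideal_def)
    ultimately show "c \<in> carrier conv_series \<and> (\<exists>g\<in>I. \<forall>\<alpha>. mdeg \<alpha> \<le> r \<longrightarrow> g \<alpha> = c \<alpha>)"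
      using ge(1) by blast
  next
    assume "c \<in> carrier conv_series \<and> (\<exists>g\<in>I. \<forall>\<alpha>. mdeg \<alpha> \<le> r \<longrightarrow> g \<alpha> = c \<alpha>)"
    then obtain g where g: "c \<in> carrier conv_series" "g \<in> I" "\<forall>\<alpha>. mdeg \<alpha> \<le> r \<longrightarrow> g \<alpha> = c \<alpha>" by blast
    define e where "e = c \<ominus>\<^bsub>conv_series\<^esub> g"
    have gc: "g \<in> carrier conv_series" using g(2) by (rule I.Icarr)
    have e: "e = (\<lambda>\<alpha>. c \<alpha> - g \<alpha>)"
      by (simp add: e_def a_minus_def conv_series_uminus[OF gc] conv_series_simps)
    have "e \<in> order_ideal (r + 1)"
      using R.minus_closed[OF g(1) gc] g(3) by (auto simp: order_ideal_def e_def[symmetric] e)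
    moreover have "c = (\<lambda>\<alpha>. g \<alpha> + e \<alpha>)" by (simp add: e)
    ultimately show "c \<in> HS_ideal I r"
      using g(2) unfolding sum by blast
  qed
qed

lemma ideal_order_ideal: "ideal (order_ideal k) (conv_series :: (('n::finite \<Rightarrow> nat) \<Rightarrow> complex) ring)"
proof -
  interpret R: cring "conv_series :: (('n \<Rightarrow> nat) \<Rightarrow> complex) ring" by (rule cring_conv_series)
  interpret S: comm_monoid "ideals_set (conv_series :: (('n \<Rightarrow> nat) \<Rightarrow> complex) ring)"
    by (rule R.ideals_set_is_comm_monoid)
  have "max_ideal \<in> carrier (ideals_set (conv_series :: (('n \<Rightarrow> nat) \<Rightarrow> complex) ring))"
    using maximalideal.axioms(1)[OF maximalideal_max_ideal] by (simp add: ideals_set_def)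
  then have "max_ideal [^]\<^bsub>ideals_set conv_series\<^esub> k \<in>
      carrier (ideals_set (conv_series :: (('n \<Rightarrow> nat) \<Rightarrow> complex) ring))"
    by (rule S.nat_pow_closed)
  then show ?thesis unfolding max_ideal_power by (simp add: ideals_set_def)
qed

lemma ideal_HS_ideal:
  assumes "ideal I (conv_series :: (('n::finite \<Rightarrow> nat) \<Rightarrow> complex) ring)"
  shows "ideal (HS_ideal I r) conv_series"
  unfolding HS_ideal_def max_ideal_power
  using ring.add_ideals[OF cring.axioms(1)[OF cring_conv_series] assms ideal_order_ideal] .

lemma ideal_conv_series_closed:
  assumes "ideal I (conv_series :: (('n::finite \<Rightarrow> nat) \<Rightarrow> complex) ring)"
  shows "c \<in> I \<Longrightarrow> d \<in> I \<Longrightarrow> (\<lambda>\<alpha>. c \<alpha> + k * d \<alpha>) \<in> I" "(\<lambda>_. 0) \<in> I"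
proof -
  interpret I: ideal I "conv_series :: (('n \<Rightarrow> nat) \<Rightarrow> complex) ring" by fact
  show "(\<lambda>_. 0) \<in> I"
    using additive_subgroup.zero_closed[OF ideal.axioms(1)[OF assms]] by (simp add: conv_series_simps)
  show "c \<in> I \<Longrightarrow> d \<in> I \<Longrightarrow> (\<lambda>\<alpha>. c \<alpha> + k * d \<alpha>) \<in> I"
    using additive_subgroup.a_closed[OF ideal.axioms(1)[OF assms], of c "const_series k \<otimes>\<^bsub>conv_series\<^esub> d"]
      I.I_l_closed[of d "const_series k"]
    by (simp add: const_series_mult const_series_closed conv_series_simps(1))
qed

lemma coset_eq_iff:
  assumes "ideal H (conv_series :: (('n::finite \<Rightarrow> nat) \<Rightarrow> complex) ring)"
  shows "H +>\<^bsub>conv_series\<^esub> x = H +>\<^bsub>conv_series\<^esub> y \<longleftrightarrow> (\<lambda>\<alpha>. x \<alpha> - y \<alpha>) \<in> H"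
proof -
  have coset: "H +>\<^bsub>conv_series\<^esub> x = {\<lambda>\<alpha>. h \<alpha> + x \<alpha> |h. h \<in> H}" for x
    unfolding a_r_coset_def' conv_series_simps(1) by blast
  note closed = ideal_conv_series_closed[OF assms]
  have sub: "H +>\<^bsub>conv_series\<^esub> x \<subseteq> H +>\<^bsub>conv_series\<^esub> y" if "(\<lambda>\<alpha>. x \<alpha> - y \<alpha>) \<in> H" for x y
  proof
    fix z assume "z \<in> H +>\<^bsub>conv_series\<^esub> x"
    then obtain h where h: "h \<in> H" "z = (\<lambda>\<alpha>. h \<alpha> + x \<alpha>)" unfolding coset by blast
    have "(\<lambda>\<alpha>. h \<alpha> + 1 * (x \<alpha> - y \<alpha>)) \<in> H" by (rule closed(1)[OF h(1) that])
    then show "z \<in> H +>\<^bsub>conv_series\<^esub> y"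
      unfolding coset h(2) by (intro CollectI exI[of _ "\<lambda>\<alpha>. h \<alpha> + 1 * (x \<alpha> - y \<alpha>)"]) auto
  qed
  show ?thesis
  proof
    assume eq: "H +>\<^bsub>conv_series\<^esub> x = H +>\<^bsub>conv_series\<^esub> y"
    have "x \<in> H +>\<^bsub>conv_series\<^esub> x"
      unfolding coset using closed(2) by (intro CollectI exI[of _ "\<lambda>_. 0"]) auto
    then have "x \<in> H +>\<^bsub>conv_series\<^esub> y" by (simp only: eq)
    then obtain h where "h \<in> H" "x = (\<lambda>\<alpha>. h \<alpha> + y \<alpha>)" unfolding coset by blast
    then show "(\<lambda>\<alpha>. x \<alpha> - y \<alpha>) \<in> H" by simp
  next
    assume xy: "(\<lambda>\<alpha>. x \<alpha> - y \<alpha>) \<in> H"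
    have "(\<lambda>\<alpha>. 0 + (- 1) * (x \<alpha> - y \<alpha>)) \<in> H" by (rule closed(1)[OF closed(2) xy])
    then have "(\<lambda>\<alpha>. y \<alpha> - x \<alpha>) \<in> H" by simp
    then show "H +>\<^bsub>conv_series\<^esub> x = H +>\<^bsub>conv_series\<^esub> y" using sub xy by blast
  qed
qed

lemma subfield_const_series:
  "subfield (range const_series) (conv_series :: (('n::finite \<Rightarrow> nat) \<Rightarrow> complex) ring)"
proof -
  let ?R = "conv_series :: (('n \<Rightarrow> nat) \<Rightarrow> complex) ring"
  let ?C = "range const_series :: (('n \<Rightarrow> nat) \<Rightarrow> complex) set"
  interpret R: cring ?R by (rule cring_conv_series)
  have inj: "const_series k = (const_series l :: ('n \<Rightarrow> nat) \<Rightarrow> complex) \<Longrightarrow> k = l" for k l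
    by (drule fun_cong[where x = "\<lambda>_. 0"]) (simp add: const_series_def)
  have zero: "\<zero>\<^bsub>?R\<^esub> = const_series 0" by (auto simp: conv_series_simps const_series_def)
  have "subring ?C ?R"
  proof (rule R.subringI)
    show "?C \<subseteq> carrier ?R" using const_series_closed by blast
    show "\<one>\<^bsub>?R\<^esub> \<in> ?C" by (simp add: conv_series_simps)
    fix c d assume "c \<in> ?C" "d \<in> ?C"
    then obtain k l where cd: "c = const_series k" "d = const_series l" by blast
    have "\<ominus>\<^bsub>?R\<^esub> c = const_series (- k)"
      unfolding cd conv_series_uminus[OF const_series_closed] by (auto simp: const_series_def)
    then show "\<ominus>\<^bsub>?R\<^esub> c \<in> ?C" by simp
    show "c \<otimes>\<^bsub>?R\<^esub> d \<in> ?C" unfolding cd const_series_mult_const_series by simp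
    have "c \<oplus>\<^bsub>?R\<^esub> d = const_series (k + l)"
      by (auto simp: cd conv_series_simps const_series_def)
    then show "c \<oplus>\<^bsub>?R\<^esub> d \<in> ?C" by simp
  qed
  then show ?thesis
  proof (intro R.subfieldI R.subcringI')
    show "Units (?R\<lparr>carrier := ?C\<rparr>) = ?C - {\<zero>\<^bsub>?R\<^esub>}"
    proof (intro equalityI subsetI)
      fix c assume "c \<in> Units (?R\<lparr>carrier := ?C\<rparr>)"
      then obtain k l where "c = const_series k" "const_series l \<otimes>\<^bsub>?R\<^esub> const_series k = \<one>\<^bsub>?R\<^esub>"
        by (auto simp: Units_def)
      then have "c = const_series k" "l * k = 1"
        using inj[of "l * k" 1]
        unfolding const_series_mult_const_series conv_series_simps(4) by simp_all
      then show "c \<in> ?C - {\<zero>\<^bsub>?R\<^esub>}" using inj[of k 0] zero by auto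
    next
      fix c assume c: "c \<in> ?C - {\<zero>\<^bsub>?R\<^esub>}"
      then obtain k where k: "c = const_series k" "k \<noteq> 0" using zero by auto
      have "const_series (inverse k) \<otimes>\<^bsub>?R\<^esub> c = \<one>\<^bsub>?R\<^esub>" "c \<otimes>\<^bsub>?R\<^esub> const_series (inverse k) = \<one>\<^bsub>?R\<^esub>"
        using k(2) unfolding k(1) const_series_mult_const_series conv_series_simps(4) by simp_all
      then show "c \<in> Units (?R\<lparr>carrier := ?C\<rparr>)" using k(1) by (auto simp: Units_def)
    qed
  qed
qed

text \<open>For a proper ideal the constants form a subfield of the quotient. If the ideal is the whole ring, the
  quotient is the zero ring, in which only the dimension \<open>0\<close> is derivable.\<close>

lemma dimension_unique_in_quotient:
  fixes H :: "(('n::finite \<Rightarrow> nat) \<Rightarrow> complex) set"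
  assumes H: "ideal H conv_series"
    and K: "K = range (\<lambda>k. H +>\<^bsub>conv_series\<^esub> const_series k)"
    and d: "ring.dimension (conv_series Quot H) d K E" "ring.dimension (conv_series Quot H) e K E"
  shows "d = e"
proof -
  let ?R = "conv_series :: (('n \<Rightarrow> nat) \<Rightarrow> complex) ring"
  let ?Q = "?R Quot H"
  interpret I: ideal H ?R by fact
  interpret Q: ring ?Q by (rule I.quotient_is_ring)
  interpret h: ring_hom_ring ?R ?Q "(+>\<^bsub>?R\<^esub>) H" by (rule I.rcos_ring_hom_ring)
  show ?thesis
  proof (cases "\<one>\<^bsub>?Q\<^esub> = \<zero>\<^bsub>?Q\<^esub>")
    case False
    have "subfield ((+>\<^bsub>?R\<^esub>) H ` range const_series) ?Q"
      by (rule h.img_is_subfield(2)[OF subfield_const_series False])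
    then have "subfield K ?Q" by (simp add: K image_image)
    then show ?thesis using d by (rule Q.dimension_is_inj)
  next
    case True
    then have car: "carrier ?Q = {\<zero>\<^bsub>?Q\<^esub>}" using Q.one_zeroD by blast
    have "n = 0 \<and> F = {\<zero>\<^bsub>?Q\<^esub>}" if "Q.dimension n K F" for n F
      using that by induction (use car in auto)
    then show ?thesis using d by blast
  qed
qed

text \<open>Exponents are treated in increasing order. A term with exponent in the diagram is cancelled by a
  multiple of an element of \<open>I\<close>, any other term is moved to \<open>p\<close>.\<close>

lemma division_by_initial_exponents:
  fixes I :: "(('n::finite \<Rightarrow> nat) \<Rightarrow> complex) set"
  assumes "ideal I conv_series"
  shows "\<exists>p g. (\<forall>\<alpha>. p \<alpha> \<noteq> 0 \<longrightarrow> \<alpha> \<in> {\<alpha>. mdeg \<alpha> \<le> r \<and> \<alpha> \<notin> initial_exponents graded_weight I}) \<and>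
    g \<in> I \<and> (\<forall>\<beta>. mdeg \<beta> \<le> r \<longrightarrow> c \<beta> = p \<beta> + g \<beta>)"
proof -
  let ?D = "initial_exponents graded_weight I"
  let ?B = "{\<alpha>. mdeg \<alpha> \<le> r \<and> \<alpha> \<notin> ?D}"
  have inj: "\<gamma> = \<beta>" if "graded_weight \<gamma> = graded_weight \<beta>" for \<beta> \<gamma> :: "'n \<Rightarrow> nat"
    using that exponent_order_graded_weight by (auto simp: exponent_order_def dest: injD)
  have approx: "\<exists>p g. (\<forall>\<alpha>. p \<alpha> \<noteq> 0 \<longrightarrow> \<alpha> \<in> ?B) \<and> g \<in> I \<and>
      (\<forall>\<beta>. graded_weight \<beta> < n \<longrightarrow> mdeg \<beta> \<le> r \<longrightarrow> c \<beta> = p \<beta> + g \<beta>)" for n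
  proof (induction n)
    case 0
    show ?case
      using ideal_conv_series_closed(2)[OF assms]
      by (intro exI[of _ "\<lambda>_. 0"]) simp
  next
    case (Suc n)
    then obtain p g where pg: "\<forall>\<alpha>. p \<alpha> \<noteq> 0 \<longrightarrow> \<alpha> \<in> ?B" "g \<in> I"
      "\<And>\<beta>. graded_weight \<beta> < n \<Longrightarrow> mdeg \<beta> \<le> r \<Longrightarrow> c \<beta> = p \<beta> + g \<beta>" by blast
    show ?case
    proof (cases "\<exists>\<beta> :: 'n \<Rightarrow> nat. graded_weight \<beta> = n \<and> mdeg \<beta> \<le> r")
      case False
      have "c \<beta> = p \<beta> + g \<beta>" if "graded_weight \<beta> < Suc n" "mdeg \<beta> \<le> r" for \<beta>
        using that False by (intro pg(3)) (auto simp: less_Suc_eq)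
      then show ?thesis using pg(1,2) by (intro exI[of _ p] exI[of _ g]) blast
    next
      case True
      then obtain \<beta> :: "'n \<Rightarrow> nat" where \<beta>: "graded_weight \<beta> = n" "mdeg \<beta> \<le> r" by blast
      have below: "c \<gamma> = p \<gamma> + g \<gamma>" if "graded_weight \<gamma> < Suc n" "mdeg \<gamma> \<le> r" "\<gamma> \<noteq> \<beta>" for \<gamma>
      proof -
        have "graded_weight \<gamma> \<noteq> n" using inj[of \<gamma> \<beta>] that(3) \<beta>(1) by metis
        then show ?thesis using that(1,2) by (intro pg(3)) auto
      qed
      show ?thesis
      proof (cases "\<beta> \<in> ?D")
        case False
        let ?p = "p(\<beta> := c \<beta> - g \<beta>)"
        have "\<forall>\<alpha>. ?p \<alpha> \<noteq> 0 \<longrightarrow> \<alpha> \<in> ?B" using pg(1) \<beta>(2) False by simp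
        moreover have "c \<gamma> = ?p \<gamma> + g \<gamma>" if "graded_weight \<gamma> < Suc n" "mdeg \<gamma> \<le> r" for \<gamma>
          using below[OF that] by (cases "\<gamma> = \<beta>") simp_all
        ultimately show ?thesis using pg(2) by (intro exI[of _ ?p] exI[of _ g]) blast
      next
        case True
        then obtain f where f: "f \<in> I" "lead graded_weight f \<beta>"
          unfolding initial_exponents_def by blast
        define k where "k = (c \<beta> - p \<beta> - g \<beta>) / f \<beta>"
        have "(\<lambda>\<gamma>. g \<gamma> + k * f \<gamma>) \<in> I" by (rule ideal_conv_series_closed(1)[OF assms pg(2) f(1)])
        moreover have "c \<gamma> = p \<gamma> + (g \<gamma> + k * f \<gamma>)" if "graded_weight \<gamma> < Suc n" "mdeg \<gamma> \<le> r" for \<gamma>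
        proof (cases "\<gamma> = \<beta>")
          case True
          then show ?thesis using f(2) by (simp add: lead_def k_def)
        next
          case False
          then have "graded_weight \<gamma> < graded_weight \<beta>"
            using that(1) \<beta>(1) inj[of \<gamma> \<beta>] by (metis less_SucE)
          then have "f \<gamma> = 0" using f(2) by (simp add: lead_def)
          then show ?thesis using below[OF that False] by simp
        qed
        ultimately show ?thesis
          using pg(1) by (intro exI[of _ p] exI[of _ "\<lambda>\<gamma>. g \<gamma> + k * f \<gamma>"]) blast
      qed
    qed
  qed
  obtain N where N: "\<And>\<beta> :: 'n \<Rightarrow> nat. mdeg \<beta> \<le> r \<Longrightarrow> graded_weight \<beta> \<le> N"
    using finite_nat_set_iff_bounded_le[of "graded_weight ` {\<beta> :: 'n \<Rightarrow> nat. mdeg \<beta> \<le> r}"]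
      finite_mdeg_le by auto
  then have "graded_weight \<beta> < Suc N" if "mdeg \<beta> \<le> r" for \<beta> :: "'n \<Rightarrow> nat"
    using that by (simp add: le_imp_less_Suc)
  then show ?thesis using approx[of "Suc N"] by blast
qed

text \<open>The monomials of degree at most \<open>r\<close> outside the diagram are a basis of the quotient. They generate it
  by \<open>division_by_initial_exponents\<close>. They are independent since the leading exponent of a combination
  of them in the ideal would belong to the diagram.\<close>

lemma HSF_eq_hilbert_count:
  fixes I :: "(('n::finite \<Rightarrow> nat) \<Rightarrow> complex) set"
  assumes "ideal I conv_series"
  shows "HSF I r = hilbert_count (initial_exponents graded_weight I) r"
proof -
  let ?R = "conv_series :: (('n \<Rightarrow> nat) \<Rightarrow> complex) ring"
  define H where "H = HS_ideal I r"
  define D where "D = initial_exponents graded_weight I"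
  define B where "B = {\<alpha> :: 'n \<Rightarrow> nat. mdeg \<alpha> \<le> r \<and> \<alpha> \<notin> D}"
  define K where "K = range (\<lambda>k. H +>\<^bsub>?R\<^esub> const_series k)"
  let ?Q = "?R Quot H"
  have H: "ideal H ?R" unfolding H_def by (rule ideal_HS_ideal[OF assms])
  interpret R: cring ?R by (rule cring_conv_series)
  interpret I: ideal H ?R by (rule H)
  interpret Q: ring ?Q by (rule I.quotient_is_ring)
  interpret h: ring_hom_ring ?R ?Q "(+>\<^bsub>?R\<^esub>) H" by (rule I.rcos_ring_hom_ring)
  have finB: "finite B" unfolding B_def by (rule finite_subset[OF _ finite_mdeg_le[of r]]) auto
  have lead_in_D: "\<alpha> \<in> D" if "u \<in> H" "lead graded_weight u \<alpha>" "mdeg \<alpha> \<le> r" for u \<alpha>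
  proof -
    obtain g where g: "g \<in> I" "\<And>\<beta>. mdeg \<beta> \<le> r \<Longrightarrow> g \<beta> = u \<beta>"
      using \<open>u \<in> H\<close> unfolding H_def HS_ideal_iff[OF assms] by blast
    have "lead graded_weight g \<alpha>"
      using that(2,3) g(2) by (auto simp: lead_def graded_weight_less_iff)
    then show ?thesis using g(1) by (auto simp: D_def initial_exponents_def)
  qed
  have indep: "u = (\<lambda>_. 0)" if u: "u \<in> H" "\<And>\<alpha>. u \<alpha> \<noteq> 0 \<Longrightarrow> \<alpha> \<in> B" for u
  proof (rule ccontr)
    assume "u \<noteq> (\<lambda>_. 0)"
    then obtain \<alpha> where "u \<alpha> \<noteq> 0" by auto
    then obtain \<beta> where \<beta>: "lead graded_weight u \<beta>" by (rule lead_exists)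
    then have "\<beta> \<in> B" using u(2) by (simp add: lead_def)
    then show False using lead_in_D[OF u(1) \<beta>] by (simp add: B_def)
  qed
  \<comment> \<open>The classes of the polynomials with support in \<open>S\<close>.\<close>
  define span where "span S = (\<lambda>p. H +>\<^bsub>?R\<^esub> p) ` {p. \<forall>\<alpha>. p \<alpha> \<noteq> 0 \<longrightarrow> \<alpha> \<in> S}" for S
  have fin_carrier: "p \<in> carrier ?R" if "finite S" "\<forall>\<alpha>. p \<alpha> \<noteq> 0 \<longrightarrow> \<alpha> \<in> S" for p S
    by (rule finite_support_closed) (use that in \<open>auto intro: finite_subset\<close>)
  have dim: "Q.dimension (card S) K (span S)" if "finite S" "S \<subseteq> B" for S
    using that
  proof induction
    case empty
    have "{p :: ('n \<Rightarrow> nat) \<Rightarrow> complex. \<forall>\<alpha>. p \<alpha> \<noteq> 0 \<longrightarrow> \<alpha> \<in> {}} = {\<zero>\<^bsub>?R\<^esub>}"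
      by (auto simp: conv_series_simps)
    then have "span {} = {\<zero>\<^bsub>?Q\<^esub>}" unfolding span_def by simp
    then show ?case by simp
  next
    case (insert \<alpha> S)
    let ?v = "H +>\<^bsub>?R\<^esub> monomial_series \<alpha>"
    have "?v \<in> carrier ?Q" by (rule h.hom_closed[OF monomial_series_closed])
    moreover have "?v \<notin> span S"
    proof
      assume "?v \<in> span S"
      then obtain p where p: "\<forall>\<beta>. p \<beta> \<noteq> 0 \<longrightarrow> \<beta> \<in> S" "?v = H +>\<^bsub>?R\<^esub> p" unfolding span_def by blast
      then have "(\<lambda>\<beta>. monomial_series \<alpha> \<beta> - p \<beta>) \<in> H" unfolding coset_eq_iff[OF H] by blast
      then have "(\<lambda>\<beta>. monomial_series \<alpha> \<beta> - p \<beta>) = (\<lambda>_. 0)"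
        by (rule indep) (use p(1) insert.prems in \<open>auto simp: monomial_series_def split: if_splits\<close>)
      then have "monomial_series \<alpha> \<alpha> - p \<alpha> = 0" by (rule fun_cong)
      then have "p \<alpha> = 1" by (simp add: monomial_series_def)
      then show False using p(1) insert.hyps(2) by auto
    qed
    ultimately have "Q.dimension (Suc (card S)) K (Q.line_extension K ?v (span S))"
      using insert by (intro Q.Suc_dim) auto
    moreover have "Q.line_extension K ?v (span S) = span (insert \<alpha> S)"
    proof -
      have comb: "(H +>\<^bsub>?R\<^esub> const_series k) \<otimes>\<^bsub>?Q\<^esub> ?v \<oplus>\<^bsub>?Q\<^esub> (H +>\<^bsub>?R\<^esub> p) =
          H +>\<^bsub>?R\<^esub> (\<lambda>\<beta>. k * monomial_series \<alpha> \<beta> + p \<beta>)"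
        if "\<forall>\<beta>. p \<beta> \<noteq> 0 \<longrightarrow> \<beta> \<in> S" for k p
      proof -
        have "H +>\<^bsub>?R\<^esub> (const_series k \<otimes>\<^bsub>?R\<^esub> monomial_series \<alpha> \<oplus>\<^bsub>?R\<^esub> p) =
            (H +>\<^bsub>?R\<^esub> (const_series k \<otimes>\<^bsub>?R\<^esub> monomial_series \<alpha>)) \<oplus>\<^bsub>?Q\<^esub> (H +>\<^bsub>?R\<^esub> p)"
          by (rule h.hom_add[OF R.m_closed[OF const_series_closed monomial_series_closed]
                fin_carrier[OF insert.hyps(1) that]])
        also have "H +>\<^bsub>?R\<^esub> (const_series k \<otimes>\<^bsub>?R\<^esub> monomial_series \<alpha>) =
            (H +>\<^bsub>?R\<^esub> const_series k) \<otimes>\<^bsub>?Q\<^esub> ?v"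
          by (rule h.hom_mult[OF const_series_closed monomial_series_closed])
        finally have "H +>\<^bsub>?R\<^esub> (const_series k \<otimes>\<^bsub>?R\<^esub> monomial_series \<alpha> \<oplus>\<^bsub>?R\<^esub> p) =
            (H +>\<^bsub>?R\<^esub> const_series k) \<otimes>\<^bsub>?Q\<^esub> ?v \<oplus>\<^bsub>?Q\<^esub> (H +>\<^bsub>?R\<^esub> p)" .
        then show ?thesis by (simp only: const_series_mult conv_series_simps(1))
      qed
      show ?thesis
      proof (intro equalityI subsetI)
        fix x assume "x \<in> Q.line_extension K ?v (span S)"
        then obtain k p where kp: "\<forall>\<beta>. p \<beta> \<noteq> 0 \<longrightarrow> \<beta> \<in> S"
          "x = (H +>\<^bsub>?R\<^esub> const_series k) \<otimes>\<^bsub>?Q\<^esub> ?v \<oplus>\<^bsub>?Q\<^esub> (H +>\<^bsub>?R\<^esub> p)"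
          unfolding Q.line_extension_mem_iff K_def span_def by blast
        then have "x = H +>\<^bsub>?R\<^esub> (\<lambda>\<beta>. k * monomial_series \<alpha> \<beta> + p \<beta>)" using comb by simp
        then show "x \<in> span (insert \<alpha> S)"
          unfolding span_def using kp(1) by (intro image_eqI) (auto simp: monomial_series_def)
      next
        fix x assume "x \<in> span (insert \<alpha> S)"
        then obtain q where q: "\<forall>\<beta>. q \<beta> \<noteq> 0 \<longrightarrow> \<beta> \<in> insert \<alpha> S" "x = H +>\<^bsub>?R\<^esub> q"
          unfolding span_def by blast
        have p: "\<forall>\<beta>. (q(\<alpha> := 0)) \<beta> \<noteq> 0 \<longrightarrow> \<beta> \<in> S" using q(1) by auto
        have "q = (\<lambda>\<beta>. q \<alpha> * monomial_series \<alpha> \<beta> + (q(\<alpha> := 0)) \<beta>)"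
          by (auto simp: monomial_series_def)
        then have "x = (H +>\<^bsub>?R\<^esub> const_series (q \<alpha>)) \<otimes>\<^bsub>?Q\<^esub> ?v \<oplus>\<^bsub>?Q\<^esub> (H +>\<^bsub>?R\<^esub> (q(\<alpha> := 0)))"
          unfolding comb[OF p] q(2) by (rule arg_cong)
        then show "x \<in> Q.line_extension K ?v (span S)"
          unfolding Q.line_extension_mem_iff K_def span_def using p by blast
      qed
    qed
    ultimately show ?case using insert.hyps by simp
  qed
  have "span B = carrier ?Q"
  proof (intro equalityI subsetI)
    fix x assume "x \<in> span B"
    then show "x \<in> carrier ?Q"
      unfolding span_def using fin_carrier[OF finB] by (auto intro: h.hom_closed)
  next
    fix x assume "x \<in> carrier ?Q"
    then have "x \<in> a_rcosets\<^bsub>?R\<^esub> H" by (simp only: FactRing_def partial_object.select_convs)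
    then have "\<exists>c\<in>carrier ?R. x = H +>\<^bsub>?R\<^esub> c" by (simp only: A_RCOSETS_def' UN_iff singleton_iff)
    then obtain c where c: "c \<in> carrier ?R" "x = H +>\<^bsub>?R\<^esub> c" by (rule bexE)
    obtain p g where pg: "\<forall>\<alpha>. p \<alpha> \<noteq> 0 \<longrightarrow> \<alpha> \<in> B" "g \<in> I"
      "\<And>\<beta>. mdeg \<beta> \<le> r \<Longrightarrow> c \<beta> = p \<beta> + g \<beta>"
      using division_by_initial_exponents[OF assms, of r c] unfolding B_def D_def by blast
    have pc: "p \<in> carrier ?R" by (rule fin_carrier[OF finB pg(1)])
    have "(\<lambda>\<alpha>. c \<alpha> - p \<alpha>) \<in> carrier ?R"
      using R.minus_closed[OF c(1) pc] by (simp add: a_minus_def conv_series_uminus[OF pc] conv_series_simps)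
    moreover have "\<forall>\<alpha>. mdeg \<alpha> \<le> r \<longrightarrow> g \<alpha> = c \<alpha> - p \<alpha>" using pg(3) by simp
    ultimately have "(\<lambda>\<alpha>. c \<alpha> - p \<alpha>) \<in> H" unfolding H_def HS_ideal_iff[OF assms] using pg(2) by blast
    then have "x = H +>\<^bsub>?R\<^esub> p" unfolding c(2) coset_eq_iff[OF H] .
    then show "x \<in> span B" unfolding span_def using pg(1) by blast
  qed
  with dim[OF finB] have "Q.dimension (card B) K (carrier ?Q)" by simp
  then have "(THE d. ring.dimension ?Q d K (carrier ?Q)) = card B"
    using dimension_unique_in_quotient[OF H K_def] by (intro the_equality) blast+
  then show ?thesis
    unfolding HSF_def Let_def hilbert_count_def B_def D_def K_def H_def .
qed

section \<open>Coefficients of the elements of a parametrized ideal\<close>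

lemma monomial_join_vec: "monomial (join_vec b x) (case_sum \<beta> \<alpha>) = monomial b \<beta> * monomial x \<alpha>"
proof -
  let ?g = "\<lambda>k. (join_vec b x $ k) ^ case_sum \<beta> \<alpha> k"
  have "prod ?g UNIV = prod ?g (UNIV <+> UNIV)" by (simp only: UNIV_Plus_UNIV)
  also have "\<dots> = prod (?g \<circ> Inl) UNIV * prod (?g \<circ> Inr) UNIV" by (rule prod.Plus) auto
  finally show ?thesis by (simp add: monomial_def join_vec_def)
qed

lemma join_vec_add: "join_vec a x + join_vec b y = join_vec (a + b) (x + y)"
  by (auto simp: join_vec_def vec_eq_iff split: sum.split)

lemma join_vec_in_polydisk:
  "join_vec b x \<in> polydisk (\<lambda>_. r) \<longleftrightarrow> b \<in> polydisk (\<lambda>_. r) \<and> x \<in> polydisk (\<lambda>_. r)"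
proof
  assume *: "join_vec b x \<in> polydisk (\<lambda>_. r)"
  have "norm (join_vec b x $ Inl i) < r" "norm (join_vec b x $ Inr j) < r" for i j
    using * by (simp_all add: polydisk_def)
  then show "b \<in> polydisk (\<lambda>_. r) \<and> x \<in> polydisk (\<lambda>_. r)" by (simp add: polydisk_def join_vec_def)
qed (auto simp: polydisk_def join_vec_def split: sum.split)

text \<open>The terms of the power series in \<open>(a, x)\<close> are summed first over the exponents of \<open>a\<close>. The radius \<open>r\<close> does
  not depend on \<open>b\<close>.\<close>

lemma slice_power_series:
  fixes f :: "complex ^ ('m::finite + 'n::finite) \<Rightarrow> complex"
  assumes "has_power_series f (join_vec a 0) C"
  obtains r where "r > 0" "\<And>b. b \<in> polydisk (\<lambda>_. r) \<Longrightarrow>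
    \<exists>c. has_power_series (\<lambda>x. f (join_vec (a + b) x)) 0 c \<and>
      (\<forall>\<alpha>. ((\<lambda>\<beta>. C (case_sum \<beta> \<alpha>) * monomial b \<beta>) has_sum c \<alpha>) UNIV)"
proof -
  obtain r where "r > 0"
    and r: "\<And>z. z \<in> polydisk (\<lambda>_. r) \<Longrightarrow>
      ((\<lambda>\<alpha>. C \<alpha> * monomial z \<alpha>) has_sum f (join_vec a 0 + z)) UNIV"
    using assms unfolding has_power_series_def by blast
  obtain s where s: "weight_point s \<in> polydisk (\<lambda>_::'n. r)"
    using weight_point_small[OF \<open>r > 0\<close>] .
  have "\<exists>c. has_power_series (\<lambda>x. f (join_vec (a + b) x)) 0 c \<and>
      (\<forall>\<alpha>. ((\<lambda>\<beta>. C (case_sum \<beta> \<alpha>) * monomial b \<beta>) has_sum c \<alpha>) UNIV)"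
    if b: "b \<in> polydisk (\<lambda>_. r)" for b
  proof -
    define F where "F x = (\<lambda>(\<alpha>, \<beta>). C (case_sum \<beta> \<alpha>) * monomial b \<beta> * monomial x \<alpha>)" for x
    have double: "(F x has_sum f (join_vec (a + b) x)) (UNIV \<times> UNIV)"
      if x: "x \<in> polydisk (\<lambda>_. r)" for x
    proof -
      let ?z = "join_vec b x"
      have "(F x has_sum f (join_vec (a + b) x)) (UNIV \<times> UNIV) \<longleftrightarrow>
          ((\<lambda>\<Gamma>. C \<Gamma> * monomial ?z \<Gamma>) has_sum f (join_vec (a + b) x)) UNIV"
      proof (rule has_sum_reindex_bij_witness[where i = "\<lambda>\<Gamma>. (\<Gamma> \<circ> Inr, \<Gamma> \<circ> Inl)"
            and j = "\<lambda>(\<alpha>, \<beta>). case_sum \<beta> \<alpha>"])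
        show "(case (\<Gamma> \<circ> Inr, \<Gamma> \<circ> Inl) of (\<alpha>, \<beta>) \<Rightarrow> case_sum \<beta> \<alpha>) = \<Gamma>" for \<Gamma> :: "'m + 'n \<Rightarrow> nat"
          by (auto simp: fun_eq_iff split: sum.split)
      qed (auto simp: F_def monomial_join_vec mult.assoc fun_eq_iff)
      moreover have "((\<lambda>\<Gamma>. C \<Gamma> * monomial ?z \<Gamma>) has_sum f (join_vec (a + b) x)) UNIV"
        using r[of ?z] b x by (simp add: join_vec_in_polydisk join_vec_add)
      ultimately show ?thesis by blast
    qed
    have "(\<lambda>\<beta>. C (case_sum \<beta> \<alpha>) * monomial b \<beta>) summable_on UNIV" for \<alpha>
    proof -
      have "F (weight_point s) summable_on (UNIV \<times> UNIV)"
        using double[OF s] unfolding summable_on_def by blast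
      then have "(\<lambda>p. F (weight_point s) p) summable_on (\<lambda>\<beta>. (\<alpha>, \<beta>)) ` UNIV"
        by (rule summable_on_subset_banach) auto
      then have "(\<lambda>\<beta>. F (weight_point s) (\<alpha>, \<beta>)) summable_on UNIV"
        by (subst (asm) summable_on_reindex) (auto simp: inj_on_def o_def)
      moreover have "monomial (weight_point s) \<alpha> \<noteq> 0"
        using weight_pos[of \<alpha>] by (simp add: monomial_weight_point)
      ultimately show ?thesis by (simp add: F_def summable_on_cmult_left')
    qed
    then have inner: "((\<lambda>\<beta>. C (case_sum \<beta> \<alpha>) * monomial b \<beta>) has_sum
        (\<Sum>\<^sub>\<infinity>\<beta>. C (case_sum \<beta> \<alpha>) * monomial b \<beta>)) UNIV" for \<alpha> by (rule has_sum_infsum)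
    let ?c = "\<lambda>\<alpha>. \<Sum>\<^sub>\<infinity>\<beta>. C (case_sum \<beta> \<alpha>) * monomial b \<beta>"
    have "((\<lambda>\<alpha>. ?c \<alpha> * monomial x \<alpha>) has_sum f (join_vec (a + b) (0 + x))) UNIV"
      if x: "x \<in> polydisk (\<lambda>_. r)" for x
    proof (rule has_sum_SigmaD)
      show "(F x has_sum f (join_vec (a + b) (0 + x))) (Sigma UNIV (\<lambda>_. UNIV))"
        using double[OF x] by simp
      show "((\<lambda>\<beta>. F x (\<alpha>, \<beta>)) has_sum ?c \<alpha> * monomial x \<alpha>) UNIV" for \<alpha>
        unfolding F_def using has_sum_cmult_left[OF inner] by simp
    qed
    then have "has_power_series (\<lambda>x. f (join_vec (a + b) x)) 0 ?c"
      unfolding has_power_series_def using \<open>r > 0\<close> by blast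
    then show ?thesis using inner by blast
  qed
  with \<open>r > 0\<close> show ?thesis using that by blast
qed

text \<open>For fixed \<open>\<alpha>\<close> the inner sum of the double series is a power series in the parameter.\<close>

lemma has_power_series_coefficient:
  fixes f :: "complex ^ ('m::finite + 'n::finite) \<Rightarrow> complex"
  assumes "has_power_series f (join_vec a 0) C" "open A" "a \<in> A"
    and w: "\<And>a. a \<in> A \<Longrightarrow> has_power_series (\<lambda>x. f (join_vec a x)) 0 (w a)"
  shows "has_power_series (\<lambda>a. w a \<alpha>) a (\<lambda>\<beta>. C (case_sum \<beta> \<alpha>))"
proof -
  obtain r where r: "r > 0" "\<And>b. b \<in> polydisk (\<lambda>_. r) \<Longrightarrow>
    \<exists>c. has_power_series (\<lambda>x. f (join_vec (a + b) x)) 0 c \<and>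
      (\<forall>\<alpha>. ((\<lambda>\<beta>. C (case_sum \<beta> \<alpha>) * monomial b \<beta>) has_sum c \<alpha>) UNIV)"
    using slice_power_series[OF assms(1)] by blast
  obtain q where q: "q > 0" "\<forall>b\<in>polydisk (\<lambda>_. q). a + b \<in> A"
    by (rule open_contains_polydisk[OF assms(2,3)])
  have "((\<lambda>\<beta>. C (case_sum \<beta> \<alpha>) * monomial b \<beta>) has_sum w (a + b) \<alpha>) UNIV"
    if b: "b \<in> polydisk (\<lambda>_. min r q)" for b
  proof -
    have "b \<in> polydisk (\<lambda>_. r)" "b \<in> polydisk (\<lambda>_. q)" using b by (auto simp: polydisk_def)
    then obtain c where c: "has_power_series (\<lambda>x. f (join_vec (a + b) x)) 0 c"
      "((\<lambda>\<beta>. C (case_sum \<beta> \<alpha>) * monomial b \<beta>) has_sum c \<alpha>) UNIV" and "a + b \<in> A"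
      using r(2) q(2) by blast
    then show ?thesis using has_power_series_unique[OF c(1) w] by simp
  qed
  then show ?thesis
    unfolding has_power_series_def using r(1) q(1) by (intro exI[of _ "min r q"]) auto
qed

lemma has_power_series_shift:
  assumes "has_power_series g 0 c"
  shows "has_power_series (\<lambda>x. monomial x \<gamma> * g x) 0 (shift \<gamma> c)"
proof -
  obtain r where "r > 0"
    and "\<And>z. z \<in> polydisk (\<lambda>_. r) \<Longrightarrow> ((\<lambda>\<alpha>. c \<alpha> * monomial z \<alpha>) has_sum g (0 + z)) UNIV"
    using assms unfolding has_power_series_def by blast
  then show ?thesis
    unfolding has_power_series_def by (intro exI[of _ r]) (simp add: has_sum_shift)
qed

lemma has_power_series_cmult:
  assumes "has_power_series g p c"
  shows "has_power_series (\<lambda>x. k * g x) p (\<lambda>\<alpha>. k * c \<alpha>)"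
  using has_power_series_mult[OF has_power_series_const assms, of k] by (simp add: series_const)

lemma locally_analytic_coordinate: "locally_analytic U (\<lambda>z. z $ k)"
  unfolding locally_analytic_def
proof
  fix q :: "complex ^ 'a" assume "q \<in> U"
  define e where "e = (\<lambda>j. if j = k then 1 else 0 :: nat)"
  have e: "monomial z e = z $ k" for z :: "complex ^ 'a"
  proof -
    have "monomial z e = (\<Prod>j\<in>UNIV. if j = k then z $ k else 1)"
      unfolding monomial_def e_def by (intro prod.cong) auto
    then show ?thesis by simp
  qed
  have "((\<lambda>\<alpha>. monomial_series e \<alpha> * monomial z \<alpha>) has_sum z $ k) UNIV" for z :: "complex ^ 'a"
    by (rule has_sum_finite_neutralI[of "{e}"]) (auto simp: monomial_series_def e)
  then have "has_power_series (\<lambda>z. z $ k - q $ k) q (monomial_series e)"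
    unfolding has_power_series_def by (intro exI[of _ 1]) simp
  from has_power_series_add[OF this has_power_series_const[of "q $ k"]]
  show "\<exists>c. has_power_series (\<lambda>z. z $ k) q c" by auto
qed

lemma locally_analytic_power: "locally_analytic U f \<Longrightarrow> locally_analytic U (\<lambda>z. f z ^ n)"
  by (induction n) (auto intro: locally_analytic_const locally_analytic_mult)

lemma locally_analytic_parameter:
  fixes f :: "complex ^ 'm::finite \<Rightarrow> complex" and X :: "(complex ^ 'n::finite) set"
  assumes "locally_analytic A f"
  shows "locally_analytic (vec_Times A X) (\<lambda>z. f (\<chi> i. z $ Inl i))"
  unfolding locally_analytic_def
proof
  fix q :: "complex ^ ('m + 'n)" assume "q \<in> vec_Times A X"
  then have "(\<chi> i. q $ Inl i) \<in> A" by (auto simp: vec_Times_def join_vec_def)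
  then obtain c r where "r > 0"
    and r: "\<And>z. z \<in> polydisk (\<lambda>_. r) \<Longrightarrow>
      ((\<lambda>\<alpha>. c \<alpha> * monomial z \<alpha>) has_sum f ((\<chi> i. q $ Inl i) + z)) UNIV"
    using assms unfolding locally_analytic_def has_power_series_def by blast
  let ?C = "\<lambda>\<Gamma>. if \<Gamma> \<circ> Inr = (\<lambda>_::'n. 0) then c (\<Gamma> \<circ> Inl) else 0"
  have "((\<lambda>\<Gamma>. ?C \<Gamma> * monomial z \<Gamma>) has_sum f (\<chi> i. (q + z) $ Inl i)) UNIV"
    if z: "z \<in> polydisk (\<lambda>_. r)" for z
  proof -
    let ?b = "\<chi> i. z $ Inl i" and ?x = "\<chi> j. z $ Inr j"
    have zjoin: "z = join_vec ?b ?x" by (auto simp: join_vec_def vec_eq_iff split: sum.split)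
    have mono: "monomial z (case_sum \<beta> (\<lambda>_. 0)) = monomial ?b \<beta>" for \<beta>
      by (subst zjoin) (simp add: monomial_join_vec monomial_zero)
    have "?b \<in> polydisk (\<lambda>_. r)" using z zjoin join_vec_in_polydisk by metis
    from r[OF this] have "((\<lambda>\<beta>. c \<beta> * monomial ?b \<beta>) has_sum f (\<chi> i. (q + z) $ Inl i)) UNIV"
      by (simp add: plus_vec_def)
    also have "((\<lambda>\<beta>. c \<beta> * monomial ?b \<beta>) has_sum f (\<chi> i. (q + z) $ Inl i)) UNIV \<longleftrightarrow>
        ((\<lambda>\<Gamma>. ?C \<Gamma> * monomial z \<Gamma>) has_sum f (\<chi> i. (q + z) $ Inl i)) {\<Gamma>. \<Gamma> \<circ> Inr = (\<lambda>_. 0)}"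
    proof (rule has_sum_reindex_bij_witness[where i = "\<lambda>\<Gamma>. \<Gamma> \<circ> Inl" and j = "\<lambda>\<beta>. case_sum \<beta> (\<lambda>_. 0)"])
      show "case_sum (\<Gamma> \<circ> Inl) (\<lambda>_. 0) = \<Gamma>" if "\<Gamma> \<in> {\<Gamma>. \<Gamma> \<circ> Inr = (\<lambda>_. 0)}" for \<Gamma> :: "'m + 'n \<Rightarrow> nat"
      proof
        fix k show "case_sum (\<Gamma> \<circ> Inl) (\<lambda>_. 0) k = \<Gamma> k"
          using that by (cases k) (auto simp: fun_eq_iff)
      qed
    qed (auto simp: mono case_sum_o_inj)
    also have "\<dots> \<longleftrightarrow> ((\<lambda>\<Gamma>. ?C \<Gamma> * monomial z \<Gamma>) has_sum f (\<chi> i. (q + z) $ Inl i)) UNIV"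
      by (rule has_sum_cong_neutral) auto
    finally show ?thesis .
  qed
  then show "\<exists>c. has_power_series (\<lambda>z. f (\<chi> i. z $ Inl i)) q c"
    unfolding has_power_series_def by (intro exI[of _ ?C] exI[of _ r]) (simp add: \<open>r > 0\<close>)
qed

text \<open>The expansions at \<open>x = 0\<close> of the elements of \<open>J\<close>. They are constrained on \<open>A\<close> only, with arbitrary
  values elsewhere.\<close>

definition coefficient_functions ::
    "(complex ^ 'm::finite) set \<Rightarrow> (complex ^ ('m + 'n::finite) \<Rightarrow> complex) set
      \<Rightarrow> (complex ^ 'm \<Rightarrow> ('n \<Rightarrow> nat) \<Rightarrow> complex) set"
  where "coefficient_functions A J =
    {w. \<exists>f\<in>J. \<forall>a\<in>A. has_power_series (\<lambda>x. f (join_vec a x)) 0 (w a)}"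

locale parametrized_ideal =
  fixes A :: "(complex ^ 'm::finite) set" and X :: "(complex ^ 'n::finite) set"
    and J :: "(complex ^ ('m + 'n) \<Rightarrow> complex) set"
  assumes open_A: "open A" and open_X: "open X" and zero_in_X: "0 \<in> X"
    and open_AX: "open (vec_Times A X)"
    and ideal_J: "ideal J (analytic_functions (vec_Times A X))"
begin

lemma join_vec_in_Times: "a \<in> A \<Longrightarrow> x \<in> X \<Longrightarrow> join_vec a x \<in> vec_Times A X"
  by (auto simp: vec_Times_def)

lemma J_locally_analytic: "f \<in> J \<Longrightarrow> locally_analytic (vec_Times A X) f"
  using ideal.Icarr[OF ideal_J] carrier_analytic_functions_iff by blast

lemma slice_exists:
  assumes "f \<in> J" "a \<in> A"
  shows "\<exists>c. has_power_series (\<lambda>x. f (join_vec a x)) 0 c"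
proof -
  obtain C where "has_power_series f (join_vec a 0) C"
    using J_locally_analytic[OF assms(1)] join_vec_in_Times[OF assms(2) zero_in_X]
    by (auto simp: locally_analytic_def)
  then obtain r where r: "r > 0" "\<And>b. b \<in> polydisk (\<lambda>_. r) \<Longrightarrow>
    \<exists>c. has_power_series (\<lambda>x. f (join_vec (a + b) x)) 0 c \<and>
      (\<forall>\<alpha>. ((\<lambda>\<beta>. C (case_sum \<beta> \<alpha>) * monomial b \<beta>) has_sum c \<alpha>) UNIV)"
    using slice_power_series by blast
  have "0 \<in> polydisk (\<lambda>_::'m. r)" using r(1) by (simp add: polydisk_def)
  from r(2)[OF this] show ?thesis by auto
qed

lemma slice_cong:
  assumes "has_power_series g 0 c" "a \<in> A" "\<And>x. x \<in> X \<Longrightarrow> g x = f (join_vec a x)"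
  shows "has_power_series (\<lambda>x. f (join_vec a x)) 0 c"
  using has_power_series_cong[OF assms(1) open_X zero_in_X assms(3)] by simp

sublocale coefficient_family A "coefficient_functions A J"
proof
  show "open A" by (rule open_A)
next
  fix w \<alpha> assume "w \<in> coefficient_functions A J"
  then obtain f where f: "f \<in> J" "\<And>a. a \<in> A \<Longrightarrow> has_power_series (\<lambda>x. f (join_vec a x)) 0 (w a)"
    by (auto simp: coefficient_functions_def)
  show "locally_analytic A (\<lambda>a. w a \<alpha>)"
    unfolding locally_analytic_def
  proof
    fix a assume a: "a \<in> A"
    obtain C where "has_power_series f (join_vec a 0) C"
      using J_locally_analytic[OF f(1)] join_vec_in_Times[OF a zero_in_X]
      by (auto simp: locally_analytic_def)
    from has_power_series_coefficient[OF this open_A a f(2)]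
    show "\<exists>c. has_power_series (\<lambda>a. w a \<alpha>) a c" by blast
  qed
next
  fix v w assume "v \<in> coefficient_functions A J" "w \<in> coefficient_functions A J"
  then obtain f g where fg: "f \<in> J" "\<And>a. a \<in> A \<Longrightarrow> has_power_series (\<lambda>x. f (join_vec a x)) 0 (v a)"
    "g \<in> J" "\<And>a. a \<in> A \<Longrightarrow> has_power_series (\<lambda>x. g (join_vec a x)) 0 (w a)"
    unfolding coefficient_functions_def by blast
  have "(\<lambda>z\<in>vec_Times A X. f z + g z) \<in> J"
    using additive_subgroup.a_closed[OF ideal.axioms(1)[OF ideal_J] fg(1,3)]
    by (simp add: analytic_functions_def)
  moreover have "has_power_series (\<lambda>x. (\<lambda>z\<in>vec_Times A X. f z + g z) (join_vec a x)) 0 (\<lambda>\<alpha>. v a \<alpha> + w a \<alpha>)"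
    if a: "a \<in> A" for a
    by (rule slice_cong[OF has_power_series_add[OF fg(2)[OF a] fg(4)[OF a]] a])
       (simp add: join_vec_in_Times a)
  ultimately show "(\<lambda>a \<alpha>. v a \<alpha> + w a \<alpha>) \<in> coefficient_functions A J"
    unfolding coefficient_functions_def by blast
next
  fix \<phi> w assume \<phi>: "locally_analytic A \<phi>" and "w \<in> coefficient_functions A J"
  then obtain f where f: "f \<in> J" "\<And>a. a \<in> A \<Longrightarrow> has_power_series (\<lambda>x. f (join_vec a x)) 0 (w a)"
    by (auto simp: coefficient_functions_def)
  let ?h = "\<lambda>z\<in>vec_Times A X. (\<lambda>z\<in>vec_Times A X. \<phi> (\<chi> i. z $ Inl i)) z * f z"
  have "(\<lambda>z\<in>vec_Times A X. \<phi> (\<chi> i. z $ Inl i)) \<in> carrier (analytic_functions (vec_Times A X))"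
    by (rule restrict_in_carrier[OF open_AX locally_analytic_parameter[OF \<phi>]])
  from ideal.I_l_closed[OF ideal_J f(1) this] have "?h \<in> J"
    by (simp add: analytic_functions_def)
  moreover have "has_power_series (\<lambda>x. ?h (join_vec a x)) 0 (\<lambda>\<alpha>. \<phi> a * w a \<alpha>)" if a: "a \<in> A" for a
    by (rule slice_cong[OF has_power_series_cmult[OF f(2)[OF a]] a])
       (simp add: join_vec_in_Times a, simp add: join_vec_def)
  ultimately show "(\<lambda>a \<alpha>. \<phi> a * w a \<alpha>) \<in> coefficient_functions A J"
    unfolding coefficient_functions_def by blast
next
  fix \<gamma> w assume "w \<in> coefficient_functions A J"
  then obtain f where f: "f \<in> J" "\<And>a. a \<in> A \<Longrightarrow> has_power_series (\<lambda>x. f (join_vec a x)) 0 (w a)"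
    by (auto simp: coefficient_functions_def)
  let ?m = "\<lambda>z :: complex ^ ('m + 'n). \<Prod>j\<in>UNIV. (z $ Inr j) ^ \<gamma> j"
  let ?h = "\<lambda>z\<in>vec_Times A X. (\<lambda>z\<in>vec_Times A X. ?m z) z * f z"
  have "locally_analytic (vec_Times A X) ?m"
    by (intro locally_analytic_prod locally_analytic_power locally_analytic_coordinate) simp
  from ideal.I_l_closed[OF ideal_J f(1) restrict_in_carrier[OF open_AX this]] have "?h \<in> J"
    by (simp add: analytic_functions_def)
  moreover have "has_power_series (\<lambda>x. ?h (join_vec a x)) 0 (shift \<gamma> (w a))" if a: "a \<in> A" for a
    by (rule slice_cong[OF has_power_series_shift[OF f(2)[OF a]] a])
       (simp add: join_vec_in_Times a, simp add: join_vec_def monomial_def)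
  ultimately show "(\<lambda>a. shift \<gamma> (w a)) \<in> coefficient_functions A J"
    unfolding coefficient_functions_def by blast
next
  have "(\<lambda>z\<in>vec_Times A X. 0) \<in> J"
    using additive_subgroup.zero_closed[OF ideal.axioms(1)[OF ideal_J]]
    by (simp add: analytic_functions_def)
  moreover have const: "const_series 0 = (\<lambda>_ :: 'n \<Rightarrow> nat. 0)" by (auto simp: const_series_def)
  have "has_power_series (\<lambda>x. (\<lambda>z\<in>vec_Times A X. 0) (join_vec a x)) 0 (\<lambda>_. 0)"
    if a: "a \<in> A" for a
    unfolding const[symmetric]
    by (rule slice_cong[OF has_power_series_const a]) (simp add: join_vec_in_Times a)
  ultimately show "(\<lambda>_ _. 0) \<in> coefficient_functions A J"
    unfolding coefficient_functions_def by blast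
qed

lemma germs_eq_coefficients:
  assumes "a \<in> A"
  shows "{c. \<exists>f\<in>specialize X J a. has_power_series f 0 c} = (\<lambda>w. w a) ` coefficient_functions A J"
proof (intro equalityI subsetI)
  fix c assume "c \<in> {c. \<exists>f\<in>specialize X J a. has_power_series f 0 c}"
  then obtain f where f: "f \<in> J" "has_power_series (\<lambda>x\<in>X. f (join_vec a x)) 0 c"
    by (auto simp: specialize_def)
  have c: "has_power_series (\<lambda>x. f (join_vec a x)) 0 c"
    by (rule slice_cong[OF f(2) assms]) simp
  obtain w where w: "\<And>a. a \<in> A \<Longrightarrow> has_power_series (\<lambda>x. f (join_vec a x)) 0 (w a)"
    using slice_exists[OF f(1)] by metis
  then have "w \<in> coefficient_functions A J" using f(1) by (auto simp: coefficient_functions_def)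
  moreover have "c = w a" by (rule has_power_series_unique[OF c w[OF assms]])
  ultimately show "c \<in> (\<lambda>w. w a) ` coefficient_functions A J" by blast
next
  fix c assume "c \<in> (\<lambda>w. w a) ` coefficient_functions A J"
  then obtain w f where w: "c = w a" "f \<in> J" "has_power_series (\<lambda>x. f (join_vec a x)) 0 (w a)"
    using assms by (auto simp: coefficient_functions_def)
  have "has_power_series (\<lambda>x\<in>X. f (join_vec a x)) 0 c"
    unfolding w(1) by (rule has_power_series_cong[OF w(3) open_X zero_in_X]) simp
  then show "c \<in> {c. \<exists>f\<in>specialize X J a. has_power_series f 0 c}"
    using w(2) by (auto simp: specialize_def)
qed

lemma sum_closed:
  assumes "finite S" "\<And>\<gamma>. \<gamma> \<in> S \<Longrightarrow> v \<gamma> \<in> coefficient_functions A J"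
  shows "(\<lambda>a \<alpha>. \<Sum>\<gamma>\<in>S. v \<gamma> a \<alpha>) \<in> coefficient_functions A J"
  using assms
proof induction
  case empty
  then show ?case using zero by simp
next
  case (insert \<gamma> S)
  from add[OF insert.prems[of \<gamma>] insert.IH] insert show ?case by simp
qed

text \<open>The specializations of the elements of \<open>J\<close> need not form an ideal of the ring of convergent power
  series, because a multiplier need not come from a function on \<open>A \<times> X\<close>. Up to any given degree, however,
  a multiplier agrees with a polynomial in \<open>x\<close>, by which \<open>J\<close> may be multiplied. Hence the series \<open>N\<close> that
  agree to every order with some specialized element form an ideal.\<close>

lemma germ_ideal_truncation:
  assumes a: "a \<in> A"
  shows "ideal (germ_ideal (specialize X J a)) conv_series"
    and "w \<in> coefficient_functions A J \<Longrightarrow> w a \<in> germ_ideal (specialize X J a)"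
    and "c \<in> germ_ideal (specialize X J a) \<Longrightarrow>
      \<exists>w\<in>coefficient_functions A J. \<forall>\<alpha>. mdeg \<alpha> \<le> r \<longrightarrow> c \<alpha> = w a \<alpha>"
proof -
  let ?R = "conv_series :: (('n \<Rightarrow> nat) \<Rightarrow> complex) ring"
  let ?W = "coefficient_functions A J"
  interpret R: cring ?R by (rule cring_conv_series)
  let ?G = "(\<lambda>w. w a) ` ?W"
  have germ: "germ_ideal (specialize X J a) = Idl\<^bsub>?R\<^esub> ?G"
    unfolding germ_ideal_def germs_eq_coefficients[OF a] ..
  have G: "?G \<subseteq> carrier ?R"
    using a unfolding coefficient_functions_def carrier_conv_series_iff subset_iff by blast
  show ideal: "ideal (germ_ideal (specialize X J a)) conv_series"
    unfolding germ by (rule R.genideal_ideal[OF G])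
  show "w \<in> ?W \<Longrightarrow> w a \<in> germ_ideal (specialize X J a)"
    unfolding germ using R.genideal_self[OF G] by blast
  define N where "N = {c \<in> carrier ?R. \<forall>r. \<exists>w\<in>?W. \<forall>\<alpha>. mdeg \<alpha> \<le> r \<longrightarrow> c \<alpha> = w a \<alpha>}"
  have mult_N: "u \<otimes>\<^bsub>?R\<^esub> c \<in> N" if u: "u \<in> carrier ?R" and c: "c \<in> N" for u c
  proof -
    have "\<exists>w\<in>?W. \<forall>\<alpha>. mdeg \<alpha> \<le> r \<longrightarrow> (u \<otimes>\<^bsub>?R\<^esub> c) \<alpha> = w a \<alpha>" for r
    proof -
      obtain w where w: "w \<in> ?W" "\<And>\<alpha>. mdeg \<alpha> \<le> r \<Longrightarrow> c \<alpha> = w a \<alpha>"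
        using c unfolding N_def by blast
      \<comment> \<open>The product of \<open>w\<close> with the truncation of the multiplier \<open>u\<close> at degree \<open>r\<close>.\<close>
      let ?v = "\<lambda>a \<alpha>. \<Sum>\<gamma> | mdeg \<gamma> \<le> r. u \<gamma> * shift \<gamma> (w a) \<alpha>"
      have "?v \<in> ?W"
        by (intro sum_closed finite_mdeg_le mult[OF locally_analytic_const] shift w(1))
      moreover have "(u \<otimes>\<^bsub>?R\<^esub> c) \<alpha> = ?v a \<alpha>" if \<alpha>: "mdeg \<alpha> \<le> r" for \<alpha>
      proof -
        have le: "mdeg \<gamma> \<le> r" "mdeg (\<lambda>i. \<alpha> i - \<gamma> i) \<le> r" if "\<gamma> \<le> \<alpha>" for \<gamma>
          using mdeg_mono[OF that] mdeg_mono[of "\<lambda>i. \<alpha> i - \<gamma> i" \<alpha>] \<alpha> by (auto simp: le_fun_def)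
        have "(u \<otimes>\<^bsub>?R\<^esub> c) \<alpha> = (\<Sum>\<gamma> | \<gamma> \<le> \<alpha>. u \<gamma> * shift \<gamma> (w a) \<alpha>)"
          unfolding conv_series_simps(2)
          by (intro sum.cong refl) (simp add: shift_def w(2) le)
        also have "\<dots> = ?v a \<alpha>"
          by (rule sum.mono_neutral_left[OF finite_mdeg_le]) (auto simp: le shift_def)
        finally show ?thesis .
      qed
      ultimately show ?thesis by (intro bexI[of _ ?v]) simp_all
    qed
    then show ?thesis using R.m_closed[OF u] c by (simp add: N_def)
  qed
  have "ideal N ?R"
  proof (rule idealI[OF R.ring_axioms])
    show "subgroup N (add_monoid ?R)"
    proof (rule R.add.subgroupI)
      show "N \<subseteq> carrier ?R" by (auto simp: N_def)
      have "(\<lambda>_. 0) \<in> N"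
        using zero R.zero_closed by (auto simp: N_def conv_series_simps(3))
      then show "N \<noteq> {}" by blast
      fix c assume c: "c \<in> N"
      have cR: "c \<in> carrier ?R" using c by (simp only: N_def mem_Collect_eq)
      have "const_series (- 1) \<otimes>\<^bsub>?R\<^esub> c \<in> N" by (rule mult_N[OF const_series_closed c])
      moreover have "const_series (- 1) \<otimes>\<^bsub>?R\<^esub> c = \<ominus>\<^bsub>?R\<^esub> c"
        unfolding const_series_mult conv_series_uminus[OF cR] by (simp only: mult_minus1)
      ultimately show "\<ominus>\<^bsub>?R\<^esub> c \<in> N" by (simp only:)
      fix d assume d: "d \<in> N"
      have "\<exists>w\<in>?W. \<forall>\<alpha>. mdeg \<alpha> \<le> r \<longrightarrow> c \<alpha> + d \<alpha> = w a \<alpha>" for r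
      proof -
        obtain v where v: "v \<in> ?W" "\<forall>\<alpha>. mdeg \<alpha> \<le> r \<longrightarrow> c \<alpha> = v a \<alpha>"
          using c unfolding N_def by blast
        obtain w where w: "w \<in> ?W" "\<forall>\<alpha>. mdeg \<alpha> \<le> r \<longrightarrow> d \<alpha> = w a \<alpha>"
          using d unfolding N_def by blast
        show ?thesis
          by (rule bexI[of _ "\<lambda>a \<alpha>. v a \<alpha> + w a \<alpha>"]) (use v(2) w(2) add[OF v(1) w(1)] in simp_all)
      qed
      moreover have "(\<lambda>\<alpha>. c \<alpha> + d \<alpha>) \<in> carrier ?R"
        using R.a_closed[of c d] c d by (simp add: N_def conv_series_simps(1))
      ultimately show "c \<oplus>\<^bsub>?R\<^esub> d \<in> N"
        by (simp add: N_def conv_series_simps(1))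
    qed
  next
    fix c u assume "c \<in> N" "u \<in> carrier ?R"
    then show "u \<otimes>\<^bsub>?R\<^esub> c \<in> N" by (intro mult_N)
    then show "c \<otimes>\<^bsub>?R\<^esub> u \<in> N"
      using R.m_comm[of c u] \<open>c \<in> N\<close> \<open>u \<in> carrier ?R\<close> by (simp add: N_def)
  qed
  moreover have "?G \<subseteq> N" using G by (auto simp: N_def)
  ultimately have "germ_ideal (specialize X J a) \<subseteq> N" unfolding germ by (rule R.genideal_minimal)
  then show "c \<in> germ_ideal (specialize X J a) \<Longrightarrow>
      \<exists>w\<in>?W. \<forall>\<alpha>. mdeg \<alpha> \<le> r \<longrightarrow> c \<alpha> = w a \<alpha>"
    unfolding N_def by blast
qed

text \<open>Initial exponents are visible in a truncation, so the generated ideal has no more of them than the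
  specialized elements.\<close>

lemma initial_exponents_germ_ideal:
  assumes a: "a \<in> A"
  shows "initial_exponents graded_weight (germ_ideal (specialize X J a)) = diagram a"
proof (intro equalityI subsetI)
  fix \<alpha> assume "\<alpha> \<in> diagram a"
  then show "\<alpha> \<in> initial_exponents graded_weight (germ_ideal (specialize X J a))"
    using germ_ideal_truncation(2)[OF a] by (auto simp: diagram_def initial_exponents_def)
next
  fix \<alpha> assume "\<alpha> \<in> initial_exponents graded_weight (germ_ideal (specialize X J a))"
  then obtain c where c: "c \<in> germ_ideal (specialize X J a)" "lead graded_weight c \<alpha>"
    by (auto simp: initial_exponents_def)
  obtain w where w: "w \<in> coefficient_functions A J" "\<And>\<beta>. mdeg \<beta> \<le> mdeg \<alpha> \<Longrightarrow> c \<beta> = w a \<beta>"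
    using germ_ideal_truncation(3)[OF a c(1), of "mdeg \<alpha>"] by blast
  have "lead graded_weight (w a) \<alpha>"
    unfolding lead_def
  proof (intro conjI allI impI)
    show "w a \<alpha> \<noteq> 0" using c(2) w(2)[of \<alpha>] by (simp add: lead_def)
    fix \<beta> :: "'n \<Rightarrow> nat" assume \<beta>: "graded_weight \<beta> < graded_weight \<alpha>"
    then have "mdeg \<beta> \<le> mdeg \<alpha>" by (auto simp: graded_weight_less_iff)
    then show "w a \<beta> = 0" using c(2) w(2)[of \<beta>] \<beta> by (simp add: lead_def)
  qed
  then show "\<alpha> \<in> diagram a" using w(1) by (auto simp: diagram_def initial_exponents_def)
qed

lemma HSF_germ_ideal:
  "a \<in> A \<Longrightarrow> HSF (germ_ideal (specialize X J a)) r = hilbert_count (diagram a) r"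
  using HSF_eq_hilbert_count[OF germ_ideal_truncation(1)] by (simp add: initial_exponents_germ_ideal)

end

section \<open>Constructibility\<close>

lemma HSP_eqI:
  assumes "\<forall>\<^sub>F r in sequentially. poly P (of_nat r) = of_nat (HSF I r)"
  shows "HSP I = P"
  unfolding HSP_def
proof (rule the_equality)
  show "\<exists>r0. \<forall>r\<ge>r0. poly P (of_nat r) = of_nat (HSF I r)"
    using assms by (simp add: eventually_sequentially)
  fix Q :: "rat poly" assume "\<exists>r0. \<forall>r\<ge>r0. poly Q (of_nat r) = of_nat (HSF I r)"
  then have "\<forall>\<^sub>F r in sequentially. poly Q (of_nat r) = of_nat (HSF I r)"
    by (simp add: eventually_sequentially)
  with assms have eq: "\<forall>\<^sub>F r in sequentially. poly (Q - P) (of_nat r) = 0"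
    by eventually_elim simp
  show "Q = P"
  proof (cases "Q - P" rule: rat_poly_trichotomy)
    case pos
    with eq have "\<forall>\<^sub>F r in sequentially. False" by eventually_elim simp
    then show ?thesis by simp
  next
    case neg
    with eq have "\<forall>\<^sub>F r in sequentially. False" by eventually_elim simp
    then show ?thesis by simp
  qed simp
qed

context parametrized_ideal
begin

abbreviation hilbert_polynomial :: "complex ^ 'm \<Rightarrow> rat poly"
  where "hilbert_polynomial a \<equiv> HSP (germ_ideal (specialize X J a))"

lemma hilbert_polynomial:
  assumes "a \<in> A"
  shows "\<forall>\<^sub>F r in sequentially.
    poly (hilbert_polynomial a) (of_nat r) = of_nat (hilbert_count (diagram a) r)"
proof -
  have "eventually_polynomial (\<lambda>r. of_nat (hilbert_count (diagram a) r))"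
    by (rule eventually_polynomial_hilbert_count) (rule diagram_upward_closed)
  then obtain P :: "rat poly" where P: "\<forall>\<^sub>F r in sequentially. poly P (of_nat r) = of_nat (hilbert_count (diagram a) r)"
    unfolding eventually_polynomial_def by blast
  then have "hilbert_polynomial a = P"
    by (intro HSP_eqI) (simp add: HSF_germ_ideal[OF assms])
  with P show ?thesis by simp
qed

text \<open>For \<open>S\<close> the nonnegative and the positive numbers, these are the parameters with a Hilbert polynomial
  at least \<open>P\<close> and greater than \<open>P\<close>. Near a point, the finitely many diagrams allow one \<open>r\<close> at which the
  membership of the difference in \<open>S\<close> is already the eventual one; the condition at this \<open>r\<close> is a lower bound \<open>d\<close> on
  the Hilbert-Samuel function.\<close>

lemma closed_analytic_superlevel:
  fixes S :: "rat set" and P :: "rat poly"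
  assumes T: "\<And>x. x \<in> S \<longleftrightarrow> 0 < x \<or> x = 0 \<and> b"
  shows "closed_analytic_in A {a \<in> A. \<forall>\<^sub>F r in sequentially. poly (hilbert_polynomial a - P) (of_nat r) \<in> S}"
    (is "closed_analytic_in A ?Z")
proof (rule closed_analytic_in_if_locally_zero_set[OF open_A])
  show "?Z \<subseteq> A" by blast
  fix a assume a: "a \<in> A"
  let ?in = "\<lambda>D r. of_nat (hilbert_count D r) - poly P (of_nat r) \<in> S"
  obtain \<D> where \<D>: "finite \<D>" "\<forall>\<^sub>F z in nhds a. z \<in> A \<longrightarrow> diagram z \<in> \<D>"
    using finitely_many_diagrams[OF a] by blast
  have iff: "z \<in> ?Z \<longleftrightarrow> (\<forall>\<^sub>F r in sequentially. ?in (diagram z) r)" if z: "z \<in> A" for z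
  proof -
    have "(\<forall>\<^sub>F r in sequentially. poly (hilbert_polynomial z - P) (of_nat r) \<in> S) \<longleftrightarrow>
        (\<forall>\<^sub>F r in sequentially. ?in (diagram z) r)"
      by (rule eventually_subst) (use hilbert_polynomial[OF z] in \<open>eventually_elim, simp\<close>)
    then show ?thesis using z by simp
  qed
  have stable: "\<forall>\<^sub>F r in sequentially. z \<in> ?Z \<longleftrightarrow> ?in (diagram z) r" if z: "z \<in> A" for z
  proof -
    let ?R = "hilbert_polynomial z - P"
    have val: "\<forall>\<^sub>F r in sequentially. poly ?R (of_nat r) = of_nat (hilbert_count (diagram z) r) - poly P (of_nat r)"
      using hilbert_polynomial[OF z] by eventually_elim simp
    have "(\<forall>\<^sub>F r in sequentially. poly ?R (of_nat r) \<in> S) \<or> (\<forall>\<^sub>F r in sequentially. poly ?R (of_nat r) \<notin> S)"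
    proof (cases ?R rule: rat_poly_trichotomy)
      case pos
      then have "\<forall>\<^sub>F r in sequentially. poly ?R (of_nat r) \<in> S" by eventually_elim (simp add: T)
      then show ?thesis by blast
    next
      case zero
      then show ?thesis by (cases b) (simp_all add: T)
    next
      case neg
      then have "\<forall>\<^sub>F r in sequentially. poly ?R (of_nat r) \<notin> S" by eventually_elim (simp add: T)
      then show ?thesis by blast
    qed
    then show ?thesis
    proof
      assume ev: "\<forall>\<^sub>F r in sequentially. poly ?R (of_nat r) \<in> S"
      then have "z \<in> ?Z" using z by simp
      with ev val show ?thesis by (auto elim: eventually_elim2)
    next
      assume ev: "\<forall>\<^sub>F r in sequentially. poly ?R (of_nat r) \<notin> S"
      have "z \<notin> ?Z"
      proof
        assume "z \<in> ?Z"
        then have "\<forall>\<^sub>F r in sequentially. poly ?R (of_nat r) \<in> S" by simp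
        with ev have "\<forall>\<^sub>F r in sequentially. False" by eventually_elim simp
        then show False by simp
      qed
      with ev val show ?thesis by (auto elim: eventually_elim2)
    qed
  qed
  \<comment> \<open>One \<open>r\<close> serves all of the finitely many diagrams.\<close>
  have "\<exists>r. \<forall>z\<in>A. diagram z \<in> \<D> \<longrightarrow> (z \<in> ?Z \<longleftrightarrow> ?in (diagram z) r)"
  proof -
    let ?D = "\<D> \<inter> diagram ` A"
    have "\<forall>D\<in>?D. \<forall>\<^sub>F r in sequentially. (\<forall>\<^sub>F s in sequentially. ?in D s) \<longleftrightarrow> ?in D r"
      using stable iff by fastforce
    then have "\<forall>\<^sub>F r in sequentially. \<forall>D\<in>?D. (\<forall>\<^sub>F s in sequentially. ?in D s) \<longleftrightarrow> ?in D r"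
      by (intro eventually_ball_finite) (use \<D>(1) in auto)
    then obtain r where "\<forall>D\<in>?D. (\<forall>\<^sub>F s in sequentially. ?in D s) \<longleftrightarrow> ?in D r"
      using eventually_happens'[OF sequentially_bot] by blast
    then show ?thesis using iff by (intro exI[of _ r]) blast
  qed
  then obtain r where r: "\<And>z. z \<in> A \<Longrightarrow> diagram z \<in> \<D> \<Longrightarrow> z \<in> ?Z \<longleftrightarrow> ?in (diagram z) r" by blast
  \<comment> \<open>The condition at \<open>r\<close> is monotone in the count, so it is a lower bound.\<close>
  obtain d :: nat where d: "\<And>n. of_nat n - poly P (of_nat r) \<in> S \<longleftrightarrow> d \<le> n"
  proof -
    define N where "N n \<longleftrightarrow> of_nat n - poly P (of_nat r) \<in> S" for n :: nat
    obtain n0 :: nat where "poly P (of_nat r) < of_nat n0" using reals_Archimedean2 by blast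
    then have n0: "N n0" by (simp add: N_def T)
    have up: "N n" if "N m" "m \<le> n" for m n
    proof -
      have "(of_nat m :: rat) \<le> of_nat n" using that(2) by simp
      then show ?thesis using that(1) by (auto simp: N_def T)
    qed
    have least: "N n \<longleftrightarrow> (LEAST n. N n) \<le> n" for n
      using up[OF LeastI[of N, OF n0]] Least_le[of N n] by blast
    show ?thesis by (rule that[of "LEAST n. N n"]) (fold N_def, rule least)
  qed
  obtain F where F: "\<forall>f\<in>F. locally_analytic A f"
    "\<And>z. z \<in> A \<Longrightarrow> d \<le> hilbert_count (diagram z) r \<longleftrightarrow> z \<in> zero_set A F"
    using hilbert_count_upper_semicontinuous[of d r] by blast
  have "\<forall>\<^sub>F z in nhds a. z \<in> A \<longrightarrow> (z \<in> ?Z \<longleftrightarrow> z \<in> zero_set A F)"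
    using \<D>(2) by eventually_elim (use r d F(2) in blast)
  then show "\<exists>F. (\<forall>f\<in>F. locally_analytic A f) \<and>
      (\<forall>\<^sub>F z in nhds a. z \<in> A \<longrightarrow> (z \<in> ?Z \<longleftrightarrow> z \<in> zero_set A F))"
    using F(1) by blast
qed

text \<open>Equality with \<open>P\<close> means being at least but not greater than \<open>P\<close>.\<close>

lemma constructible_level_set:
  "constructible_in A {a \<in> A. hilbert_polynomial a = P}"
proof -
  let ?Z = "\<lambda>S. {a \<in> A. \<forall>\<^sub>F r in sequentially. poly (hilbert_polynomial a - P) (of_nat r) \<in> S}"
  have "closed_analytic_in A (?Z {0..})"
    by (rule closed_analytic_superlevel[where b = True]) auto
  moreover have "closed_analytic_in A (?Z {0<..})"
    by (rule closed_analytic_superlevel[where b = False]) auto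
  moreover have "{a \<in> A. hilbert_polynomial a = P} = ?Z {0..} - ?Z {0<..}"
  proof (intro equalityI subsetI)
    fix a assume "a \<in> {a \<in> A. hilbert_polynomial a = P}"
    then show "a \<in> ?Z {0..} - ?Z {0<..}" by simp
  next
    fix a assume a: "a \<in> ?Z {0..} - ?Z {0<..}"
    show "a \<in> {a \<in> A. hilbert_polynomial a = P}"
    proof (cases "hilbert_polynomial a - P" rule: rat_poly_trichotomy)
      case pos
      then have "a \<in> ?Z {0<..}" using a by simp
      then show ?thesis using a by blast
    next
      case zero
      then show ?thesis using a by simp
    next
      case neg
      have "\<forall>\<^sub>F r in sequentially. poly (hilbert_polynomial a - P) (of_nat r) \<ge> 0" using a by simp
      with neg have "\<forall>\<^sub>F r in sequentially. False" by eventually_elim linarith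
      then show ?thesis by simp
    qed
  qed
  ultimately have "locally_closed_in A {a \<in> A. hilbert_polynomial a = P}"
    unfolding locally_closed_in_def by blast
  then show ?thesis
    unfolding constructible_in_def by (intro exI[of _ "{{a \<in> A. hilbert_polynomial a = P}}"]) simp
qed

end

theorem proposition4p2p1:
  fixes A :: "(complex ^ 'm::finite) set" and X :: "(complex ^ 'n::finite) set"
    and \<rho> :: "'m \<Rightarrow> real" and \<sigma> :: "'n \<Rightarrow> real"
    and J :: "(complex ^ ('m + 'n) \<Rightarrow> complex) set"
  assumes "\<And>i. 0 < \<rho> i" and "A = polydisk \<rho>"
    and "\<And>j. 0 < \<sigma> j" and "X = polydisk \<sigma>"
    and "ideal J (analytic_functions (vec_Times A X))"
  shows "\<forall>E \<in> A // {(a, a'). a \<in> A \<and> a' \<in> A \<and>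
             HSP (germ_ideal (specialize X J a)) = HSP (germ_ideal (specialize X J a'))}.
           constructible_in A E"
proof
  interpret parametrized_ideal A X J
  proof (rule parametrized_ideal.intro)
    show "open A" "open X" "open (vec_Times A X)"
      unfolding assms(2,4) vec_Times_polydisk by (rule open_polydisk)+
    show "0 \<in> X" using assms(3) by (simp add: assms(4) polydisk_def)
  qed (rule assms(5))
  fix E assume "E \<in> A // {(a, a'). a \<in> A \<and> a' \<in> A \<and> hilbert_polynomial a = hilbert_polynomial a'}"
  then obtain a where "a \<in> A"
    "E = {(a, a'). a \<in> A \<and> a' \<in> A \<and> hilbert_polynomial a = hilbert_polynomial a'} `` {a}"
    by (rule quotientE)
  then have "E = {a' \<in> A. hilbert_polynomial a' = hilbert_polynomial a}" by auto
  then show "constructible_in A E" using constructible_level_set by simp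
qed

end
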